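(* Let $M$ be a quaternionic manifold of real dimension $4n$. For an integer $k$ with $0\le k\le 2n-1$ consider the complex $$0\to C^\infty(E_{2k,0})\xrightarrow{\mathcal{D}}C^\infty(E_{2k+1,1})\xrightarrow{\mathcal{D}}C^\infty(E_{2k+2,2})\xrightarrow{\mathcal{D}}\cdots\xrightarrow{\mathcal{D}}C^\infty(E_{2n+k,2n-k})\xrightarrow{\mathcal{D}}0 .$$ (i) If $2k\ge 4$, the complex is elliptic everywhere except at $E_{2k,0}$ and $E_{2k+1,1}$, where it is not elliptic. (ii) If $k=1$, the complex is elliptic everywhere except at $E_{3,1}$, where it is not elliptic. (iii) If $k=0$, the complex is elliptic everywhere.
   Context: A quaternionic manifold is, for $n\ge 2$, a real $4n$-manifold $M$ with an $\mathrm{Sp}(1)\mathrm{GL}(n,\mathbb{H})$-structure $Q$ admitting a torsion-free connection; here $\mathrm{Sp}(1)\mathrm{GL}(n,\mathbb{H})=\mathrm{Sp}(1)\times_{\mathbb{Z}_2}\mathrm{GL}(n,\mathbb{H})\subset \mathrm{GL}(4n,\mathbb{R})$ acts on $\mathbb{H}^n$, with $\mathrm{Sp}(1)$ the unit quaternions acting by left multiplication and $\mathrm{GL}(n,\mathbb{H})$ acting by right multiplication by quaternionic matrices. For $n=1$ a quaternionic manifold means a self-dual conformal 4-manifold (with the induced $\mathrm{Sp}(1)\mathrm{GL}(1,\mathbb{H})$-structure). The structure gives locally defined almost complex structures $I,J,K$ with $IJ=K$, well defined up to rotation. They act on $T^*M$ (with $IJ=K$ there too) and, extended by derivations, on $\Lambda^kT^*M$,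 giving an action of $\mathfrak{sp}(1)=\langle I,J,K\rangle$. The Casimir operator $I^2+J^2+K^2$ on $\Lambda^kT^*M$ is globally well defined. $E_{k,r}\subset\Lambda^kT^*M$ is the subbundle consisting of the $\mathrm{Sp}(1)$-representations with highest weight $r$ (copies of $V_r=S^r(\mathbb{C}^2)$); equivalently, the eigenbundle of $I^2+J^2+K^2$ on $\Lambda^kT^*M$ with eigenvalue $-r(r+2)$. One has $\Lambda^kT^*M=\bigoplus_{r=0}^kE_{k,r}$. Let $\pi_{k,r}:\Lambda^kT^*M\to E_{k,r}$ be the natural projection and $\mathcal{D}=\pi_{k+1,r+1}\circ d:C^\infty(E_{k,r})\to C^\infty(E_{k+1,r+1})$; these operators satisfy $\mathcal{D}^2=0$. A complex of first-order differential operators $\cdots\to C^\infty(F_{i-1})\xrightarrow{\Phi_i}C^\infty(F_i)\xrightarrow{\Phi_{i+1}}C^\infty(F_{i+1})\to\cdots$ between vector bundles is elliptic at $F_i$ if the principal symbol sequence $F_{i-1}\xrightarrow{\sigma_{\Phi_i}}F_i\xrightarrow{\sigma_{\Phi_{i+1}}}F_{i+1}$ is exact at $F_i$ for all $x\in M$ and all nonzero $\xi\in T^*_xM$. The principal symbol of $\mathcal{D}$ on $E_{k,r}$ is $\sigma_{\mathcal{D}}(x,\xi)\alpha=\pi_{k+1,r+1}(\alpha\wedge\xi)$. *)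

theory Defs
  imports "HOL-Analysis.Analysis"
begin

section \<open>Quaternions and the group Sp(1)GL(n,H)\<close>

text \<open>The quaternion \<open>a + b i + c j + d k\<close> is \<open>vector [a, b, c, d]\<close>. An element of
  \<open>H\<^sup>n\<close> is a row vector, on which unit quaternions act from the left and quaternionic
  matrices from the right.\<close>

type_synonym quat = "real^4"
type_synonym 'n qvec = "quat^'n"
type_synonym 'n qmat = "quat^'n^'n"

definition qmult :: "quat \<Rightarrow> quat \<Rightarrow> quat" where
  "qmult p q = vector
    [p$1 * q$1 - p$2 * q$2 - p$3 * q$3 - p$4 * q$4,
     p$1 * q$2 + p$2 * q$1 + p$3 * q$4 - p$4 * q$3,
     p$1 * q$3 - p$2 * q$4 + p$3 * q$1 + p$4 * q$2,
     p$1 * q$4 + p$2 * q$3 - p$3 * q$2 + p$4 * q$1]"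

definition q1 :: quat where "q1 = vector [1, 0, 0, 0]"
definition qi :: quat where "qi = vector [0, 1, 0, 0]"
definition qj :: quat where "qj = vector [0, 0, 1, 0]"
definition qk :: quat where "qk = vector [0, 0, 0, 1]"

lemma quat_nth [simp]:
  "(vector [a, b, c, d] :: quat) $ 1 = a" "(vector [a, b, c, d] :: quat) $ 2 = b"
  "(vector [a, b, c, d] :: quat) $ 3 = c" "(vector [a, b, c, d] :: quat) $ 4 = d"
  by (simp_all add: vector_def)

lemma quat_units:
  "qmult qi qi = - q1" "qmult qj qj = - q1" "qmult qk qk = - q1"
  "qmult qi qj = qk" "qmult qj qk = qi" "qmult qk qi = qj"
  "qmult q1 q = q" "qmult q q1 = q"
  by (simp_all add: qmult_def q1_def qi_def qj_def qk_def vec_eq_iff forall_4)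

lemma qmult_assoc: "qmult (qmult p q) r = qmult p (qmult q r)"
  by (simp add: qmult_def vec_eq_iff forall_4 algebra_simps)

definition lmul :: "quat \<Rightarrow> 'n::finite qvec \<Rightarrow> 'n qvec" where
  "lmul q v = (\<chi> j. qmult q (v $ j))"

definition rmul :: "'n::finite qvec \<Rightarrow> 'n qmat \<Rightarrow> 'n qvec" where
  "rmul v A = (\<chi> j. \<Sum>i\<in>UNIV. qmult (v $ i) (A $ i $ j))"

definition qmat_mult :: "'n::finite qmat \<Rightarrow> 'n qmat \<Rightarrow> 'n qmat" where
  "qmat_mult A B = (\<chi> i j. \<Sum>l\<in>UNIV. qmult (A $ i $ l) (B $ l $ j))"

definition qmat_one :: "'n::finite qmat" where
  "qmat_one = (\<chi> i j. if i = j then q1 else 0)"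

definition GLnH :: "'n::finite qmat set" where
  "GLnH = {A. \<exists>B. qmat_mult A B = qmat_one \<and> qmat_mult B A = qmat_one}"

definition Sp1GLnH :: "('n::finite qvec \<Rightarrow> 'n qvec) set" where
  "Sp1GLnH = {\<lambda>v. rmul (lmul q v) A | q A. norm q = 1 \<and> A \<in> GLnH}"

text \<open>The Lie algebra \<open>sp(1) + gl(n,H)\<close> as endomorphisms of \<open>H\<^sup>n\<close>; \<open>sp(1)\<close> consists of the
  imaginary quaternions.\<close>

definition sp1_glnH :: "('n::finite qvec \<Rightarrow> 'n qvec) set" where
  "sp1_glnH = {\<lambda>v. lmul p v + rmul v B | p B. p $ 1 = 0}"


section \<open>Smooth manifolds modelled on \<open>H\<^sup>n\<close>\<close>

primrec times_differentiable_on ::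
    "nat \<Rightarrow> 'v::real_normed_vector set \<Rightarrow> ('v \<Rightarrow> 'w::real_normed_vector) \<Rightarrow> bool" where
  "times_differentiable_on 0 S f \<longleftrightarrow> continuous_on S f"
| "times_differentiable_on (Suc m) S f \<longleftrightarrow>
     (\<forall>x\<in>S. f differentiable (at x)) \<and>
     (\<forall>v. times_differentiable_on m S (\<lambda>x. frechet_derivative f (at x) v))"

text \<open>Only used for open \<open>S\<close> in a finite-dimensional space, where it is the usual \<open>C\<^sup>\<infinity>\<close>.\<close>

definition smooth_on :: "'v::euclidean_space set \<Rightarrow> ('v \<Rightarrow> 'w::real_normed_vector) \<Rightarrow> bool" where
  "smooth_on S f \<longleftrightarrow> (\<forall>m. times_differentiable_on m S f)"

type_synonym ('a, 'n) chart = "'a set \<times> ('a \<Rightarrow> 'n qvec)"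

definition chart_inv :: "('a, 'n::finite) chart \<Rightarrow> 'n qvec \<Rightarrow> 'a" where
  "chart_inv c = inv_into (fst c) (snd c)"

text \<open>The manifold is the whole (Hausdorff, second countable) type \<open>'a\<close>; it is nonempty and has
  real dimension \<open>4 CARD('n)\<close>.\<close>

definition smooth_atlas ::
    "('a::{t2_space, second_countable_topology}, 'n::finite) chart set \<Rightarrow> bool" where
  "smooth_atlas A \<longleftrightarrow>
     (\<Union>c\<in>A. fst c) = UNIV \<and>
     (\<forall>c\<in>A. open (fst c) \<and> open (snd c ` fst c) \<and>
        homeomorphism (fst c) (snd c ` fst c) (snd c) (chart_inv c)) \<and>
     (\<forall>c\<in>A. \<forall>c'\<in>A. smooth_on (snd c ` (fst c \<inter> fst c')) (snd c' \<circ> chart_inv c))"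

text \<open>Every point \<open>x\<close> gets a preferred chart \<open>chart_at A x\<close>, and \<open>T\<^sub>xM\<close> is identified with the
  model space \<open>H\<^sup>n\<close> by means of this chart. Thus the same type carries all the tangent spaces, but
  components at different points may refer to different charts; to speak about the smoothness of a
  field one first passes to components in one fixed chart \<open>c\<close>, using the derivatives of the
  coordinate changes.\<close>

definition chart_at :: "('a, 'n::finite) chart set \<Rightarrow> 'a \<Rightarrow> ('a, 'n) chart" where
  "chart_at A x = (SOME c. c \<in> A \<and> x \<in> fst c)"

definition coord_at :: "('a, 'n::finite) chart set \<Rightarrow> 'a \<Rightarrow> 'n qvec" where
  "coord_at A x = snd (chart_at A x) x"

definition coord_change ::
    "('a, 'n::finite) chart \<Rightarrow> ('a, 'n) chart \<Rightarrow> 'a \<Rightarrow> 'n qvec \<Rightarrow> 'n qvec" where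
  "coord_change c c' x = frechet_derivative (snd c' \<circ> chart_inv c) (at (snd c x))"

definition fun_in_chart ::
    "('a, 'n::finite) chart \<Rightarrow> ('a \<Rightarrow> real) \<Rightarrow> 'n qvec \<Rightarrow> real" where
  "fun_in_chart c f = (\<lambda>p. f (chart_inv c p))"

definition field_in_chart ::
    "('a, 'n::finite) chart set \<Rightarrow> ('a, 'n) chart \<Rightarrow> ('a \<Rightarrow> 'n qvec) \<Rightarrow> 'n qvec \<Rightarrow> 'n qvec" where
  "field_in_chart A c X = (\<lambda>p. let y = chart_inv c p in coord_change (chart_at A y) c y (X y))"

definition smooth_fun ::
    "('a, 'n::finite) chart set \<Rightarrow> 'a set \<Rightarrow> ('a \<Rightarrow> real) \<Rightarrow> bool" where
  "smooth_fun A U f \<longleftrightarrow> (\<forall>c\<in>A. smooth_on (snd c ` (fst c \<inter> U)) (fun_in_chart c f))"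

definition smooth_field ::
    "('a, 'n::finite) chart set \<Rightarrow> 'a set \<Rightarrow> ('a \<Rightarrow> 'n qvec) \<Rightarrow> bool" where
  "smooth_field A U X \<longleftrightarrow> (\<forall>c\<in>A. smooth_on (snd c ` (fst c \<inter> U)) (field_in_chart A c X))"

definition differential ::
    "('a, 'n::finite) chart set \<Rightarrow> ('a \<Rightarrow> real) \<Rightarrow> 'a \<Rightarrow> 'n qvec \<Rightarrow> real" where
  "differential A f x = frechet_derivative (fun_in_chart (chart_at A x) f) (at (coord_at A x))"

definition lie_bracket ::
    "('a, 'n::finite) chart set \<Rightarrow> ('a \<Rightarrow> 'n qvec) \<Rightarrow> ('a \<Rightarrow> 'n qvec) \<Rightarrow> 'a \<Rightarrow> 'n qvec" where
  "lie_bracket A X Y x =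
     frechet_derivative (field_in_chart A (chart_at A x) Y) (at (coord_at A x)) (X x) -
     frechet_derivative (field_in_chart A (chart_at A x) X) (at (coord_at A x)) (Y x)"


section \<open>Quaternionic manifolds\<close>

text \<open>A \<open>Sp(1)GL(n,H)\<close>-structure is given by its set \<open>Q x\<close> of adapted frames \<open>H\<^sup>n \<Rightarrow> T\<^sub>xM\<close> at each
  point \<open>x\<close>.\<close>

type_synonym ('a, 'n) frames = "'a \<Rightarrow> ('n qvec \<Rightarrow> 'n qvec) set"

definition smooth_frame ::
    "('a, 'n::finite) chart set \<Rightarrow> ('a, 'n) frames \<Rightarrow> 'a set \<Rightarrow> ('a \<Rightarrow> 'n qvec \<Rightarrow> 'n qvec) \<Rightarrow> bool" where
  "smooth_frame A Q U e \<longleftrightarrow> (\<forall>y\<in>U. e y \<in> Q y) \<and> (\<forall>u. smooth_field A U (\<lambda>y. e y u))"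

definition Sp1GLnH_structure ::
    "('a::topological_space, 'n::finite) chart set \<Rightarrow> ('a, 'n) frames \<Rightarrow> bool" where
  "Sp1GLnH_structure A Q \<longleftrightarrow>
     (\<forall>x. \<exists>e. linear e \<and> bij e \<and> Q x = {e \<circ> g | g. g \<in> Sp1GLnH}) \<and>
     (\<forall>x. \<exists>U e. open U \<and> x \<in> U \<and> smooth_frame A Q U e)"

text \<open>\<open>D v Y x\<close> is the covariant derivative at \<open>x\<close> of the vector field \<open>Y\<close>, defined near \<open>x\<close>, in the
  direction \<open>v \<in> T\<^sub>xM\<close>. Fields defined on an open set \<open>U\<close> are total functions whose values outside
  \<open>U\<close> are irrelevant.\<close>

type_synonym ('a, 'n) connection = "'n qvec \<Rightarrow> ('a \<Rightarrow> 'n qvec) \<Rightarrow> 'a \<Rightarrow> 'n qvec"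

definition connection ::
    "('a::topological_space, 'n::finite) chart set \<Rightarrow> ('a, 'n) connection \<Rightarrow> bool" where
  "connection A D \<longleftrightarrow> (\<forall>U. open U \<longrightarrow>
     (\<forall>x\<in>U. \<forall>Y. smooth_field A U Y \<longrightarrow> linear (\<lambda>v. D v Y x)) \<and>
     (\<forall>x\<in>U. \<forall>v Y Z. smooth_field A U Y \<and> smooth_field A U Z \<longrightarrow>
        D v (\<lambda>y. Y y + Z y) x = D v Y x + D v Z x) \<and>
     (\<forall>x\<in>U. \<forall>v f Y. smooth_fun A U f \<and> smooth_field A U Y \<longrightarrow>
        D v (\<lambda>y. f y *\<^sub>R Y y) x = differential A f x v *\<^sub>R Y x + f x *\<^sub>R D v Y x) \<and>
     (\<forall>x\<in>U. \<forall>v Y Z. smooth_field A U Y \<and> (\<forall>y\<in>U. Y y = Z y) \<longrightarrow> D v Y x = D v Z x) \<and>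
     (\<forall>X Y. smooth_field A U X \<and> smooth_field A U Y \<longrightarrow> smooth_field A U (\<lambda>x. D (X x) Y x)))"

definition torsion_free ::
    "('a::topological_space, 'n::finite) chart set \<Rightarrow> ('a, 'n) connection \<Rightarrow> bool" where
  "torsion_free A D \<longleftrightarrow> (\<forall>U X Y. open U \<and> smooth_field A U X \<and> smooth_field A U Y \<longrightarrow>
     (\<forall>x\<in>U. D (X x) Y x - D (Y x) X x = lie_bracket A X Y x))"

text \<open>\<open>D\<close> is induced by a connection on the principal bundle \<open>Q\<close> iff, with respect to every local
  section of \<open>Q\<close>, its connection form takes values in the Lie algebra.\<close>

definition preserves_structure ::
    "('a::topological_space, 'n::finite) chart set \<Rightarrow> ('a, 'n) frames \<Rightarrow> ('a, 'n) connection \<Rightarrow> bool" where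
  "preserves_structure A Q D \<longleftrightarrow> (\<forall>U e. open U \<and> smooth_frame A Q U e \<longrightarrow>
     (\<forall>x\<in>U. \<forall>v. \<exists>B\<in>sp1_glnH. \<forall>u. D v (\<lambda>y. e y u) x = e x (B u)))"

type_synonym ('a, 'n) metric = "'a \<Rightarrow> 'n qvec \<Rightarrow> 'n qvec \<Rightarrow> real"

definition riemannian_metric ::
    "('a::topological_space, 'n::finite) chart set \<Rightarrow> ('a, 'n) metric \<Rightarrow> bool" where
  "riemannian_metric A g \<longleftrightarrow>
     (\<forall>x. bilinear (g x) \<and> (\<forall>u v. g x u v = g x v u) \<and> (\<forall>u. u \<noteq> 0 \<longrightarrow> g x u u > 0)) \<and>
     (\<forall>U X Y. open U \<and> smooth_field A U X \<and> smooth_field A U Y \<longrightarrow>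
        smooth_fun A U (\<lambda>x. g x (X x) (Y x)))"

definition levi_civita ::
    "('a::topological_space, 'n::finite) chart set \<Rightarrow> ('a, 'n) metric \<Rightarrow> ('a, 'n) connection \<Rightarrow> bool" where
  "levi_civita A g D \<longleftrightarrow> connection A D \<and> torsion_free A D \<and>
     (\<forall>U Y Z. open U \<and> smooth_field A U Y \<and> smooth_field A U Z \<longrightarrow>
        (\<forall>x\<in>U. \<forall>v. differential A (\<lambda>y. g y (Y y) (Z y)) x v = g x (D v Y x) (Z x) + g x (Y x) (D v Z x)))"

definition curvature ::
    "('a, 'n::finite) chart set \<Rightarrow> ('a, 'n) connection \<Rightarrow>
     ('a \<Rightarrow> 'n qvec) \<Rightarrow> ('a \<Rightarrow> 'n qvec) \<Rightarrow> ('a \<Rightarrow> 'n qvec) \<Rightarrow> 'a \<Rightarrow> 'n qvec" where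
  "curvature A D X Y Z x =
     D (X x) (\<lambda>y. D (Y y) Z y) x - D (Y x) (\<lambda>y. D (X y) Z y) x - D (lie_bracket A X Y x) Z x"

text \<open>Components with respect to a local \<open>g\<close>-orthonormal frame \<open>(e b)\<^sub>b\<close>, where \<open>b\<close> ranges over the
  standard basis of the model space. The sign of \<open>riem\<close> is such that \<open>riem a b a b\<close> is the sectional
  curvature. The coefficients in \<open>weyl4\<close> are those of dimension 4.\<close>

definition riem ::
    "('a, 'n::finite) chart set \<Rightarrow> ('a, 'n) metric \<Rightarrow> ('a, 'n) connection \<Rightarrow> ('a \<Rightarrow> 'n qvec \<Rightarrow> 'n qvec) \<Rightarrow>
     'a \<Rightarrow> 'n qvec \<Rightarrow> 'n qvec \<Rightarrow> 'n qvec \<Rightarrow> 'n qvec \<Rightarrow> real" where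
  "riem A g D e x a b c d =
     g x (curvature A D (\<lambda>y. e y a) (\<lambda>y. e y b) (\<lambda>y. e y d) x) (e x c)"

definition ricci ::
    "('a, 'n::finite) chart set \<Rightarrow> ('a, 'n) metric \<Rightarrow> ('a, 'n) connection \<Rightarrow> ('a \<Rightarrow> 'n qvec \<Rightarrow> 'n qvec) \<Rightarrow>
     'a \<Rightarrow> 'n qvec \<Rightarrow> 'n qvec \<Rightarrow> real" where
  "ricci A g D e x a c = (\<Sum>b\<in>Basis. riem A g D e x a b c b)"

definition scal ::
    "('a, 'n::finite) chart set \<Rightarrow> ('a, 'n) metric \<Rightarrow> ('a, 'n) connection \<Rightarrow> ('a \<Rightarrow> 'n qvec \<Rightarrow> 'n qvec) \<Rightarrow>
     'a \<Rightarrow> real" where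
  "scal A g D e x = (\<Sum>a\<in>Basis. ricci A g D e x a a)"

definition weyl4 ::
    "('a, 'n::finite) chart set \<Rightarrow> ('a, 'n) metric \<Rightarrow> ('a, 'n) connection \<Rightarrow> ('a \<Rightarrow> 'n qvec \<Rightarrow> 'n qvec) \<Rightarrow>
     'a \<Rightarrow> 'n qvec \<Rightarrow> 'n qvec \<Rightarrow> 'n qvec \<Rightarrow> 'n qvec \<Rightarrow> real" where
  "weyl4 A g D e x a b c d = riem A g D e x a b c d
     - (ricci A g D e x a c * (b \<bullet> d) - ricci A g D e x a d * (b \<bullet> c)
        + ricci A g D e x b d * (a \<bullet> c) - ricci A g D e x b c * (a \<bullet> d)) / 2
     + scal A g D e x / 6 * ((a \<bullet> c) * (b \<bullet> d) - (a \<bullet> d) * (b \<bullet> c))"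

text \<open>A \<open>Sp(1)GL(1,H)\<close>-structure on a 4-manifold is an oriented conformal structure. The orientation
  is the one for which the Kaehler forms \<open>g(I\<cdot>,\<cdot>)\<close>, \<open>g(J\<cdot>,\<cdot>)\<close>, \<open>g(K\<cdot>,\<cdot>)\<close> span the bundle
  \<open>\<Lambda>\<^sup>2\<^sub>-\<close> of anti-self-dual 2-forms (so that the twistor space of a self-dual conformal structure is
  the bundle of the almost complex structures \<open>a I + b J + c K\<close>). Self-duality is the vanishing of
  the restriction \<open>W\<^sub>-\<close> of the Weyl tensor to \<open>\<Lambda>\<^sup>2\<^sub>-\<close>; it depends on \<open>g\<close> only through its
  conformal class. Only used for \<open>CARD('n) = 1\<close>.\<close>

definition self_dual_conformal ::
    "('a::topological_space, 'n::finite) chart set \<Rightarrow> ('a, 'n) frames \<Rightarrow> bool" where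
  "self_dual_conformal A Q \<longleftrightarrow> (\<exists>g D. riemannian_metric A g \<and> levi_civita A g D \<and>
     (\<forall>x. \<forall>e\<in>Q x. \<exists>s>0. \<forall>u v. g x (e u) (e v) = s * (u \<bullet> v)) \<and>
     (\<forall>U e. open U \<and> smooth_frame A Q U e \<and> (\<forall>y\<in>U. \<forall>u v. g y (e y u) (e y v) = u \<bullet> v) \<longrightarrow>
        (\<forall>x\<in>U. \<forall>p\<in>{qi, qj, qk}. \<forall>c\<in>Basis. \<forall>d\<in>Basis.
           (\<Sum>a\<in>Basis. \<Sum>b\<in>Basis. (lmul p a \<bullet> b) * weyl4 A g D e x a b c d) = 0)))"

definition quaternionic_manifold ::
    "('a::{t2_space, second_countable_topology}, 'n::finite) chart set \<Rightarrow> ('a, 'n) frames \<Rightarrow> bool" where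
  "quaternionic_manifold A Q \<longleftrightarrow> smooth_atlas A \<and> Sp1GLnH_structure A Q \<and>
     (if CARD('n) = 1 then self_dual_conformal A Q
      else \<exists>D. connection A D \<and> torsion_free A D \<and> preserves_structure A Q D)"


section \<open>Differential forms\<close>

text \<open>A \<open>k\<close>-form on \<open>T\<^sub>xM\<close> is an alternating multilinear function of \<open>k\<close> vectors, presented as a
  function on lists that vanishes on lists of length other than \<open>k\<close>.\<close>

type_synonym 'n form = "'n qvec list \<Rightarrow> real"

definition alt_forms :: "nat \<Rightarrow> 'n::finite form set" where
  "alt_forms k = {\<alpha>. (\<forall>vs. length vs \<noteq> k \<longrightarrow> \<alpha> vs = 0) \<and>
     (\<forall>vs i. length vs = k \<and> i < k \<longrightarrow> linear (\<lambda>v. \<alpha> (vs[i := v]))) \<and>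
     (\<forall>vs i j. length vs = k \<and> i < j \<and> j < k \<and> vs ! i = vs ! j \<longrightarrow> \<alpha> vs = 0)}"

definition form_in_chart ::
    "('a, 'n::finite) chart set \<Rightarrow> ('a, 'n) chart \<Rightarrow> ('a \<Rightarrow> 'n form) \<Rightarrow> 'n qvec \<Rightarrow> 'n form" where
  "form_in_chart A c \<omega> = (\<lambda>p vs. let y = chart_inv c p in \<omega> y (map (coord_change c (chart_at A y) y) vs))"

definition smooth_form ::
    "('a, 'n::finite) chart set \<Rightarrow> 'a set \<Rightarrow> ('a \<Rightarrow> 'n form) \<Rightarrow> bool" where
  "smooth_form A U \<omega> \<longleftrightarrow>
     (\<forall>c\<in>A. \<forall>vs. smooth_on (snd c ` (fst c \<inter> U)) (\<lambda>p. form_in_chart A c \<omega> p vs))"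

text \<open>\<open>(d\<omega>)(v\<^sub>0,\<dots>,v\<^sub>k) = \<Sum>\<^sub>i (-1)\<^sup>i \<partial>\<^bsub>v\<^sub>i\<^esub> \<omega>(v\<^sub>0,\<dots>,\<close> (omit \<open>v\<^sub>i\<close>) \<open>\<dots>,v\<^sub>k)\<close>, computed in the
  preferred chart.\<close>

definition ext_deriv :: "('a, 'n::finite) chart set \<Rightarrow> ('a \<Rightarrow> 'n form) \<Rightarrow> 'a \<Rightarrow> 'n form" where
  "ext_deriv A \<omega> x vs = (\<Sum>i<length vs. (-1) ^ i *
     frechet_derivative (\<lambda>p. form_in_chart A (chart_at A x) \<omega> p (take i vs @ drop (Suc i) vs))
       (at (coord_at A x)) (vs ! i))"


section \<open>The bundles \<open>E\<^bsub>k,r\<^esub>\<close> and the operators between them\<close>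

text \<open>\<open>L\<close> acts on covectors by \<open>\<alpha> \<mapsto> - \<alpha> \<circ> L\<close>, so that \<open>IJ = K\<close> also holds on \<open>T\<^sup>*M\<close>, and on
  forms by derivations.\<close>

definition deriv_action :: "('n::finite qvec \<Rightarrow> 'n qvec) \<Rightarrow> 'n form \<Rightarrow> 'n form" where
  "deriv_action L \<alpha> vs = - (\<Sum>i<length vs. \<alpha> (vs[i := L (vs ! i)]))"

definition frame_acs :: "('n::finite qvec \<Rightarrow> 'n qvec) \<Rightarrow> quat \<Rightarrow> 'n qvec \<Rightarrow> 'n qvec" where
  "frame_acs e p = e \<circ> lmul p \<circ> inv e"

definition casimir :: "('n::finite qvec \<Rightarrow> 'n qvec) \<Rightarrow> 'n form \<Rightarrow> 'n form" where
  "casimir e \<alpha> vs = (\<Sum>p\<in>{qi, qj, qk}. deriv_action (frame_acs e p) (deriv_action (frame_acs e p) \<alpha>) vs)"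

text \<open>The Casimir operator does not depend on the choice of the adapted frame \<open>e \<in> Q x\<close>.\<close>

definition E_bundle :: "('a, 'n::finite) frames \<Rightarrow> nat \<Rightarrow> nat \<Rightarrow> 'a \<Rightarrow> 'n form set" where
  "E_bundle Q k r x = {\<alpha> \<in> alt_forms k.
     \<forall>e\<in>Q x. \<forall>vs. casimir e \<alpha> vs = - (real r * (real r + 2)) * \<alpha> vs}"

text \<open>The projection along \<open>\<Lambda>\<^sup>kT\<^sup>*M = \<Oplus>\<^bsub>r\<le>k\<^esub> E\<^bsub>k,r\<^esub>\<close>: the \<open>r\<close>-th term of the unique
  decomposition.\<close>

definition E_proj :: "('a, 'n::finite) frames \<Rightarrow> nat \<Rightarrow> nat \<Rightarrow> 'a \<Rightarrow> 'n form \<Rightarrow> 'n form" where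
  "E_proj Q k r x \<alpha> = (THE \<beta>. \<exists>\<gamma>. (\<forall>s. \<gamma> s \<in> E_bundle Q k s x) \<and>
     (\<forall>vs. \<alpha> vs = (\<Sum>s\<le>k. \<gamma> s vs)) \<and> \<beta> = \<gamma> r)"

text \<open>The operator from sections of \<open>E\<^bsub>k,r\<^esub>\<close> to sections of \<open>E\<^bsub>k+1,r+1\<^esub>\<close>.\<close>

definition D_op ::
    "('a, 'n::finite) chart set \<Rightarrow> ('a, 'n) frames \<Rightarrow> nat \<Rightarrow> nat \<Rightarrow> ('a \<Rightarrow> 'n form) \<Rightarrow> 'a \<Rightarrow> 'n form" where
  "D_op A Q k r \<omega> x = E_proj Q (k + 1) (r + 1) x (ext_deriv A \<omega> x)"


section \<open>Principal symbols and ellipticity\<close>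

definition smooth_section ::
    "('a, 'n::finite) chart set \<Rightarrow> ('a \<Rightarrow> 'n form set) \<Rightarrow> 'a set \<Rightarrow> ('a \<Rightarrow> 'n form) \<Rightarrow> bool" where
  "smooth_section A F U s \<longleftrightarrow> smooth_form A U s \<and> (\<forall>y\<in>U. s y \<in> F y)"

text \<open>For a first-order operator \<open>\<Phi>\<close> on sections of \<open>F\<close>, the symbol is
  \<open>\<sigma>(x, df\<^sub>x)(s x) = \<Phi>(f s)(x)\<close> for functions \<open>f\<close> with \<open>f x = 0\<close>. As \<open>\<Phi>\<close> is local, \<open>f\<close> and \<open>s\<close>
  need only be defined near \<open>x\<close>. For \<open>\<Phi> = d\<close> this yields \<open>\<alpha> \<mapsto> \<xi> \<and> \<alpha>\<close>, which agrees with
  \<open>\<alpha> \<and> \<xi>\<close> up to the sign \<open>(-1)\<^sup>k\<close>.\<close>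

definition principal_symbol ::
    "('a::topological_space, 'n::finite) chart set \<Rightarrow> ('a \<Rightarrow> 'n form set) \<Rightarrow>
     (('a \<Rightarrow> 'n form) \<Rightarrow> 'a \<Rightarrow> 'n form) \<Rightarrow> 'a \<Rightarrow> ('n qvec \<Rightarrow> real) \<Rightarrow> 'n form \<Rightarrow> 'n form" where
  "principal_symbol A F \<Phi> x \<xi> \<alpha> = (THE \<beta>. \<forall>U f s.
     open U \<and> x \<in> U \<and> smooth_fun A U f \<and> f x = 0 \<and> differential A f x = \<xi> \<and>
     smooth_section A F U s \<and> s x = \<alpha> \<longrightarrow> \<Phi> (\<lambda>y vs. f y * s y vs) x = \<beta>)"

text \<open>A complex consists of bundles \<open>F i\<close> and operators \<open>\<Phi> i\<close> from sections of \<open>F (i - 1)\<close> to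
  sections of \<open>F i\<close>.\<close>

definition elliptic_at ::
    "('a::topological_space, 'n::finite) chart set \<Rightarrow> (int \<Rightarrow> 'a \<Rightarrow> 'n form set) \<Rightarrow>
     (int \<Rightarrow> ('a \<Rightarrow> 'n form) \<Rightarrow> 'a \<Rightarrow> 'n form) \<Rightarrow> int \<Rightarrow> bool" where
  "elliptic_at A F \<Phi> i \<longleftrightarrow> (\<forall>x \<xi>. linear \<xi> \<and> \<xi> \<noteq> (\<lambda>v. 0) \<longrightarrow>
     principal_symbol A (F (i - 1)) (\<Phi> i) x \<xi> ` F (i - 1) x =
       {\<alpha> \<in> F i x. principal_symbol A (F i) (\<Phi> (i + 1)) x \<xi> \<alpha> = (\<lambda>vs. 0)})"

text \<open>The complex \<open>0 \<rightarrow> E\<^bsub>2k,0\<^esub> \<rightarrow> E\<^bsub>2k+1,1\<^esub> \<rightarrow> \<dots> \<rightarrow> E\<^bsub>2n+k,2n-k\<^esub> \<rightarrow> 0\<close>, with \<open>E\<^bsub>2k+i,i\<^esub>\<close>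
  in position \<open>i\<close>.\<close>

definition quat_bundle :: "('a, 'n::finite) frames \<Rightarrow> nat \<Rightarrow> int \<Rightarrow> 'a \<Rightarrow> 'n form set" where
  "quat_bundle Q k i = (if 0 \<le> i \<and> i \<le> 2 * int CARD('n) - int k
     then E_bundle Q (2 * k + nat i) (nat i) else (\<lambda>x. {\<lambda>vs. 0}))"

definition quat_op ::
    "('a, 'n::finite) chart set \<Rightarrow> ('a, 'n) frames \<Rightarrow> nat \<Rightarrow> int \<Rightarrow> ('a \<Rightarrow> 'n form) \<Rightarrow> 'a \<Rightarrow> 'n form" where
  "quat_op A Q k i = (if 1 \<le> i \<and> i \<le> 2 * int CARD('n) - int k
     then D_op A Q (2 * k + nat (i - 1)) (nat (i - 1)) else (\<lambda>\<omega> x vs. 0))"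

end

theory Submission
  imports Defs
begin

text \<open>Ellipticity is a statement about the principal symbols at one point \<open>x\<close>. The symbol of \<open>D\<close> at a
  covector \<open>\<xi>\<close> is \<open>\<alpha> \<mapsto> \<pi>(\<xi> \<and> \<alpha>)\<close> (\<open>principal_symbol_D_op\<close>). As the symbol is a description of
  the values on sections through \<open>\<alpha>\<close>, this needs a smooth section of \<open>E\<^bsub>k,r\<^esub>\<close> through every
  element of its fibre; such a section is transported by a smooth adapted frame
  (\<open>E_section_through\<close>). What remains is multilinear algebra on \<open>V = T\<^sub>xM\<close> with \<open>I\<close>, \<open>J\<close>, \<open>K\<close>.

  On complex-valued forms \<open>D\<^sub>I, D\<^sub>J, D\<^sub>K\<close> span an sl(2) with operators \<open>H, X, Y\<close>, and \<open>E\<^bsub>m,r\<^esub>\<close>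
  is the part of highest weight \<open>r\<close> in degree \<open>m\<close>. Its elements are the
  \<open>\<Sum>\<^bsub>j\<le>r\<^esub> ((r-j)!/r!) Y\<^sup>j \<phi>\<^sub>j\<close> for unique highest weight vectors \<open>\<phi>\<^sub>0, \<dots>, \<phi>\<^sub>r\<close>
  (\<open>isotypic_eq_assemble\<close>, \<open>assemble_eq_0\<close>); think of the polynomial
  \<open>\<phi>(z) = \<Sum>\<^sub>j \<phi>\<^sub>j z\<^sub>1\<^bsup>r-j\<^esup> z\<^sub>2\<^sup>j\<close>. Write \<open>\<xi> = \<xi>\<^sub>1 + Y \<xi>\<^sub>2\<close> with two covectors \<open>\<xi>\<^sub>1, \<xi>\<^sub>2\<close> of
  weight 1. With the normalisation above, \<open>\<pi>(\<xi> \<and> \<cdot>)\<close> becomes multiplication of the polynomial by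
  \<open>z\<^sub>1 \<xi>\<^sub>1 + z\<^sub>2 \<xi>\<^sub>2\<close>, that is \<open>\<phi>\<^sub>j \<mapsto> \<xi>\<^sub>1 \<and> \<phi>\<^sub>j + \<xi>\<^sub>2 \<and> \<phi>\<^bsub>j-1\<^esub>\<close> (\<open>wedge_assemble\<close>). If
  the coefficients are arbitrary forms instead of highest weight vectors, this Koszul type complex is
  exact in all polynomial degrees \<open>r \<ge> 1\<close>, by contraction with vectors dual to \<open>\<xi>\<^sub>1\<close> and
  \<open>\<xi>\<^sub>2\<close> (\<open>koszul_exact\<close>). A primitive \<open>g\<close> of a cycle of highest weight vectors has \<open>X g\<close> closed,
  hence exact if its polynomial degree \<open>r - 1\<close> is positive; as \<open>X\<close> is onto in positive weights,
  \<open>g\<close> can be corrected to a primitive with \<open>X g = 0\<close> (\<open>seqs_exact\<close>). This gives exactness for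
  \<open>r \<ge> 2\<close>. For \<open>k = 0\<close> also \<open>r = 1\<close> is fine, because \<open>X g\<close> would have a weight larger than its
  degree. At the end of the complex the symbol is onto since forms with degree plus weight above
  \<open>dim V\<close> vanish (\<open>Deg_top\<close>).

  At position 0 the symbol is \<open>\<alpha> \<mapsto> \<xi> \<and> \<alpha>\<close> on invariant forms. If it kills \<open>\<alpha>\<close>, then \<open>\<alpha>\<close> is
  divisible by \<open>\<xi>\<^sub>1\<close> and \<open>\<xi>\<^sub>2\<close>, which forces \<open>\<alpha> = 0\<close> in degrees 0 and 2
  (\<open>wedge_injective_low_degree\<close>). In all even degrees \<open>2j\<close> with \<open>4 \<le> 2j \<le> 4n\<close> there is an
  invariant form \<open>b \<noteq> 0\<close> with \<open>\<xi> \<and> b = 0\<close>, a multiple of the volume form of the quaternionic line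
  of \<open>\<xi>\<close> (\<open>real_invariant_form_exists\<close>). For \<open>j = k \<ge> 2\<close> it lies in the kernel at position 0. For
  \<open>j = k + 1 \<ge> 2\<close> its contraction \<open>f\<close> with a vector \<open>u\<close>, \<open>\<xi>(u) = 1\<close>, breaks exactness at position 1:
  \<open>\<xi> \<and> f = b\<close> is invariant, so \<open>f\<close> is in the kernel, but \<open>\<xi> \<and> f \<noteq> 0\<close>, so \<open>f\<close> is not of the
  form \<open>\<xi> \<and> g\<close>.\<close>

section \<open>Representations of sl(2)\<close>

text \<open>Expanding small integer multiples lets the simplifier decide identities between sums of operators
  by associativity and commutativity alone.\<close>

lemma scaleR_small:
  fixes x :: "'f::real_vector"
  shows "2 *\<^sub>R x = x + x" "4 *\<^sub>R x = x + x + x + x" "8 *\<^sub>R x = x + x + x + x + x + x + x + x"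
proof -
  have e: "(2::real) = 1 + 1" "(4::real) = 1 + 1 + 1 + 1" "(8::real) = 1 + 1 + 1 + 1 + 1 + 1 + 1 + 1" by simp_all
  show "2 *\<^sub>R x = x + x" "4 *\<^sub>R x = x + x + x + x" "8 *\<^sub>R x = x + x + x + x + x + x + x + x"
    unfolding e by (simp_all only: scaleR_add_left scaleR_one)
qed

lemma scaleR_times_2: "(c * 2) *\<^sub>R x = c *\<^sub>R x + c *\<^sub>R (x :: 'f::real_vector)"
  by (simp flip: scaleR_left_distrib)

locale sl2 =
  fixes H X Y :: "'f::real_vector \<Rightarrow> 'f"
  assumes linear_H: "linear H" and linear_X: "linear X" and linear_Y: "linear Y"
    and HX: "H (X a) = X (H a) + 2 *\<^sub>R X a"
    and HY: "H (Y a) = Y (H a) - 2 *\<^sub>R Y a"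
    and XY: "X (Y a) = Y (X a) + H a"
begin

lemmas H_simps = linear_0[OF linear_H] linear_add[OF linear_H] linear_diff[OF linear_H]
  linear_neg[OF linear_H] linear_scale[OF linear_H] linear_sum[OF linear_H]
lemmas X_simps = linear_0[OF linear_X] linear_add[OF linear_X] linear_diff[OF linear_X]
  linear_neg[OF linear_X] linear_scale[OF linear_X] linear_sum[OF linear_X]
lemmas Y_simps = linear_0[OF linear_Y] linear_add[OF linear_Y] linear_diff[OF linear_Y]
  linear_neg[OF linear_Y] linear_scale[OF linear_Y] linear_sum[OF linear_Y]
lemmas sl2_simps = H_simps X_simps Y_simps

text \<open>The Casimir element in normal order. For \<open>H\<close>, \<open>X\<close>, \<open>Y\<close> built from \<open>I\<close>, \<open>J\<close>, \<open>K\<close> as below it is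
  \<open>I\<^sup>2 + J\<^sup>2 + K\<^sup>2\<close>; this explains the sign.\<close>

definition Cas :: "'f \<Rightarrow> 'f" where
  "Cas a = - H (H a) - 2 *\<^sub>R H a - 4 *\<^sub>R Y (X a)"

lemma linear_Cas: "linear Cas"
  by (rule linearI) (simp_all add: Cas_def sl2_simps algebra_simps)

lemma H_Cas: "H (Cas a) = Cas (H a)"
  by (simp add: Cas_def sl2_simps HX HY algebra_simps)

lemma X_Cas: "X (Cas a) = Cas (X a)"
  by (simp add: Cas_def sl2_simps HX HY XY scaleR_small algebra_simps)

lemma Y_Cas: "Y (Cas a) = Cas (Y a)"
  by (simp add: Cas_def sl2_simps HX HY XY scaleR_small algebra_simps)

text \<open>Real values of \<open>r\<close> are allowed so that \<open>r - 1\<close> makes sense for \<open>r = 0\<close>.\<close>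

definition isotypic :: "real \<Rightarrow> 'f set" where
  "isotypic r = {a. Cas a = - (r * (r + 2)) *\<^sub>R a}"

definition weight_space :: "real \<Rightarrow> 'f set" where
  "weight_space h = {a. H a = h *\<^sub>R a}"

lemma isotypicD: "a \<in> isotypic r \<Longrightarrow> Cas a = - (r * (r + 2)) *\<^sub>R a"
  by (simp add: isotypic_def)

lemma weightD: "a \<in> weight_space h \<Longrightarrow> H a = h *\<^sub>R a"
  by (simp add: weight_space_def)

lemma subspace_isotypic: "subspace (isotypic r)"
  by (auto simp: subspace_def isotypic_def linear_0[OF linear_Cas] linear_add[OF linear_Cas]
      linear_scale[OF linear_Cas] scaleR_add_right)

lemma subspace_weight: "subspace (weight_space h)"
  by (auto simp: subspace_def weight_space_def H_simps algebra_simps)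

lemma isotypic_H: "a \<in> isotypic r \<Longrightarrow> H a \<in> isotypic r"
  and isotypic_X: "a \<in> isotypic r \<Longrightarrow> X a \<in> isotypic r"
  and isotypic_Y: "a \<in> isotypic r \<Longrightarrow> Y a \<in> isotypic r"
  by (simp_all add: isotypic_def flip: H_Cas X_Cas Y_Cas)
     (simp_all add: sl2_simps)

lemma weight_X: "a \<in> weight_space h \<Longrightarrow> X a \<in> weight_space (h + 2)"
  and weight_Y: "a \<in> weight_space h \<Longrightarrow> Y a \<in> weight_space (h - 2)"
  by (simp_all add: weight_space_def HX HY sl2_simps algebra_simps)

lemma isotypic_Ypow: "a \<in> isotypic r \<Longrightarrow> (Y ^^ j) a \<in> isotypic r"
  by (induction j) (auto intro: isotypic_Y)

lemma isotypic_Xpow: "a \<in> isotypic r \<Longrightarrow> (X ^^ j) a \<in> isotypic r"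
  by (induction j) (auto intro: isotypic_X)

lemma weight_Ypow: "a \<in> weight_space h \<Longrightarrow> (Y ^^ j) a \<in> weight_space (h - 2 * real j)"
proof (induction j)
  case (Suc j)
  show ?case using weight_Y[OF Suc.IH[OF Suc.prems]] by (simp add: algebra_simps)
qed simp

lemma weight_Xpow: "a \<in> weight_space h \<Longrightarrow> (X ^^ j) a \<in> weight_space (h + 2 * real j)"
proof (induction j)
  case (Suc j)
  show ?case using weight_X[OF Suc.IH[OF Suc.prems]] by (simp add: algebra_simps)
qed simp

lemma YX_isotypic:
  assumes "a \<in> isotypic r" "a \<in> weight_space h"
  shows "Y (X a) = ((r - h) * (r + h + 2) / 4) *\<^sub>R a"
proof -
  have "4 *\<^sub>R Y (X a) = - Cas a - H (H a) - 2 *\<^sub>R H a"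
    by (simp add: Cas_def)
  also have "\<dots> = (r * (r + 2) - h * h - 2 * h) *\<^sub>R a"
    using weightD[OF assms(2)] unfolding isotypicD[OF assms(1)]
    by (simp add: H_simps scaleR_diff_left mult.commute)
  finally have "(1/4) *\<^sub>R 4 *\<^sub>R Y (X a) = (1/4) *\<^sub>R (r * (r + 2) - h * h - 2 * h) *\<^sub>R a" by simp
  moreover have "(1/4) * (r * (r + 2) - h * h - 2 * h) = (r - h) * (r + h + 2) / 4"
    by (simp add: field_simps)
  ultimately show ?thesis by simp
qed

lemma XY_isotypic:
  assumes "a \<in> isotypic r" "a \<in> weight_space h"
  shows "X (Y a) = ((r + h) * (r - h + 2) / 4) *\<^sub>R a"
proof -
  have "X (Y a) = ((r - h) * (r + h + 2) / 4 + h) *\<^sub>R a"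
    using YX_isotypic[OF assms] weightD[OF assms(2)] by (simp add: XY scaleR_add_left)
  also have "(r - h) * (r + h + 2) / 4 + h = (r + h) * (r - h + 2) / 4" by (simp add: field_simps)
  finally show ?thesis .
qed

text \<open>If \<open>X a = 0\<close>, the Casimir eigenvalue determines the weight up to \<open>r \<leftrightarrow> -r-2\<close>, which excludes weights
  above \<open>r\<close>; a nilpotent \<open>X\<close> reduces every \<open>a\<close> to this case.\<close>

lemma isotypic_high_weight_zero:
  assumes "a \<in> isotypic r" "a \<in> weight_space h" "h > r" "r \<ge> 0" "(X ^^ N) a = 0"
  shows "a = 0"
  using assms
proof (induction N arbitrary: a h)
  case (Suc N)
  have "(X ^^ N) (X a) = 0" using Suc.prems(5) by (simp add: funpow_swap1)
  then have "X a = 0"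
    using Suc.IH[OF isotypic_X[OF Suc.prems(1)] weight_X[OF Suc.prems(2)]] Suc.prems by simp
  then show ?case
    using YX_isotypic[OF Suc.prems(1,2)] Suc.prems(3,4) by (simp add: Y_simps)
qed simp

lemma isotypic_low_weight_zero:
  assumes "a \<in> isotypic r" "a \<in> weight_space h" "h < - r" "r \<ge> 0" "(Y ^^ N) a = 0"
  shows "a = 0"
  using assms
proof (induction N arbitrary: a h)
  case (Suc N)
  have "(Y ^^ N) (Y a) = 0" using Suc.prems(5) by (simp add: funpow_swap1)
  then have "Y a = 0"
    using Suc.IH[OF isotypic_Y[OF Suc.prems(1)] weight_Y[OF Suc.prems(2)]] Suc.prems by simp
  then show ?case
    using XY_isotypic[OF Suc.prems(1,2)] Suc.prems(3,4) by (simp add: X_simps)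
qed simp

lemma X_Ypow: "(X ^^ Suc N) (Y a) = Y ((X ^^ Suc N) a)
    + (real N + 1) *\<^sub>R (H ((X ^^ N) a) - real N *\<^sub>R (X ^^ N) a)"
proof (induction N)
  case (Suc N)
  have "(X ^^ Suc (Suc N)) (Y a) = X ((X ^^ Suc N) (Y a))" by simp
  also have "\<dots> = X (Y ((X ^^ Suc N) a) + (real N + 1) *\<^sub>R (H ((X ^^ N) a) - real N *\<^sub>R (X ^^ N) a))"
    by (simp only: Suc.IH)
  also have "\<dots> = Y ((X ^^ Suc (Suc N)) a)
    + (real (Suc N) + 1) *\<^sub>R (H ((X ^^ Suc N) a) - real (Suc N) *\<^sub>R (X ^^ Suc N) a)"
    by (simp add: sl2_simps XY HX scaleR_small scaleR_times_2 algebra_simps)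
  finally show ?case .
qed (simp add: XY sl2_simps)

lemma linear_Xpow: "linear (X ^^ N)"
proof (induction N)
  case 0 show ?case by (simp add: linear_iff)
next
  case (Suc N)
  show ?case using linear_compose[OF Suc.IH linear_X] by (simp add: o_def linear_iff)
qed

lemma linear_Ypow: "linear (Y ^^ N)"
proof (induction N)
  case 0 show ?case by (simp add: linear_iff)
next
  case (Suc N)
  show ?case using linear_compose[OF Suc.IH linear_Y] by (simp add: o_def linear_iff)
qed

text \<open>\<open>X Y\<close> acts on the top step of the \<open>X\<close>-filtration by the positive scalar \<open>(N + 1) (h + N)\<close>. Thus
  \<open>X Y a - c a\<close> is killed by a lower power of \<open>X\<close>, and induction applies.\<close>

lemma X_surj_positive_weight:
  assumes "subspace S" "\<And>a. a \<in> S \<Longrightarrow> X a \<in> S" "\<And>a. a \<in> S \<Longrightarrow> Y a \<in> S"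
    and "a \<in> weight_space h" "h \<ge> 1" "a \<in> S" "(X ^^ N) a = 0"
  shows "\<exists>w\<in>S \<inter> weight_space (h - 2). a = X w"
  using assms(4-7)
proof (induction N arbitrary: a)
  case 0
  then show ?case
    using subspace_0[OF assms(1)] subspace_0[OF subspace_weight]
    by (intro bexI[of _ 0]) (auto simp: X_simps)
next
  case (Suc N)
  define c where "c = (real N + 1) * (h + real N)"
  have c: "c > 0" using Suc.prems(2) by (simp add: c_def)
  have XN: "(X ^^ N) a \<in> weight_space (h + 2 * real N)"
    by (rule weight_Xpow[OF Suc.prems(1)])
  have linN: "linear (X ^^ N)" by (rule linear_Xpow)
  have "X (Y a) - c *\<^sub>R a \<in> weight_space h"
    using weight_X[OF weight_Y[OF Suc.prems(1)]] Suc.prems(1)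
    by (simp add: subspace_diff subspace_scale subspace_weight)
  moreover have "X (Y a) - c *\<^sub>R a \<in> S"
    using assms(1-3) Suc.prems(3) by (simp add: subspace_diff subspace_scale)
  moreover have "(X ^^ N) (X (Y a) - c *\<^sub>R a) = 0"
  proof -
    have "(X ^^ N) (X (Y a)) = (X ^^ Suc N) (Y a)" by (simp add: funpow_swap1)
    also have "\<dots> = c *\<^sub>R (X ^^ N) a"
      unfolding X_Ypow using Suc.prems(4) weightD[OF XN]
      by (simp add: c_def Y_simps flip: scaleR_diff_left)
    finally show ?thesis by (simp add: linear_diff[OF linN] linear_scale[OF linN])
  qed
  ultimately obtain w where w: "w \<in> S" "w \<in> weight_space (h - 2)" "X (Y a) - c *\<^sub>R a = X w"
    using Suc.IH[of "X (Y a) - c *\<^sub>R a"] Suc.prems(2) by blast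
  have "c *\<^sub>R a = X (Y a - w)" using w(3) by (simp add: X_simps algebra_simps)
  then have "a = X ((1 / c) *\<^sub>R (Y a - w))"
    using c by (simp only: linear_scale[OF linear_X] \<open>c *\<^sub>R a = _\<close>[symmetric]) simp
  moreover have "(1 / c) *\<^sub>R (Y a - w) \<in> S \<inter> weight_space (h - 2)"
    using w assms(1,3) Suc.prems(3) weight_Y[OF Suc.prems(1)]
    by (simp add: subspace_diff subspace_scale subspace_weight)
  ultimately show ?case by blast
qed

definition hw_vectors :: "real \<Rightarrow> 'f set" where
  "hw_vectors r = {a. X a = 0 \<and> H a = r *\<^sub>R a}"

lemma hw_vectors_weight: "a \<in> hw_vectors r \<Longrightarrow> a \<in> weight_space r"
  by (simp add: hw_vectors_def weight_space_def)

lemma hw_vectors_isotypic: "a \<in> hw_vectors r \<Longrightarrow> a \<in> isotypic r"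
  by (simp add: hw_vectors_def isotypic_def Cas_def sl2_simps algebra_simps)

lemma subspace_hw_vectors: "subspace (hw_vectors r)"
  by (auto simp: subspace_def hw_vectors_def sl2_simps algebra_simps)

lemma X_Y_hw_vectors: "a \<in> hw_vectors r \<Longrightarrow> X ((Y ^^ Suc j) a) = ((real j + 1) * (r - real j)) *\<^sub>R (Y ^^ j) a"
proof -
  assume a: "a \<in> hw_vectors r"
  have "(r + (r - 2 * real j)) * (r - (r - 2 * real j) + 2) / 4 = (real j + 1) * (r - real j)"
    by (simp add: field_simps)
  then show ?thesis
    using XY_isotypic[OF isotypic_Ypow[OF hw_vectors_isotypic[OF a]] weight_Ypow[OF hw_vectors_weight[OF a]], of j] by simp
qed

lemma Xpow_Ypow_hw_vectors:
  assumes "a \<in> hw_vectors (real r)" "j \<le> r"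
  shows "(X ^^ j) ((Y ^^ j) a) = (fact j * fact r / fact (r - j)) *\<^sub>R a"
  using assms(2)
proof (induction j)
  case (Suc j)
  have *: "r - j = Suc (r - Suc j)" using Suc.prems by simp
  have "(X ^^ Suc j) ((Y ^^ Suc j) a) = (X ^^ j) (X ((Y ^^ Suc j) a))" by (simp add: funpow_swap1)
  also have "\<dots> = ((real j + 1) * (real r - real j)) *\<^sub>R ((fact j * fact r / fact (r - j)) *\<^sub>R a)"
    using Suc by (simp only: X_Y_hw_vectors[OF assms(1)] linear_scale[OF linear_Xpow] Suc.IH)
  also have "\<dots> = (fact (Suc j) * fact r / fact (r - Suc j)) *\<^sub>R a"
    using Suc.prems by (simp add: * of_nat_diff field_simps)
  finally show ?case .
qed simp

lemma Ypow_Xpow_isotypic: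
  assumes "a \<in> isotypic (real r)" "a \<in> weight_space (real r - 2 * real j)" "j \<le> r"
  shows "(Y ^^ j) ((X ^^ j) a) = (fact j * fact r / fact (r - j)) *\<^sub>R a"
  using assms
proof (induction j arbitrary: a)
  case (Suc j)
  have *: "r - j = Suc (r - Suc j)" using Suc.prems by simp
  have Xa: "X a \<in> weight_space (real r - 2 * real j)"
    using weight_X[OF Suc.prems(2)] by (simp add: algebra_simps)
  have "(Y ^^ Suc j) ((X ^^ Suc j) a) = Y ((Y ^^ j) ((X ^^ j) (X a)))" by (simp add: funpow_swap1)
  also have "\<dots> = (fact j * fact r / fact (r - j)) *\<^sub>R Y (X a)"
    using Suc.IH[OF isotypic_X[OF Suc.prems(1)] Xa] Suc.prems(3) by (simp add: Y_simps)
  also have "\<dots> = (fact j * fact r / fact (r - j) * ((real j + 1) * (real r - real j))) *\<^sub>R a"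
  proof -
    have "(real r - (real r - 2 * real (Suc j))) * (real r + (real r - 2 * real (Suc j)) + 2) / 4
        = (real j + 1) * (real r - real j)" by (simp add: field_simps)
    then show ?thesis using YX_isotypic[OF Suc.prems(1,2)] by simp
  qed
  also have "(fact j * fact r / fact (r - j)) * ((real j + 1) * (real r - real j))
      = fact (Suc j) * fact r / fact (r - Suc j)"
    using Suc.prems by (simp add: * of_nat_diff field_simps)
  finally show ?case .
qed simp

text \<open>The factor \<open>(r-j)!/r!\<close> is chosen so that wedging with a covector takes a form without
  binomial coefficients on the sequences \<open>\<phi>\<close>.\<close>

definition assemble :: "nat \<Rightarrow> (nat \<Rightarrow> 'f) \<Rightarrow> 'f" where
  "assemble r \<phi> = (\<Sum>j\<le>r. (fact (r - j) / fact r) *\<^sub>R (Y ^^ j) (\<phi> j))"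

lemma assemble_isotypic:
  "(\<And>j. j \<le> r \<Longrightarrow> \<phi> j \<in> hw_vectors (real r)) \<Longrightarrow> assemble r \<phi> \<in> isotypic (real r)"
  unfolding assemble_def
  by (intro subspace_sum subspace_isotypic subspace_scale isotypic_Ypow hw_vectors_isotypic) auto

end

text \<open>Independence of eigenvectors: applying \<open>T - \<mu> t\<close> removes the \<open>t\<close>-th summand.\<close>

lemma eigen_sum_zero:
  fixes T :: "'f::real_vector \<Rightarrow> 'f" and \<mu> :: "'i \<Rightarrow> real"
  assumes "linear T" "finite S" "inj_on \<mu> S" "\<And>s. s \<in> S \<Longrightarrow> T (\<gamma> s) = \<mu> s *\<^sub>R \<gamma> s"
    and "(\<Sum>s\<in>S. \<gamma> s) = 0" "s \<in> S"
  shows "\<gamma> s = 0"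
  using assms(2-6)
proof (induction S arbitrary: \<gamma> s rule: finite_induct)
  case (insert t S)
  define \<delta> where "\<delta> s = (\<mu> s - \<mu> t) *\<^sub>R \<gamma> s" for s
  have T: "T (\<delta> s) = \<mu> s *\<^sub>R \<delta> s" if "s \<in> S" for s
    using insert.prems(2)[of s] that by (simp add: \<delta>_def linear_scale[OF assms(1)])
  have "(\<Sum>s\<in>insert t S. \<delta> s) = (\<Sum>s\<in>insert t S. T (\<gamma> s)) - \<mu> t *\<^sub>R (\<Sum>s\<in>insert t S. \<gamma> s)"
    unfolding scaleR_sum_right sum_subtractf[symmetric]
    by (intro sum.cong) (auto simp: \<delta>_def insert.prems(2) scaleR_diff_left)
  also have "\<dots> = 0"
    by (simp only: linear_sum[OF assms(1), symmetric] insert.prems(3) linear_0[OF assms(1)]) simp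
  finally have "(\<Sum>s\<in>S. \<delta> s) = 0" using insert.hyps by (simp add: \<delta>_def)
  then have \<delta>0: "\<delta> s = 0" if "s \<in> S" for s
    using insert.IH[of \<delta> s] T that insert.prems(1) by (auto simp: inj_on_def)
  have 0: "\<gamma> s = 0" if "s \<in> S" for s
  proof -
    have "\<mu> s \<noteq> \<mu> t" using that insert.prems(1) insert.hyps by (metis inj_onD insertCI)
    then show ?thesis using \<delta>0[OF that] by (simp add: \<delta>_def)
  qed
  moreover have "\<gamma> t = 0" using insert.prems(3) insert.hyps 0 by simp
  ultimately show ?case using insert.prems(4) by blast
qed simp

context sl2 begin

lemma assemble_eq_0:
  assumes "\<And>j. j \<le> r \<Longrightarrow> \<phi> j \<in> hw_vectors (real r)" "assemble r \<phi> = 0" "j \<le> r"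
  shows "\<phi> j = 0"
proof -
  have "(fact (r - j) / fact r) *\<^sub>R (Y ^^ j) (\<phi> j) = 0"
  proof (rule eigen_sum_zero[OF linear_H, of "{..r}" "\<lambda>j. real r - 2 * real j"])
    show "H ((fact (r - i) / fact r) *\<^sub>R (Y ^^ i) (\<phi> i)) =
       (real r - 2 * real i) *\<^sub>R (fact (r - i) / fact r) *\<^sub>R (Y ^^ i) (\<phi> i)" if "i \<in> {..r}" for i
      using weightD[OF weight_Ypow[OF hw_vectors_weight[OF assms(1)[of i]], of i]] that by (simp add: H_simps)
    show "(\<Sum>i\<le>r. (fact (r - i) / fact r) *\<^sub>R (Y ^^ i) (\<phi> i)) = 0"
      using assms(2) by (simp add: assemble_def)
  qed (use assms(3) in \<open>auto simp: inj_on_def\<close>)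
  then have "(X ^^ j) ((Y ^^ j) (\<phi> j)) = 0" by (simp add: linear_0[OF linear_Xpow])
  then show ?thesis using Xpow_Ypow_hw_vectors[OF assms(1)[OF assms(3)] assms(3)] by simp
qed

end

primrec shift_prod :: "('f::real_vector \<Rightarrow> 'f) \<Rightarrow> real list \<Rightarrow> 'f \<Rightarrow> 'f" where
  "shift_prod T [] a = a"
| "shift_prod T (s # ss) a = shift_prod T ss (T a - s *\<^sub>R a)"

text \<open>Lagrange interpolation, one root at a time. The subspace \<open>S\<close> keeps the eigenvectors in one degree and in
  one isotypic part.\<close>

lemma eigen_decomposition:
  fixes T :: "'f::real_vector \<Rightarrow> 'f"
  assumes "linear T" "subspace S" "\<And>a. a \<in> S \<Longrightarrow> T a \<in> S"
    and "distinct ss" "shift_prod T ss a = 0" "a \<in> S"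
  shows "\<exists>\<gamma>. (\<forall>s. \<gamma> s \<in> S \<and> T (\<gamma> s) = s *\<^sub>R \<gamma> s) \<and> a = (\<Sum>s\<in>set ss. \<gamma> s)"
  using assms(4-6)
proof (induction ss arbitrary: a)
  case Nil
  then show ?case
    by (intro exI[of _ "\<lambda>_. 0"]) (auto simp: linear_0[OF assms(1)] subspace_0[OF assms(2)])
next
  case (Cons t ss)
  have "T a - t *\<^sub>R a \<in> S" using assms(2,3) Cons.prems by (simp add: subspace_diff subspace_scale)
  then obtain \<gamma> where \<gamma>: "\<And>s. \<gamma> s \<in> S" "\<And>s. T (\<gamma> s) = s *\<^sub>R \<gamma> s" "T a - t *\<^sub>R a = (\<Sum>s\<in>set ss. \<gamma> s)"
    using Cons.IH[of "T a - t *\<^sub>R a"] Cons.prems by auto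
  \<comment> \<open>On the \<open>s\<close>-eigenspace \<open>T - t\<close> is the scalar \<open>s - t\<close>, so dividing by it lifts the decomposition of
    \<open>T a - t a\<close> up to a \<open>t\<close>-eigenvector \<open>b\<close>.\<close>
  define b where "b = a - (\<Sum>s\<in>set ss. (1 / (s - t)) *\<^sub>R \<gamma> s)"
  have b: "b \<in> S" unfolding b_def
    using assms(2) Cons.prems \<gamma>(1) by (intro subspace_diff subspace_sum subspace_scale) auto
  have "T b - t *\<^sub>R b = (T a - t *\<^sub>R a) - (\<Sum>s\<in>set ss. T ((1 / (s - t)) *\<^sub>R \<gamma> s) - t *\<^sub>R (1 / (s - t)) *\<^sub>R \<gamma> s)"
    unfolding b_def linear_diff[OF assms(1)] linear_sum[OF assms(1)] sum_subtractf
      scaleR_sum_right[symmetric] scaleR_diff_right by simp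
  also have "(\<Sum>s\<in>set ss. T ((1 / (s - t)) *\<^sub>R \<gamma> s) - t *\<^sub>R (1 / (s - t)) *\<^sub>R \<gamma> s)
     = (\<Sum>s\<in>set ss. ((s - t) / (s - t)) *\<^sub>R \<gamma> s)"
  proof (intro sum.cong refl)
    fix s
    have "1 / (s - t) * s - t * (1 / (s - t)) = (s - t) / (s - t)" by (cases "s = t") (simp_all flip: diff_divide_distrib)
    then show "T ((1 / (s - t)) *\<^sub>R \<gamma> s) - t *\<^sub>R (1 / (s - t)) *\<^sub>R \<gamma> s = ((s - t) / (s - t)) *\<^sub>R \<gamma> s"
      by (simp only: linear_scale[OF assms(1)] \<gamma>(2) scaleR_scaleR flip: scaleR_diff_left)
  qed
  also have "(\<Sum>s\<in>set ss. ((s - t) / (s - t)) *\<^sub>R \<gamma> s) = (\<Sum>s\<in>set ss. \<gamma> s)"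
    using Cons.prems(1) by (intro sum.cong) auto
  also have "T a - t *\<^sub>R a - sum \<gamma> (set ss) = 0" using \<gamma>(3) by simp
  finally have Tb: "T b = t *\<^sub>R b" by simp
  define \<gamma>' where "\<gamma>' s = (if s = t then b else (1 / (s - t)) *\<^sub>R \<gamma> s)" for s
  have "(\<Sum>s\<in>set (t # ss). \<gamma>' s) = b + (\<Sum>s\<in>set ss. (1 / (s - t)) *\<^sub>R \<gamma> s)"
  proof -
    have "(\<Sum>s\<in>set (t # ss). \<gamma>' s) = \<gamma>' t + (\<Sum>s\<in>set ss. \<gamma>' s)" using Cons.prems(1) by simp
    also have "(\<Sum>s\<in>set ss. \<gamma>' s) = (\<Sum>s\<in>set ss. (1 / (s - t)) *\<^sub>R \<gamma> s)"
      using Cons.prems(1) by (intro sum.cong) (auto simp: \<gamma>'_def)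
    finally show ?thesis by (simp add: \<gamma>'_def)
  qed
  then have "a = (\<Sum>s\<in>set (t # ss). \<gamma>' s)" by (simp add: b_def)
  moreover have "\<gamma>' s \<in> S \<and> T (\<gamma>' s) = s *\<^sub>R \<gamma>' s" for s
    using b Tb \<gamma>(1,2) assms(2) by (auto simp: \<gamma>'_def subspace_scale linear_scale[OF assms(1)])
  ultimately show ?case by blast
qed

section \<open>Exactness of the symbol sequence in representation-theoretic form\<close>

context sl2 begin

text \<open>Operators that behave like wedging with a covector of weight 1: \<open>x\<close> is a highest weight vector of
  weight 1 for the adjoint action, so \<open>[Y, [Y, x]] = 0\<close>.\<close>

definition highest_operator :: "('f \<Rightarrow> 'f) \<Rightarrow> bool" where
  "highest_operator x \<longleftrightarrow> linear x \<and> (\<forall>a. X (x a) = x (X a)) \<and> (\<forall>a. H (x a) = x (H a) + x a) \<and>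
     (\<forall>a. Y (Y (x a)) - 2 *\<^sub>R Y (x (Y a)) + x (Y (Y a)) = 0)"

text \<open>For the wedge with a covector this is the wedge with the image of the covector under \<open>Y\<close>.\<close>

definition lower :: "('f \<Rightarrow> 'f) \<Rightarrow> 'f \<Rightarrow> 'f" where
  "lower x a = Y (x a) - x (Y a)"

text \<open>The component of highest weight \<open>r - 1\<close> in the product of the two-dimensional representation
  spanned by \<open>x\<close> and \<open>[Y, x]\<close> with the one generated by a highest weight vector \<open>a\<close> of weight \<open>r\<close>.\<close>

definition descend :: "real \<Rightarrow> ('f \<Rightarrow> 'f) \<Rightarrow> 'f \<Rightarrow> 'f" where
  "descend r x a = x (Y a) - r *\<^sub>R lower x a"

context
  fixes x assumes x: "highest_operator x"
begin

lemma highest_operator_simps: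
  "x 0 = 0" "x (a + b) = x a + x b" "x (a - b) = x a - x b" "x (- a) = - x a" "x (c *\<^sub>R a) = c *\<^sub>R x a"
  "X (x a) = x (X a)" "H (x a) = x (H a) + x a"
  using x linear_0 linear_add linear_diff linear_neg linear_scale
  unfolding highest_operator_def by metis+

lemma linear_lower: "linear (lower x)"
  by (rule linearI) (simp_all add: lower_def highest_operator_simps Y_simps algebra_simps)

lemma Y_lower: "Y (lower x a) = lower x (Y a)"
proof -
  have "Y (Y (x a)) - 2 *\<^sub>R Y (x (Y a)) + x (Y (Y a)) = 0"
    using x by (simp add: highest_operator_def)
  then show ?thesis by (simp add: lower_def Y_simps scaleR_small algebra_simps)
qed

lemma Y_highest: "Y (x a) = x (Y a) + lower x a"
  by (simp add: lower_def)

lemma Ypow_lower: "(Y ^^ j) (lower x a) = lower x ((Y ^^ j) a)"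
  by (induction j) (simp_all add: Y_lower)

lemma Ypow_highest: "(Y ^^ j) (x a) = x ((Y ^^ j) a) + real j *\<^sub>R lower x ((Y ^^ (j - 1)) a)"
proof (induction j)
  case (Suc j)
  have "(Y ^^ Suc j) (x a) = x ((Y ^^ Suc j) a) + lower x ((Y ^^ j) a) + real j *\<^sub>R lower x (Y ((Y ^^ (j - 1)) a))"
    using Suc by (simp add: Y_simps Y_highest Y_lower)
  also have "real j *\<^sub>R lower x (Y ((Y ^^ (j - 1)) a)) = real j *\<^sub>R lower x ((Y ^^ j) a)"
    by (cases j) auto
  finally show ?case by (simp add: algebra_simps)
qed simp

lemma descend_hw_vectors:
  assumes "a \<in> hw_vectors r"
  shows "descend r x a \<in> hw_vectors (r - 1)"
proof -
  have a: "X a = 0" "H a = r *\<^sub>R a" using assms by (auto simp: hw_vectors_def)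
  have "X (lower x a) = x a"
    by (simp add: lower_def X_simps XY highest_operator_simps a Y_simps)
  moreover have "H (lower x a) = (r - 1) *\<^sub>R lower x a"
    by (simp add: lower_def H_simps HY highest_operator_simps a Y_simps scaleR_small algebra_simps)
  moreover have "X (x (Y a)) = r *\<^sub>R x a"
    by (simp add: XY highest_operator_simps a Y_simps)
  moreover have "H (x (Y a)) = (r - 1) *\<^sub>R x (Y a)"
    by (simp add: HY highest_operator_simps a Y_simps scaleR_small algebra_simps)
  ultimately show ?thesis
    by (simp add: hw_vectors_def descend_def X_simps H_simps scaleR_diff_right mult.commute)
qed

text \<open>The two components of \<open>x \<cdot> Y\<^sup>j a\<close>: one is \<open>Y\<^sup>j\<close> of the highest weight vector \<open>x a\<close>, the
  other is \<open>Y\<^bsup>j-1\<^esup>\<close> of the highest weight vector \<open>descend r x a\<close>.\<close>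

lemma wedge_first_part:
  assumes "r \<ge> 0"
  shows "x ((Y ^^ j) a) - ((r + 1 - real j) / (r + 1)) *\<^sub>R (Y ^^ j) (x a)
    = (real j / (r + 1)) *\<^sub>R (Y ^^ (j - 1)) (descend r x a)"
proof (cases j)
  case (Suc i)
  define u v where "u = x ((Y ^^ j) a)" and "v = lower x ((Y ^^ i) a)"
  have 1: "(Y ^^ j) (x a) = u + real j *\<^sub>R v"
    by (simp only: Ypow_highest u_def v_def) (simp add: Suc)
  have "(Y ^^ i) (x (Y a)) = u + real i *\<^sub>R lower x ((Y ^^ (i - 1)) (Y a))"
    unfolding Ypow_highest u_def by (simp add: Suc funpow_swap1)
  also have "real i *\<^sub>R lower x ((Y ^^ (i - 1)) (Y a)) = real i *\<^sub>R v"
    by (cases i) (auto simp: v_def funpow_swap1)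
  finally have 2: "(Y ^^ (j - 1)) (descend r x a) = u + (real i - r) *\<^sub>R v"
    by (simp add: descend_def Suc linear_diff[OF linear_Ypow] linear_scale[OF linear_Ypow] Ypow_lower
        v_def scaleR_diff_left)
  have c: "1 - (r + 1 - real j) / (r + 1) = real j / (r + 1)"
    "- ((r + 1 - real j) / (r + 1) * real j) = real j / (r + 1) * (real i - r)"
    using assms by (auto simp: Suc field_simps)
  have "x ((Y ^^ j) a) - ((r + 1 - real j) / (r + 1)) *\<^sub>R (Y ^^ j) (x a)
      = (1 - (r + 1 - real j) / (r + 1)) *\<^sub>R u + (- ((r + 1 - real j) / (r + 1) * real j)) *\<^sub>R v"
    unfolding 1 by (simp only: u_def[symmetric] scaleR_add_right scaleR_diff_left scaleR_minus_left scaleR_one scaleR_scaleR) simp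
  then show ?thesis unfolding c 2 by (simp add: scaleR_add_right)
qed (use assms in simp)

text \<open>The same splitting for \<open>[Y, x]\<close> in place of \<open>x\<close>, where \<open>x a\<close> contributes one step lower.\<close>

lemma wedge_second_part:
  assumes "r \<ge> 0"
  shows "lower x ((Y ^^ j) a) - (1 / (r + 1)) *\<^sub>R (Y ^^ Suc j) (x a)
    = - (1 / (r + 1)) *\<^sub>R (Y ^^ j) (descend r x a)"
proof -
  define u v where "u = x ((Y ^^ Suc j) a)" and "v = lower x ((Y ^^ j) a)"
  have 1: "(Y ^^ Suc j) (x a) = u + (real j + 1) *\<^sub>R v"
    unfolding Ypow_highest u_def v_def by (simp add: add.commute)
  have "(Y ^^ j) (x (Y a)) = u + real j *\<^sub>R lower x ((Y ^^ (j - 1)) (Y a))"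
    unfolding Ypow_highest u_def by (simp add: funpow_swap1)
  also have "real j *\<^sub>R lower x ((Y ^^ (j - 1)) (Y a)) = real j *\<^sub>R v"
    by (cases j) (auto simp: v_def funpow_swap1)
  finally have 2: "(Y ^^ j) (descend r x a) = u + (real j - r) *\<^sub>R v"
    by (simp add: descend_def linear_diff[OF linear_Ypow] linear_scale[OF linear_Ypow] Ypow_lower
        v_def scaleR_diff_left)
  have c: "1 - 1 / (r + 1) * (real j + 1) = - (1 / (r + 1)) * (real j - r)"
    using assms by (auto simp: field_simps)
  have "lower x ((Y ^^ j) a) - (1 / (r + 1)) *\<^sub>R (Y ^^ Suc j) (x a)
      = (- (1 / (r + 1))) *\<^sub>R u + (1 - 1 / (r + 1) * (real j + 1)) *\<^sub>R v"
    unfolding 1 by (simp only: v_def[symmetric] scaleR_add_right scaleR_diff_left scaleR_minus_left scaleR_one scaleR_scaleR) simp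
  then show ?thesis unfolding c 2 by (simp add: scaleR_add_right)
qed

end

end

text \<open>The properties of forms that the exactness argument uses. \<open>Deg m\<close> are the forms of degree \<open>m\<close> and
  \<open>top_deg\<close> is the real dimension; \<open>x1\<close>, \<open>x2\<close> are the wedges with \<open>\<xi>\<^sub>1\<close>, \<open>\<xi>\<^sub>2\<close>, and \<open>i1\<close>,
  \<open>i2\<close> the contractions with dual vectors. The assumption \<open>weights\<close> says that \<open>H\<close> is diagonalisable
  on forms of degree \<open>m\<close> with weights among \<open>m, m - 2, \<dots>, - m\<close>, and \<open>top_zero\<close> that a form of type
  \<open>(p, q)\<close> vanishes if \<open>2 p\<close> exceeds the dimension.\<close>

locale sl2_symbol = sl2 H X Y for H X Y :: "'f::real_vector \<Rightarrow> 'f" +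
  fixes Deg :: "nat \<Rightarrow> 'f set" and top_deg :: nat and x1 x2 i1 i2 :: "'f \<Rightarrow> 'f"
  assumes subspace_Deg: "subspace (Deg m)"
    and Deg_H: "a \<in> Deg m \<Longrightarrow> H a \<in> Deg m"
    and Deg_X: "a \<in> Deg m \<Longrightarrow> X a \<in> Deg m"
    and Deg_Y: "a \<in> Deg m \<Longrightarrow> Y a \<in> Deg m"
    and Deg_x1: "a \<in> Deg m \<Longrightarrow> x1 a \<in> Deg (Suc m)"
    and Deg_x2: "a \<in> Deg m \<Longrightarrow> x2 a \<in> Deg (Suc m)"
    and Deg_i1: "a \<in> Deg m \<Longrightarrow> i1 a \<in> Deg (m - 1)"
    and Deg_i2: "a \<in> Deg m \<Longrightarrow> i2 a \<in> Deg (m - 1)"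
    and Deg_0_i1: "a \<in> Deg 0 \<Longrightarrow> i1 a = 0" and Deg_0_i2: "a \<in> Deg 0 \<Longrightarrow> i2 a = 0"
    and weights: "a \<in> Deg m \<Longrightarrow> shift_prod H (map (\<lambda>j. real m - 2 * real j) [0..<Suc m]) a = 0"
    and top_zero: "a \<in> Deg m \<Longrightarrow> a \<in> weight_space h \<Longrightarrow> real m + h > real top_deg \<Longrightarrow> a = 0"
    and x1: "highest_operator x1" and x2: "highest_operator x2"
    and linear_i1: "linear i1" and linear_i2: "linear i2"
    and H_i1: "H (i1 a) = i1 (H a) - i1 a" and H_i2: "H (i2 a) = i2 (H a) - i2 a"
    and x1x1: "x1 (x1 a) = 0" and x2x2: "x2 (x2 a) = 0" and x2x1: "x2 (x1 a) = - x1 (x2 a)"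
    and i1x1: "i1 (x1 a) = a - x1 (i1 a)" and i1x2: "i1 (x2 a) = - x2 (i1 a)"
    and i2x1: "i2 (x1 a) = - x1 (i2 a)" and i2x2: "i2 (x2 a) = a - x2 (i2 a)"
begin

lemmas x1_simps = highest_operator_simps[OF x1]
lemmas x2_simps = highest_operator_simps[OF x2]
lemmas i1_simps = linear_0[OF linear_i1] linear_add[OF linear_i1] linear_diff[OF linear_i1]
  linear_neg[OF linear_i1] linear_scale[OF linear_i1]
lemmas i2_simps = linear_0[OF linear_i2] linear_add[OF linear_i2] linear_diff[OF linear_i2]
  linear_neg[OF linear_i2] linear_scale[OF linear_i2]

lemma shift_prod_weight:
  "a \<in> weight_space h \<Longrightarrow> shift_prod H ss a = prod_list (map (\<lambda>s. h - s) ss) *\<^sub>R a"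
proof (induction ss arbitrary: a)
  case (Cons s ss)
  have "H a - s *\<^sub>R a = (h - s) *\<^sub>R a" using weightD[OF Cons.prems] by (simp add: scaleR_diff_left)
  then show ?case using Cons.IH[of "(h - s) *\<^sub>R a"] Cons.prems
    by (simp add: subspace_scale[OF subspace_weight] mult.commute)
qed simp

lemma weight_bounds:
  assumes "a \<in> Deg m" "a \<in> weight_space h" "\<bar>h\<bar> > real m"
  shows "a = 0"
proof -
  have "prod_list (map (\<lambda>s. h - s) (map (\<lambda>j. real m - 2 * real j) [0..<Suc m])) *\<^sub>R a = 0"
    using weights[OF assms(1)] shift_prod_weight[OF assms(2)] by simp
  moreover have "h - (real m - 2 * real j) \<noteq> 0" if "j < Suc m" for j
  proof -
    have "real j \<le> real m" using that by simp
    then show ?thesis using assms(3) by linarith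
  qed
  then have "0 \<notin> set (map (\<lambda>s. h - s) (map (\<lambda>j. real m - 2 * real j) [0..<Suc m]))"
    unfolding set_map set_upt by (metis (no_types, lifting) atLeastLessThan_iff imageE)
  then have "prod_list (map (\<lambda>s. h - s) (map (\<lambda>j. real m - 2 * real j) [0..<Suc m])) \<noteq> 0"
    by (simp only: prod_list_zero_iff not_False_eq_True)
  ultimately show ?thesis by simp
qed

lemma Deg_Xpow: "a \<in> Deg m \<Longrightarrow> (X ^^ j) a \<in> Deg m"
  by (induction j) (auto intro: Deg_X)

lemma Deg_Ypow: "a \<in> Deg m \<Longrightarrow> (Y ^^ j) a \<in> Deg m"
  by (induction j) (auto intro: Deg_Y)

lemma X_nilpotent:
  assumes "a \<in> Deg m" "a \<in> weight_space h"
  shows "\<exists>N. (X ^^ N) a = 0"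
proof -
  obtain N :: nat where N: "real N > real m + \<bar>h\<bar>" using reals_Archimedean2 by blast
  have "(X ^^ N) a = 0"
    by (rule weight_bounds[OF Deg_Xpow[OF assms(1)] weight_Xpow[OF assms(2)]]) (use N in linarith)
  then show ?thesis ..
qed

lemma Y_nilpotent:
  assumes "a \<in> Deg m" "a \<in> weight_space h"
  shows "\<exists>N. (Y ^^ N) a = 0"
proof -
  obtain N :: nat where N: "real N > real m + \<bar>h\<bar>" using reals_Archimedean2 by blast
  have "(Y ^^ N) a = 0"
    by (rule weight_bounds[OF Deg_Ypow[OF assms(1)] weight_Ypow[OF assms(2)]]) (use N in linarith)
  then show ?thesis ..
qed

text \<open>Sequences of coefficients of polynomials of degree \<open>r\<close> with values in the highest weight vectors. They are
  continued by 0 so that no case distinction at the upper end is needed.\<close>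

definition seqs :: "nat \<Rightarrow> nat \<Rightarrow> (nat \<Rightarrow> 'f) set" where
  "seqs m r = {\<phi>. \<forall>j. \<phi> j \<in> Deg m \<inter> hw_vectors (real r) \<and> (j > r \<longrightarrow> \<phi> j = 0)}"

lemma isotypic_weight_outside:
  assumes "a \<in> Deg m" "a \<in> isotypic (real r)" "a \<in> weight_space h" "\<bar>h\<bar> > real r"
  shows "a = 0"
proof (cases "h > 0")
  case True
  then show ?thesis
    using isotypic_high_weight_zero[OF assms(2,3)] X_nilpotent[OF assms(1,3)] assms(4) by auto
next
  case False
  then show ?thesis
    using isotypic_low_weight_zero[OF assms(2,3)] Y_nilpotent[OF assms(1,3)] assms(4) by auto
qed

text \<open>The weight components of \<open>a\<close> have weights \<open>r - 2j\<close> with \<open>j \<le> r\<close>, and on the \<open>j\<close>-th one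
  \<open>Y\<^sup>j X\<^sup>j\<close> is a nonzero scalar, so it comes from the highest weight vector obtained by \<open>X\<^sup>j\<close>.
  The parity of \<open>m - r\<close> guarantees that \<open>r\<close> is among the weights.\<close>

lemma isotypic_eq_assemble:
  assumes a: "a \<in> Deg m" "a \<in> isotypic (real r)" and m: "m = r + 2 * k"
  shows "\<exists>\<phi>\<in>seqs m r. a = assemble r \<phi>"
proof -
  define ss where "ss = map (\<lambda>j. real m - 2 * real j) [0..<Suc m]"
  have dist: "distinct ss" by (simp add: ss_def distinct_map inj_on_def del: upt_Suc)
  have inv: "H b \<in> Deg m \<inter> isotypic (real r)" if "b \<in> Deg m \<inter> isotypic (real r)" for b
    using that Deg_H isotypic_H by blast
  have sp: "shift_prod H ss a = 0" unfolding ss_def by (rule weights[OF a(1)])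
  obtain \<gamma> where \<gamma>: "\<And>s. \<gamma> s \<in> Deg m" "\<And>s. \<gamma> s \<in> isotypic (real r)" "\<And>s. H (\<gamma> s) = s *\<^sub>R \<gamma> s"
     "a = (\<Sum>s\<in>set ss. \<gamma> s)"
    using eigen_decomposition[OF linear_H subspace_inter[OF subspace_Deg subspace_isotypic] inv dist sp] a
    by auto
  have \<gamma>w: "\<gamma> s \<in> weight_space s" for s using \<gamma>(3) by (simp add: weight_space_def)
  define \<phi> where "\<phi> j = (if j \<le> r then (1 / fact j) *\<^sub>R (X ^^ j) (\<gamma> (real r - 2 * real j)) else 0)" for j
  have hw: "\<phi> j \<in> Deg m \<inter> hw_vectors (real r)" for j
  proof (cases "j \<le> r")
    case True
    let ?b = "(X ^^ j) (\<gamma> (real r - 2 * real j))"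
    have w: "?b \<in> weight_space (real r)" using weight_Xpow[OF \<gamma>w] by (metis diff_add_cancel)
    have "X ?b = 0"
      by (rule isotypic_weight_outside[OF Deg_X[OF Deg_Xpow[OF \<gamma>(1)]] isotypic_X[OF isotypic_Xpow[OF \<gamma>(2)]] weight_X[OF w]])
         simp
    then have "?b \<in> hw_vectors (real r)" using weightD[OF w] by (simp add: hw_vectors_def)
    then show ?thesis using True Deg_Xpow[OF \<gamma>(1)]
      by (auto simp: \<phi>_def intro!: subspace_scale subspace_hw_vectors subspace_Deg)
  next
    case False
    then show ?thesis by (simp add: \<phi>_def subspace_0 subspace_hw_vectors subspace_Deg)
  qed
  have summand: "(fact (r - j) / fact r) *\<^sub>R (Y ^^ j) (\<phi> j) = \<gamma> (real r - 2 * real j)" if "j \<le> r" for j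
    using that Ypow_Xpow_isotypic[OF \<gamma>(2) \<gamma>w that]
    by (simp add: \<phi>_def linear_scale[OF linear_Ypow])
  have "a = (\<Sum>s\<in>(\<lambda>j. real r - 2 * real j) ` {..r}. \<gamma> s)"
    unfolding \<gamma>(4)
  proof (rule sum.mono_neutral_right)
    show "(\<lambda>j. real r - 2 * real j) ` {..r} \<subseteq> set ss"
    proof (clarsimp simp: ss_def simp del: upt_Suc)
      fix j assume "j \<le> r"
      then have "real r - 2 * real j = real m - 2 * real (k + j)" "k + j < Suc m" using m by auto
      then show "real r - 2 * real j \<in> (\<lambda>j. real m - 2 * real j) ` {0..<Suc m}" by force
    qed
    show "\<forall>s\<in>set ss - (\<lambda>j. real r - 2 * real j) ` {..r}. \<gamma> s = 0"
    proof
      fix s assume s: "s \<in> set ss - (\<lambda>j. real r - 2 * real j) ` {..r}"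
      then obtain i where i: "s = real m - 2 * real i" by (auto simp: ss_def simp del: upt_Suc)
      have "\<bar>s\<bar> > real r"
      proof (rule ccontr)
        assume "\<not> \<bar>s\<bar> > real r"
        then have "real i \<ge> real k" "real i \<le> real (k + r)" using i m by auto
        then have "s = real r - 2 * real (i - k)" "i - k \<le> r" using i m by (auto simp: of_nat_diff)
        then show False using s by blast
      qed
      then show "\<gamma> s = 0" by (rule isotypic_weight_outside[OF \<gamma>(1,2) \<gamma>w])
    qed
  qed simp
  also have "\<dots> = (\<Sum>j\<le>r. \<gamma> (real r - 2 * real j))"
    by (subst sum.reindex) (auto simp: inj_on_def)
  also have "\<dots> = assemble r \<phi>"
    unfolding assemble_def by (intro sum.cong) (simp_all add: summand)
  finally have "a = assemble r \<phi>" .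
  moreover have "\<phi> \<in> seqs m r" using hw by (auto simp: seqs_def \<phi>_def)
  ultimately show ?thesis by blast
qed

lemma assemble_seqs:
  assumes "\<phi> \<in> seqs m r"
  shows "assemble r \<phi> \<in> Deg m \<inter> isotypic (real r)"
proof -
  have "\<phi> j \<in> Deg m" "\<phi> j \<in> hw_vectors (real r)" for j using assms by (auto simp: seqs_def)
  then show ?thesis
    by (auto simp: assemble_def intro!: assemble_isotypic[unfolded assemble_def]
      subspace_sum subspace_Deg subspace_scale Deg_Ypow)
qed

text \<open>The wedge with \<open>\<xi> = \<xi>\<^sub>1 + Y \<xi>\<^sub>2\<close>.\<close>

definition wedge :: "'f \<Rightarrow> 'f" where
  "wedge a = x1 a + lower x2 a"

lemma linear_wedge: "linear wedge"
  by (rule linearI) (simp_all add: wedge_def x1_simps linear_add[OF linear_lower[OF x2]]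
      linear_scale[OF linear_lower[OF x2]] algebra_simps)

text \<open>Multiplication of the polynomial with coefficients \<open>\<phi>\<close> by \<open>z\<^sub>1 \<xi>\<^sub>1 + z\<^sub>2 \<xi>\<^sub>2\<close>.\<close>

definition koszul :: "(nat \<Rightarrow> 'f) \<Rightarrow> nat \<Rightarrow> 'f" where
  "koszul \<phi> j = x1 (\<phi> j) + (if j = 0 then 0 else x2 (\<phi> (j - 1)))"

lemma koszul_koszul: "koszul (koszul \<phi>) j = 0"
  by (auto simp: koszul_def x1_simps x2_simps x1x1 x2x2 x2x1)

lemma koszul_diff: "koszul (\<lambda>j. \<phi> j - \<psi> j) j = koszul \<phi> j - koszul \<psi> j"
  by (auto simp: koszul_def x1_simps x2_simps)

lemma koszul_zero: "koszul (\<lambda>j. 0) j = 0"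
  by (simp add: koszul_def x1_simps x2_simps)

lemma X_koszul: "X (koszul \<phi> j) = koszul (\<lambda>j. X (\<phi> j)) j"
  by (auto simp: koszul_def x1_simps x2_simps X_simps)

lemma weight_highest:
  "highest_operator x \<Longrightarrow> a \<in> weight_space h \<Longrightarrow> x a \<in> weight_space (h + 1)"
  by (simp add: weight_space_def highest_operator_simps scaleR_add_left)

lemma hw_vectors_highest: "highest_operator x \<Longrightarrow> a \<in> hw_vectors h \<Longrightarrow> x a \<in> hw_vectors (h + 1)"
  by (simp add: hw_vectors_def highest_operator_simps scaleR_add_left)

lemma weight_koszul:
  "(\<And>j. \<phi> j \<in> weight_space h) \<Longrightarrow> koszul \<phi> j \<in> weight_space (h + 1)"
  by (auto simp: koszul_def intro!: subspace_add subspace_weight weight_highest[OF x1] weight_highest[OF x2] subspace_0)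

lemma Deg_koszul: "(\<And>j. \<phi> j \<in> Deg m) \<Longrightarrow> koszul \<phi> j \<in> Deg (Suc m)"
  by (auto simp: koszul_def intro!: subspace_add subspace_Deg Deg_x1 Deg_x2 subspace_0)

lemma koszul_seqs:
  assumes "\<phi> \<in> seqs m r"
  shows "koszul \<phi> \<in> seqs (Suc m) (Suc r)"
proof -
  have *: "\<phi> j \<in> Deg m" "\<phi> j \<in> hw_vectors (real r)" for j using assms by (auto simp: seqs_def)
  have "koszul \<phi> j \<in> hw_vectors (real (Suc r))" for j
  proof -
    have "koszul \<phi> j \<in> hw_vectors (real r + 1)"
      using * by (auto simp: koszul_def intro!: subspace_add subspace_hw_vectors hw_vectors_highest[OF x1] hw_vectors_highest[OF x2] subspace_0)
    then show ?thesis by (simp add: add.commute)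
  qed
  moreover have "koszul \<phi> j = 0" if "j > Suc r" for j
    using that assms by (auto simp: koszul_def seqs_def x1_simps x2_simps)
  ultimately show ?thesis using Deg_koszul[of \<phi> m, OF *(1)] by (auto simp: seqs_def)
qed

lemma Y_hw_vectors_0:
  assumes "a \<in> Deg m" "a \<in> hw_vectors 0"
  shows "Y a = 0"
  using isotypic_weight_outside[of "Y a" m 0 "-2"] assms Deg_Y isotypic_Y hw_vectors_isotypic hw_vectors_weight weight_Y
  by fastforce

text \<open>The key computation: modulo the part of highest weight \<open>r - 1\<close>, wedging with \<open>\<xi>\<close> is the Koszul
  differential on coefficient sequences. Both error terms are given by \<open>descend\<close>; for \<open>r = 0\<close> they
  vanish because invariant vectors are also killed by \<open>Y\<close>.\<close>

lemma wedge_assemble: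
  assumes \<phi>: "\<phi> \<in> seqs m r"
  shows "wedge (assemble r \<phi>) - assemble (Suc r) (koszul \<phi>) \<in> isotypic (real r - 1)"
    and "r = 0 \<Longrightarrow> wedge (assemble r \<phi>) = assemble (Suc r) (koszul \<phi>)"
proof -
  have hw: "\<phi> j \<in> Deg m" "\<phi> j \<in> hw_vectors (real r)" for j using \<phi> by (auto simp: seqs_def)
  have beyond: "\<phi> (Suc r) = 0" using \<phi> by (auto simp: seqs_def)
  define c where "c j = (fact (r - j) / fact r :: real)" for j
  define b1 where "b1 j = x1 ((Y ^^ j) (\<phi> j)) - ((real r + 1 - real j) / (real r + 1)) *\<^sub>R (Y ^^ j) (x1 (\<phi> j))" for j
  define b2 where "b2 j = lower x2 ((Y ^^ j) (\<phi> j)) - (1 / (real r + 1)) *\<^sub>R (Y ^^ Suc j) (x2 (\<phi> j))" for j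
  have "assemble (Suc r) (koszul \<phi>)
     = (\<Sum>j\<le>Suc r. (fact (Suc r - j) / fact (Suc r)) *\<^sub>R (Y ^^ j) (x1 (\<phi> j)))
     + (\<Sum>j\<le>Suc r. (fact (Suc r - j) / fact (Suc r)) *\<^sub>R (Y ^^ j) (if j = 0 then 0 else x2 (\<phi> (j - 1))))"
    by (simp add: assemble_def koszul_def linear_add[OF linear_Ypow] scaleR_add_right sum.distrib del: sum.atMost_Suc)
  also have "(\<Sum>j\<le>Suc r. (fact (Suc r - j) / fact (Suc r)) *\<^sub>R (Y ^^ j) (x1 (\<phi> j)))
     = (\<Sum>j\<le>r. c j *\<^sub>R ((real r + 1 - real j) / (real r + 1)) *\<^sub>R (Y ^^ j) (x1 (\<phi> j)))"
  proof -
    have "fact (Suc r - j) / fact (Suc r) = c j * ((real r + 1 - real j) / (real r + 1))" if "j \<le> r" for j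
      using that by (simp add: c_def Suc_diff_le of_nat_diff field_simps)
    then show ?thesis
      by (simp add: beyond x1_simps linear_0[OF linear_Ypow] Y_simps del: fact_Suc)
  qed
  also have "(\<Sum>j\<le>Suc r. (fact (Suc r - j) / fact (Suc r)) *\<^sub>R (Y ^^ j) (if j = 0 then 0 else x2 (\<phi> (j - 1))))
     = (\<Sum>j\<le>r. c j *\<^sub>R (1 / (real r + 1)) *\<^sub>R (Y ^^ Suc j) (x2 (\<phi> j)))"
    by (subst sum.atMost_Suc_shift) (simp add: c_def add_ac mult.commute)
  finally have "wedge (assemble r \<phi>) - assemble (Suc r) (koszul \<phi>) = (\<Sum>j\<le>r. c j *\<^sub>R (b1 j + b2 j))"
    by (simp add: assemble_def linear_sum[OF linear_wedge] linear_scale[OF linear_wedge] flip: c_def)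
       (simp add: wedge_def b1_def b2_def scaleR_add_right scaleR_diff_right sum.distrib sum_subtractf)
  note diff = this
  have b1: "b1 j = (real j / (real r + 1)) *\<^sub>R (Y ^^ (j - 1)) (descend (real r) x1 (\<phi> j))" for j
    unfolding b1_def by (rule wedge_first_part[OF x1]) simp
  have b2: "b2 j = - (1 / (real r + 1)) *\<^sub>R (Y ^^ j) (descend (real r) x2 (\<phi> j))" for j
    unfolding b2_def by (rule wedge_second_part[OF x2]) simp
  have "b1 j \<in> isotypic (real r - 1)" "b2 j \<in> isotypic (real r - 1)" for j
    unfolding b1 b2
    by (intro subspace_scale subspace_isotypic isotypic_Ypow hw_vectors_isotypic descend_hw_vectors x1 x2 hw)+
  then show "wedge (assemble r \<phi>) - assemble (Suc r) (koszul \<phi>) \<in> isotypic (real r - 1)"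
    unfolding diff by (intro subspace_sum subspace_isotypic subspace_scale subspace_add)
  show "wedge (assemble r \<phi>) = assemble (Suc r) (koszul \<phi>)" if "r = 0"
  proof -
    have "Y (\<phi> 0) = 0" using Y_hw_vectors_0[OF hw(1)[of 0]] hw(2)[of 0] that by simp
    then have "b1 0 = 0" "b2 0 = 0" by (simp_all add: b1 b2 descend_def that x2_simps)
    then show ?thesis using diff that by simp
  qed
qed

lemma isotypic_disjoint:
  assumes "a \<in> isotypic r" "a \<in> isotypic s" "r * (r + 2) \<noteq> s * (s + 2)"
  shows "a = 0"
proof -
  have "(r * (r + 2) - s * (s + 2)) *\<^sub>R a = 0"
    using assms(1,2) by (simp add: isotypic_def scaleR_diff_left)
  then show ?thesis using assms(3) by simp
qed

definition Iso :: "nat \<Rightarrow> nat \<Rightarrow> 'f set" where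
  "Iso m r = Deg m \<inter> isotypic (real r)"

text \<open>\<open>b\<close> is the projection of \<open>wedge a\<close> to highest weight \<open>r + 1\<close>. For \<open>r = 0\<close> there is no second
  component, which has to be said explicitly: the Casimir eigenvalue that belongs to \<open>r - 1 = -1\<close>
  does not come from a representation.\<close>

definition symbol_rel :: "nat \<Rightarrow> 'f \<Rightarrow> 'f \<Rightarrow> bool" where
  "symbol_rel r a b \<longleftrightarrow> b \<in> isotypic (real r + 1) \<and> wedge a - b \<in> isotypic (real r - 1) \<and> (r = 0 \<longrightarrow> wedge a = b)"

lemma symbol_rel_unique:
  assumes "symbol_rel r a b" "symbol_rel r a b'"
  shows "b = b'"
proof -
  have "b - b' \<in> isotypic (real r + 1)"
    using assms by (auto simp only: symbol_rel_def intro: subspace_diff[OF subspace_isotypic])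
  moreover have "(wedge a - b') - (wedge a - b) \<in> isotypic (real r - 1)"
    using assms by (auto simp only: symbol_rel_def intro: subspace_diff[OF subspace_isotypic])
  then have "b - b' \<in> isotypic (real r - 1)" by simp
  ultimately have "b - b' = 0"
    by (rule isotypic_disjoint) (simp add: algebra_simps)
  then show ?thesis by simp
qed

lemma symbol_rel_assemble:
  assumes "\<phi> \<in> seqs m r"
  shows "symbol_rel r (assemble r \<phi>) (assemble (Suc r) (koszul \<phi>))"
  using wedge_assemble[OF assms] assemble_seqs[OF koszul_seqs[OF assms]]
  by (simp add: symbol_rel_def add.commute)

lemma symbol_exists:
  assumes "a \<in> Iso m r" "m = r + 2 * k"
  shows "\<exists>b\<in>Iso (Suc m) (Suc r). symbol_rel r a b"
  using isotypic_eq_assemble[of a m r k] assms symbol_rel_assemble assemble_seqs koszul_seqs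
  unfolding Iso_def by fast

lemma symbol_symbol:
  assumes "a \<in> Iso m r" "m = r + 2 * k" "symbol_rel r a b" "symbol_rel (Suc r) b c"
  shows "c = 0"
proof -
  obtain \<phi> where \<phi>: "\<phi> \<in> seqs m r" "a = assemble r \<phi>"
    using isotypic_eq_assemble[of a m r k] assms(1,2) unfolding Iso_def by blast
  have b: "b = assemble (Suc r) (koszul \<phi>)"
    using symbol_rel_unique[OF assms(3)] symbol_rel_assemble[OF \<phi>(1)] \<phi>(2) by blast
  have "c = assemble (Suc (Suc r)) (koszul (koszul \<phi>))"
    using symbol_rel_unique[OF assms(4)] symbol_rel_assemble[OF koszul_seqs[OF \<phi>(1)]] b by blast
  then show ?thesis by (simp add: assemble_def koszul_koszul linear_0[OF linear_Ypow])
qed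

text \<open>Contraction with the dual of \<open>\<xi>\<^sub>1\<close> gives a primitive \<open>i1 (\<phi> j)\<close> of length \<open>r\<close>, one too long for the
  polynomial degree. Its last entry is removed at the expense of the entry before it; this is possible as
  the last equation \<open>x2 (\<phi> r) = 0\<close> makes \<open>x1 (i1 (\<phi> r))\<close> divisible by \<open>x2\<close>.\<close>

lemma koszul_exact:
  assumes "\<And>j. koszul \<phi> j = 0" "r \<ge> 1" "\<And>j. j > r \<Longrightarrow> \<phi> j = 0"
  defines "g \<equiv> (\<lambda>j. if j < r - 1 then i1 (\<phi> j) else if j = r - 1 then i1 (\<phi> j) - x1 (i2 (i1 (\<phi> r))) else 0)"
  shows "koszul g j = \<phi> j"
proof -
  have x1g: "x1 (g j) = x1 (i1 (\<phi> j))" if "j \<le> r - 1" for j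
    using that by (auto simp: g_def x1_simps x1x1)
  have c0: "x1 (\<phi> 0) = 0" using assms(1)[of 0] by (simp add: koszul_def)
  have c: "x1 (\<phi> (Suc j)) = - x2 (\<phi> j)" for j
    using assms(1)[of "Suc j"] by (simp add: koszul_def eq_neg_iff_add_eq_0)
  have i: "x1 (i1 (\<phi> (Suc j))) = \<phi> (Suc j) - x2 (i1 (\<phi> j))" for j
    using i1x1[of "\<phi> (Suc j)"] by (simp add: c i1_simps i1x2 algebra_simps)
  consider "j = 0" | j' where "j = Suc j'" "Suc j' \<le> r - 1" | "j = r" "j > 0" | "j > r" using assms(2)
    by (cases j) (fastforce simp: not_le)+
  then show ?thesis
  proof cases
    case 1
    then show ?thesis using i1x1[of "\<phi> 0"] by (simp add: koszul_def x1g c0 i1_simps)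
  next
    case (2 j')
    then have "g j' = i1 (\<phi> j')" by (auto simp: g_def)
    then show ?thesis using 2 by (simp add: koszul_def x1g i)
  next
    case 3
    then obtain r' where r: "r = Suc r'" by (cases r) auto
    have "x2 (\<phi> r) = 0" using c[of r] assms(3)[of "Suc r"] by (simp add: x1_simps)
    then have "x2 (i2 (i1 (\<phi> r))) = i1 (\<phi> r)"
      using i2x2[of "i1 (\<phi> r)"] i1x2[of "\<phi> r"] by (simp add: i2_simps i1_simps)
    then have "x2 (x1 (i2 (i1 (\<phi> r)))) = - x1 (i1 (\<phi> r))" by (simp add: x2x1)
    then show ?thesis using 3 i[of r'] by (simp add: koszul_def g_def r x2_simps x1_simps)
  next
    case 4
    then show ?thesis using assms(2) by (auto simp: koszul_def g_def x1_simps x2_simps assms(3))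
  qed
qed

lemma weight_i1: "a \<in> weight_space h \<Longrightarrow> i1 a \<in> weight_space (h - 1)"
  and weight_i2: "a \<in> weight_space h \<Longrightarrow> i2 a \<in> weight_space (h - 1)"
  by (simp_all add: weight_space_def H_i1 H_i2 i1_simps i2_simps scaleR_diff_left)

lemma Deg_x1i2i1:
  assumes "a \<in> Deg (Suc m)"
  shows "x1 (i2 (i1 a)) \<in> Deg m"
proof (cases m)
  case 0
  then have "i1 a \<in> Deg 0" using Deg_i1[OF assms] by simp
  then show ?thesis by (simp add: Deg_0_i2 x1_simps subspace_0[OF subspace_Deg])
next
  case (Suc l)
  then show ?thesis using Deg_x1[OF Deg_i2[OF Deg_i1[OF assms]]] by simp
qed

lemma koszul_primitive:
  assumes "\<And>j. koszul \<phi> j = 0" "r \<ge> 1" "\<And>j. j > r \<Longrightarrow> \<phi> j = 0"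
    and "\<And>j. \<phi> j \<in> Deg (Suc m)" "\<And>j. \<phi> j \<in> weight_space h"
  shows "\<exists>g. (\<forall>j. koszul g j = \<phi> j) \<and> (\<forall>j\<ge>r. g j = 0) \<and> (\<forall>j. g j \<in> Deg m \<inter> weight_space (h - 1))"
proof -
  define g where "g j = (if j < r - 1 then i1 (\<phi> j) else if j = r - 1 then i1 (\<phi> j) - x1 (i2 (i1 (\<phi> r))) else 0)" for j
  have "koszul g j = \<phi> j" for j
    using koszul_exact[OF assms(1-3)] by (simp add: g_def[abs_def])
  moreover have "i1 (\<phi> j) \<in> Deg m \<inter> weight_space (h - 1)" for j
    using Deg_i1[OF assms(4)] weight_i1[OF assms(5)] by simp
  moreover have "x1 (i2 (i1 (\<phi> j))) \<in> Deg m \<inter> weight_space (h - 1)" for j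
    using Deg_x1i2i1[OF assms(4)] weight_highest[OF x1 weight_i2[OF weight_i1[OF assms(5)]]] by simp
  ultimately show ?thesis using assms(2)
    by (intro exI[of _ g])
      (auto simp: g_def subspace_0 subspace_Deg subspace_weight subspace_diff)
qed

lemma X_surj:
  assumes "u \<in> Deg m" "u \<in> weight_space h" "h \<ge> 1"
  shows "\<exists>w\<in>Deg m \<inter> weight_space (h - 2). u = X w"
proof -
  obtain N where "(X ^^ N) u = 0" using X_nilpotent[OF assms(1,2)] by blast
  then show ?thesis
    using X_surj_positive_weight[OF subspace_Deg Deg_X Deg_Y assms(2,3,1)] by blast
qed

text \<open>A Koszul primitive \<open>g\<close> of \<open>\<phi>\<close> need not consist of highest weight vectors. But \<open>X g\<close> is again a
  Koszul cycle, in polynomial degree \<open>r\<close>. Either it vanishes for reasons of weight (\<open>r = m\<close>), or it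
  has a primitive \<open>u = X w\<close>, and \<open>g - koszul w\<close> is the primitive sought.\<close>

lemma seqs_exact:
  assumes \<phi>: "\<phi> \<in> seqs (Suc m) (Suc r)" and closed: "\<And>j. koszul \<phi> j = 0"
    and r: "r \<ge> 1 \<and> r \<le> m \<or> r = m"
  shows "\<exists>\<psi>\<in>seqs m r. koszul \<psi> = \<phi>"
proof -
  have \<phi>': "\<phi> j \<in> Deg (Suc m)" "X (\<phi> j) = 0" "\<phi> j \<in> weight_space (real (Suc r))" for j
    using \<phi> hw_vectors_weight by (auto simp: seqs_def hw_vectors_def)
  have \<phi>0: "\<phi> j = 0" if "j > Suc r" for j using that \<phi> by (auto simp: seqs_def)
  obtain g where g: "\<And>j. koszul g j = \<phi> j" "\<And>j. j \<ge> Suc r \<Longrightarrow> g j = 0"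
    "\<And>j. g j \<in> Deg m" "\<And>j. g j \<in> weight_space (real r)"
    using koszul_primitive[of \<phi> "Suc r" m "real (Suc r)", OF closed _ \<phi>0 \<phi>'(1,3)] by auto
  have "\<exists>w. (\<forall>j. w j \<in> Deg (m - 1) \<inter> weight_space (real r - 1) \<and> (j \<ge> r \<longrightarrow> w j = 0)) \<and>
          (\<forall>j. X (g j - koszul w j) = 0) \<and> (\<forall>j. koszul w j \<in> Deg m)"
  proof (cases "r = m")
    case True
    have "X (g j) = 0" for j
      by (rule weight_bounds[OF Deg_X[OF g(3)] weight_X[OF g(4)]]) (simp add: True)
    then show ?thesis
      by (intro exI[of _ "\<lambda>_. 0"]) (simp add: koszul_zero subspace_0 subspace_Deg subspace_weight)
  next
    case False
    then have rm: "r \<ge> 1" "m = Suc (m - 1)" using r by auto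
    have "\<exists>u. (\<forall>j. koszul u j = X (g j)) \<and> (\<forall>j\<ge>r. u j = 0) \<and>
        (\<forall>j. u j \<in> Deg (m - 1) \<inter> weight_space (real r + 2 - 1))"
    proof (rule koszul_primitive[OF _ rm(1)])
      show "koszul (\<lambda>j. X (g j)) j = 0" for j
        using X_koszul[of g j] by (simp add: g(1) \<phi>'(2))
      show "X (g j) = 0" if "j > r" for j using g(2)[of j] that by (simp add: X_simps)
      show "X (g j) \<in> Deg (Suc (m - 1))" for j using Deg_X[OF g(3)] rm by simp
      show "X (g j) \<in> weight_space (real r + 2)" for j by (rule weight_X[OF g(4)])
    qed
    then obtain u where u: "\<And>j. koszul u j = X (g j)" "\<And>j. j \<ge> r \<Longrightarrow> u j = 0"
      "\<And>j. u j \<in> Deg (m - 1)" "\<And>j. u j \<in> weight_space (real r + 2 - 1)"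
      by auto
    have "\<exists>w\<in>Deg (m - 1) \<inter> weight_space (real r + 2 - 1 - 2). u j = X w" for j
      by (rule X_surj[OF u(3,4)]) (use rm in simp)
    then obtain w where w: "\<And>j. w j \<in> Deg (m - 1) \<inter> weight_space (real r + 2 - 1 - 2)" "\<And>j. u j = X (w j)"
      by metis
    define w' where "w' j = (if j \<ge> r then 0 else w j)" for j
    have Xw': "X (w' j) = u j" for j using w(2) u(2) by (auto simp: w'_def X_simps)
    have "w' j \<in> Deg (m - 1) \<inter> weight_space (real r - 1)" for j
      using w(1)[of j] by (auto simp: w'_def subspace_0 subspace_Deg subspace_weight)
    moreover have "X (g j - koszul w' j) = 0" for j
      by (simp add: X_simps X_koszul Xw' u(1))
    moreover have "koszul w' j \<in> Deg m" for j
      using Deg_koszul[of w' "m - 1"] calculation(1) rm(2) by auto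
    ultimately show ?thesis by (intro exI[of _ w']) (auto simp: w'_def)
  qed
  then obtain w where w: "\<And>j. w j \<in> weight_space (real r - 1)" "\<And>j. j \<ge> r \<Longrightarrow> w j = 0"
    "\<And>j. X (g j - koszul w j) = 0" "\<And>j. koszul w j \<in> Deg m" by blast
  define \<psi> where "\<psi> j = g j - koszul w j" for j
  have "koszul \<psi> j = \<phi> j" for j
    unfolding \<psi>_def koszul_diff by (simp add: g(1) koszul_koszul)
  moreover have "\<psi> j \<in> Deg m" for j
    by (simp add: \<psi>_def subspace_diff subspace_Deg g(3) w(4))
  moreover have "\<psi> j \<in> weight_space (real r)" for j
    using weight_koszul[of w, OF w(1)] g(4) by (simp add: \<psi>_def subspace_diff subspace_weight)
  then have "\<psi> j \<in> hw_vectors (real r)" for j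
    using w(3) by (simp add: \<psi>_def[symmetric] hw_vectors_def weight_space_def)
  moreover have "\<psi> j = 0" if "j > r" for j
    using that g(2) w(2) by (cases j) (auto simp: \<psi>_def koszul_def x1_simps x2_simps)
  ultimately show ?thesis by (intro bexI[of _ \<psi>]) (auto simp: seqs_def)
qed

lemma seqs_above_top:
  assumes "\<phi> \<in> seqs m r" "m + r > top_deg"
  shows "\<phi> j = 0"
  using top_zero[of "\<phi> j" m "real r"] assms hw_vectors_weight by (auto simp: seqs_def)

text \<open>The second alternative in \<open>closed\<close> covers the end of the complex, where there is no equation to
  satisfy: the target of the symbol is zero because its degree plus weight exceeds the dimension.\<close>

theorem symbol_exact:
  assumes a: "a \<in> Iso (Suc m) (Suc r)" and k: "m = r + 2 * k"
    and closed: "symbol_rel (Suc r) a 0 \<or> m + r + 4 > top_deg"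
    and r: "r \<ge> 1 \<or> k = 0"
  shows "\<exists>b\<in>Iso m r. symbol_rel r b a"
proof -
  obtain \<phi> where \<phi>: "\<phi> \<in> seqs (Suc m) (Suc r)" "a = assemble (Suc r) \<phi>"
    using isotypic_eq_assemble[of a "Suc m" "Suc r" k] a k unfolding Iso_def by auto
  note k\<phi> = koszul_seqs[OF \<phi>(1)]
  have "koszul \<phi> j = 0" for j
    using closed
  proof
    assume "symbol_rel (Suc r) a 0"
    then have "assemble (Suc (Suc r)) (koszul \<phi>) = 0"
      using symbol_rel_unique symbol_rel_assemble[OF \<phi>(1)] \<phi>(2) by blast
    then show ?thesis
      using assemble_eq_0[of "Suc (Suc r)" "koszul \<phi>" j] k\<phi> by (cases "j \<le> Suc (Suc r)") (auto simp: seqs_def)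
  next
    assume "m + r + 4 > top_deg"
    then show ?thesis by (intro seqs_above_top[OF k\<phi>]) simp
  qed
  then obtain \<psi> where \<psi>: "\<psi> \<in> seqs m r" "koszul \<psi> = \<phi>"
    using seqs_exact[OF \<phi>(1)] r k by auto
  then show ?thesis
    using symbol_rel_assemble[OF \<psi>(1)] assemble_seqs[OF \<psi>(1)] \<phi>(2)
    by (auto simp: Iso_def)
qed

text \<open>\<open>wedge a = 0\<close> splits into \<open>x1 a = x2 a = 0\<close>, so that \<open>a = x1 (x2 (i2 (i1 a)))\<close>. The form
  \<open>i2 (i1 a)\<close> has weight \<open>-2\<close> and degree at most 0, hence is zero.\<close>

theorem wedge_injective_low_degree:
  assumes a: "a \<in> Iso m 0" and m: "m = 2 * k" "k \<le> 1" and "wedge a = 0"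
  shows "a = 0"
proof -
  obtain \<phi> where \<phi>: "\<phi> \<in> seqs m 0" "a = assemble 0 \<phi>"
    using isotypic_eq_assemble[of a m 0 k] a m unfolding Iso_def by auto
  have a\<phi>: "a = \<phi> 0" by (simp add: \<phi>(2) assemble_def)
  have "assemble (Suc 0) (koszul \<phi>) = 0"
    using wedge_assemble(2)[OF \<phi>(1)] assms(4) \<phi>(2) by simp
  then have "koszul \<phi> j = 0" if "j \<le> Suc 0" for j
    using assemble_eq_0[of "Suc 0" "koszul \<phi>" j] koszul_seqs[OF \<phi>(1)] that by (auto simp: seqs_def)
  from this[of 0] this[of 1] have x: "x1 a = 0" "x2 a = 0"
    using \<phi>(1) by (auto simp: koszul_def a\<phi> seqs_def x1_simps)
  have hw: "a \<in> weight_space 0" using \<phi>(1) hw_vectors_weight[of a 0] by (auto simp: a\<phi> seqs_def)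
  have "i2 (i1 a) = 0"
  proof (cases "k = 0")
    case True
    then show ?thesis using a m by (simp add: Iso_def Deg_0_i1 i2_simps)
  next
    case False
    then have "k = 1" using m by simp
    then have "a \<in> Deg 2" using a m by (simp add: Iso_def)
    from Deg_i2[OF Deg_i1[OF this]] have "i2 (i1 a) \<in> Deg 0" by simp
    moreover have "i2 (i1 a) \<in> weight_space (0 - 1 - 1)" by (intro weight_i2 weight_i1 hw)
    ultimately show ?thesis by (rule weight_bounds) simp
  qed
  then have "i1 a = 0" using i2x2[of "i1 a"] i1x2[of a] by (simp add: x i1_simps i2_simps x2_simps)
  then show ?thesis using i1x1[of a] by (simp add: x i1_simps x1_simps)
qed

end

section \<open>Complex-valued alternating forms and their operators\<close>

text \<open>Multilinearity and vanishing on equal neighbours, for all lengths of the argument list at once. Stated with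
  \<open>us @ v # vs\<close> instead of positions, the property passes to \<open>\<lambda>us. \<alpha> (v # us)\<close>, which makes
  induction on the argument list work.\<close>

definition alternating :: "('v::real_vector list \<Rightarrow> 'b::real_vector) \<Rightarrow> bool" where
  "alternating \<alpha> \<longleftrightarrow> (\<forall>us vs. linear (\<lambda>v. \<alpha> (us @ v # vs))) \<and> (\<forall>us v vs. \<alpha> (us @ v # v # vs) = 0)"

definition wedge_fun :: "('v \<Rightarrow> 'b::comm_ring_1) \<Rightarrow> ('v list \<Rightarrow> 'b) \<Rightarrow> 'v list \<Rightarrow> 'b" where
  "wedge_fun \<eta> \<alpha> vs = (\<Sum>i<length vs. (-1) ^ i * (\<eta> (vs ! i) * \<alpha> (take i vs @ drop (Suc i) vs)))"

definition deriv_fun :: "('v \<Rightarrow> 'v) \<Rightarrow> ('v list \<Rightarrow> 'b::ab_group_add) \<Rightarrow> 'v list \<Rightarrow> 'b" where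
  "deriv_fun L \<alpha> vs = - (\<Sum>i<length vs. \<alpha> (vs[i := L (vs ! i)]))"

text \<open>These recursion equations express the (anti)commutation rules of wedge and contraction by the first
  vector. All later operator identities are derived from them by induction on the argument list.\<close>

lemma wedge_fun_simps:
  "wedge_fun \<eta> \<alpha> [] = 0"
  "wedge_fun \<eta> \<alpha> (v # vs) = \<eta> v * \<alpha> vs - wedge_fun \<eta> (\<lambda>us. \<alpha> (v # us)) vs"
  by (simp_all add: wedge_fun_def sum.lessThan_Suc_shift sum_negf del: sum.lessThan_Suc)

lemma deriv_fun_simps:
  "deriv_fun L \<alpha> [] = 0"
  "deriv_fun L \<alpha> (v # vs) = - \<alpha> (L v # vs) + deriv_fun L (\<lambda>us. \<alpha> (v # us)) vs"
  by (simp_all add: deriv_fun_def sum.lessThan_Suc_shift del: sum.lessThan_Suc)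

lemma alternatingD:
  assumes "alternating \<alpha>"
  shows "linear (\<lambda>v. \<alpha> (us @ v # vs))" "\<alpha> (us @ v # v # vs) = 0"
  using assms by (auto simp: alternating_def)

lemma alternating_slot:
  assumes "alternating \<alpha>"
  shows "\<alpha> (us @ (v + w) # vs) = \<alpha> (us @ v # vs) + \<alpha> (us @ w # vs)"
    and "\<alpha> (us @ (c *\<^sub>R v) # vs) = c *\<^sub>R \<alpha> (us @ v # vs)"
    and "\<alpha> (us @ (- v) # vs) = - \<alpha> (us @ v # vs)"
  using linear_add[OF alternatingD(1)[OF assms]] linear_scale[OF alternatingD(1)[OF assms]]
    linear_neg[OF alternatingD(1)[OF assms]] by blast+

lemma alternating_swap:
  assumes "alternating \<alpha>"
  shows "\<alpha> (us @ v # w # vs) = - \<alpha> (us @ w # v # vs)"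
proof -
  have "0 = \<alpha> (us @ (v + w) # (v + w) # vs)" using alternatingD(2)[OF assms] by simp
  also have "\<dots> = \<alpha> ((us @ [v]) @ (v + w) # vs) + \<alpha> ((us @ [w]) @ (v + w) # vs)"
    using alternating_slot(1)[OF assms] by simp
  also have "\<dots> = \<alpha> (us @ v # w # vs) + \<alpha> (us @ w # v # vs)"
    unfolding alternating_slot(1)[OF assms] using alternatingD(2)[OF assms] by simp
  finally show ?thesis by (simp add: eq_neg_iff_add_eq_0)
qed

lemma alternating_repeated:
  assumes "alternating \<alpha>"
  shows "\<alpha> (us @ v # ws @ v # vs) = 0"
proof (induction ws arbitrary: us)
  case Nil then show ?case using alternatingD(2)[OF assms] by simp
next
  case (Cons w ws)
  have "\<alpha> (us @ v # (w # ws) @ v # vs) = - \<alpha> ((us @ [w]) @ v # ws @ v # vs)"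
    using alternating_swap[OF assms, of us v w] by simp
  then show ?case by (simp only: Cons.IH minus_zero)
qed

lemma alternating_Cons:
  assumes "alternating \<alpha>"
  shows "alternating (\<lambda>us. \<alpha> (v # us))"
proof -
  have "linear (\<lambda>w. \<alpha> (v # us @ w # vs)) \<and> \<alpha> (v # us @ w # w # vs) = 0" for us w vs
    using alternatingD[OF assms, of "v # us"] by simp
  then show ?thesis by (simp add: alternating_def)
qed

lemma alternating_zero: "alternating (\<lambda>_. 0)"
  by (simp add: alternating_def linear_iff)

lemma alternating_add: "alternating \<alpha> \<Longrightarrow> alternating \<beta> \<Longrightarrow> alternating (\<lambda>vs. \<alpha> vs + \<beta> vs)"
  unfolding alternating_def by (auto intro: linear_compose_add)

lemma alternating_minus: "alternating \<alpha> \<Longrightarrow> alternating (\<lambda>vs. - \<alpha> vs)"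
  unfolding alternating_def by (auto intro: linear_compose_neg)

lemma alternating_compose: "linear f \<Longrightarrow> alternating \<alpha> \<Longrightarrow> alternating (\<lambda>vs. f (\<alpha> vs))"
  unfolding alternating_def by (auto simp: linear_0 dest!: linear_compose[where g=f, unfolded o_def, rotated])

lemma wedge_fun_add: "wedge_fun \<eta> (\<lambda>us. \<alpha> us + \<beta> us) vs = wedge_fun \<eta> \<alpha> vs + wedge_fun \<eta> \<beta> vs"
  by (simp add: wedge_fun_def sum.distrib algebra_simps)

lemma wedge_fun_scaleR:
  fixes \<eta> :: "'v \<Rightarrow> 'b::{real_algebra_1, comm_ring_1}"
  shows "wedge_fun \<eta> (\<lambda>us. c *\<^sub>R \<alpha> us) vs = c *\<^sub>R wedge_fun \<eta> \<alpha> vs"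
  by (simp add: wedge_fun_def scaleR_sum_right)

lemma deriv_fun_add: "deriv_fun L (\<lambda>us. \<alpha> us + \<beta> us) vs = deriv_fun L \<alpha> vs + deriv_fun L \<beta> vs"
  by (simp add: deriv_fun_def sum.distrib)

lemma deriv_fun_scaleR:
  fixes \<alpha> :: "'v list \<Rightarrow> 'b::real_vector"
  shows "deriv_fun L (\<lambda>us. c *\<^sub>R \<alpha> us) vs = c *\<^sub>R deriv_fun L \<alpha> vs"
  by (simp add: deriv_fun_def scaleR_sum_right)

lemma wedge_fun_zero: "wedge_fun \<eta> (\<lambda>us. 0) vs = 0" by (simp add: wedge_fun_def)
lemma deriv_fun_zero: "deriv_fun \<eta> (\<lambda>us. 0) vs = 0" by (simp add: deriv_fun_def)

lemma alternating_wedge: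
  fixes \<eta> :: "'v::real_vector \<Rightarrow> 'b::{real_algebra_1, comm_ring_1}"
  assumes "linear \<eta>" "alternating \<alpha>"
  shows "alternating (wedge_fun \<eta> \<alpha>)"
proof -
  have "linear (\<lambda>v. wedge_fun \<eta> \<alpha> (us @ v # vs)) \<and> wedge_fun \<eta> \<alpha> (us @ v # v # vs) = 0" for us v vs
    using assms(2)
  proof (induction us arbitrary: \<alpha>)
    case Nil
    note slot = alternating_slot[OF Nil, of "[]", simplified] alternatingD(2)[OF Nil, of "[]", simplified]
    show ?case
      by (auto intro!: linearI simp: wedge_fun_simps slot wedge_fun_add wedge_fun_scaleR wedge_fun_zero
          linear_add[OF assms(1)] linear_scale[OF assms(1)] algebra_simps)
  next
    case (Cons u us)
    have l: "linear (\<lambda>v. \<alpha> (us @ v # vs))" using alternatingD(1)[OF Cons.prems] .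
    show ?case
      using Cons.IH[OF alternating_Cons[OF Cons.prems]] linear_add[OF l] linear_scale[OF l]
        alternatingD(2)[OF Cons.prems, of us v vs]
      by (auto simp: wedge_fun_simps linear_iff algebra_simps)
  qed
  then show ?thesis by (simp add: alternating_def)
qed

lemma alternating_deriv:
  assumes "linear L" "alternating \<alpha>"
  shows "alternating (deriv_fun L \<alpha>)"
proof -
  have "linear (\<lambda>v. deriv_fun L \<alpha> (us @ v # vs)) \<and> deriv_fun L \<alpha> (us @ v # v # vs) = 0" for us v vs
    using assms(2)
  proof (induction us arbitrary: \<alpha>)
    case Nil
    note slot = alternating_slot[OF Nil, of "[]", simplified] alternatingD(2)[OF Nil, of "[]", simplified]
    have sw: "\<alpha> (L v # v # vs) = - \<alpha> (v # L v # vs)" by (rule alternating_swap[OF Nil, of "[]", unfolded append_Nil])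
    have "linear (\<lambda>v. deriv_fun L \<alpha> (v # vs))"
      by (rule linearI)
         (simp_all add: deriv_fun_simps slot deriv_fun_add deriv_fun_scaleR
          linear_add[OF assms(1)] linear_scale[OF assms(1)] scaleR_diff_right)
    moreover have "deriv_fun L \<alpha> (v # v # vs) = 0"
      by (simp add: deriv_fun_simps slot sw deriv_fun_zero)
    ultimately show ?case by simp
  next
    case (Cons u us)
    have l: "linear (\<lambda>v. \<alpha> ((L u # us) @ v # vs))" using alternatingD(1)[OF Cons.prems] .
    show ?case
      using Cons.IH[OF alternating_Cons[OF Cons.prems]] linear_add[OF l] linear_scale[OF l]
        alternatingD(2)[OF Cons.prems, of "L u # us" v vs]
      by (auto simp: deriv_fun_simps linear_iff algebra_simps)
  qed
  then show ?thesis by (simp add: alternating_def)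
qed

text \<open>A type of its own makes the operators total, so that operator identities hold without side conditions
  on the forms and can be used for rewriting.\<close>

typedef (overloaded) 'v cform = "{\<alpha> :: 'v::real_vector list \<Rightarrow> complex. alternating \<alpha>}"
  morphisms ev Abs_cform
  using alternating_zero by blast

setup_lifting type_definition_cform

instantiation cform :: (real_vector) real_vector
begin
lift_definition zero_cform :: "'a cform" is "\<lambda>_. 0" by (rule alternating_zero)
lift_definition plus_cform :: "'a cform \<Rightarrow> 'a cform \<Rightarrow> 'a cform" is "\<lambda>\<alpha> \<beta> vs. \<alpha> vs + \<beta> vs"
  by (rule alternating_add)
lift_definition uminus_cform :: "'a cform \<Rightarrow> 'a cform" is "\<lambda>\<alpha> vs. - \<alpha> vs"
  by (rule alternating_minus)
lift_definition minus_cform :: "'a cform \<Rightarrow> 'a cform \<Rightarrow> 'a cform" is "\<lambda>\<alpha> \<beta> vs. \<alpha> vs - \<beta> vs"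
  using alternating_add[OF _ alternating_minus] by fastforce
lift_definition scaleR_cform :: "real \<Rightarrow> 'a cform \<Rightarrow> 'a cform" is "\<lambda>c \<alpha> vs. c *\<^sub>R \<alpha> vs"
  by (rule alternating_compose) (auto intro: linear_compose_scale_right linear_ident)
instance by standard (transfer; auto simp: fun_eq_iff algebra_simps)+
end

lift_definition cscale :: "complex \<Rightarrow> 'v::real_vector cform \<Rightarrow> 'v cform" is "\<lambda>c \<alpha> vs. c * \<alpha> vs"
  by (rule alternating_compose) (auto simp: linear_iff algebra_simps)

lift_definition contract :: "'v::real_vector \<Rightarrow> 'v cform \<Rightarrow> 'v cform" is "\<lambda>v \<alpha> vs. \<alpha> (v # vs)"
  by (rule alternating_Cons)

lift_definition wedge1 :: "('v::real_vector \<Rightarrow> complex) \<Rightarrow> 'v cform \<Rightarrow> 'v cform" is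
  "\<lambda>\<eta> \<alpha>. if linear \<eta> then wedge_fun \<eta> \<alpha> else (\<lambda>_. 0)"
  by (simp add: alternating_wedge alternating_zero)

lift_definition derivation :: "('v::real_vector \<Rightarrow> 'v) \<Rightarrow> 'v cform \<Rightarrow> 'v cform" is
  "\<lambda>L \<alpha>. if linear L then deriv_fun L \<alpha> else (\<lambda>_. 0)"
  by (simp add: alternating_deriv alternating_zero)

lemma ev_simps [simp]:
  "ev 0 vs = 0" "ev (\<alpha> + \<beta>) vs = ev \<alpha> vs + ev \<beta> vs" "ev (\<alpha> - \<beta>) vs = ev \<alpha> vs - ev \<beta> vs"
  "ev (- \<alpha>) vs = - ev \<alpha> vs" "ev (r *\<^sub>R \<alpha>) vs = r *\<^sub>R ev \<alpha> vs" "ev (cscale c \<alpha>) vs = c * ev \<alpha> vs"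
  "ev (contract v \<alpha>) vs = ev \<alpha> (v # vs)"
  by (transfer; simp)+

lemma ev_sum [simp]: "ev (sum f S) vs = (\<Sum>s\<in>S. ev (f s) vs)"
  by (induction S rule: infinite_finite_induct) auto

lemma ev_wedge1: "linear \<eta> \<Longrightarrow> ev (wedge1 \<eta> \<alpha>) vs = wedge_fun \<eta> (ev \<alpha>) vs"
  by transfer simp

lemma ev_derivation: "linear L \<Longrightarrow> ev (derivation L \<alpha>) vs = deriv_fun L (ev \<alpha>) vs"
  by transfer simp

lemma alternating_ev: "alternating (ev \<alpha>)"
  using ev by blast

lemma cform_eqI: "(\<And>vs. ev \<alpha> vs = ev \<beta> vs) \<Longrightarrow> \<alpha> = \<beta>"
  by (metis ev_inverse ext)

lemma cform_eqI_contract: "ev \<alpha> [] = ev \<beta> [] \<Longrightarrow> (\<And>v. contract v \<alpha> = contract v \<beta>) \<Longrightarrow> \<alpha> = \<beta>"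
  by (rule cform_eqI) (metis ev_simps(7) list.exhaust)

lemma cscale_simps:
  "cscale a (cscale b \<alpha>) = cscale (a * b) \<alpha>" "cscale 1 \<alpha> = \<alpha>" "cscale 0 \<alpha> = 0" "cscale c 0 = 0"
  "cscale c (\<alpha> + \<beta>) = cscale c \<alpha> + cscale c \<beta>" "cscale c (\<alpha> - \<beta>) = cscale c \<alpha> - cscale c \<beta>"
  "cscale c (- \<alpha>) = - cscale c \<alpha>" "cscale c (r *\<^sub>R \<alpha>) = r *\<^sub>R cscale c \<alpha>"
  "cscale (of_real r) \<alpha> = r *\<^sub>R \<alpha>" "cscale (- c) \<alpha> = - cscale c \<alpha>"
  by (rule cform_eqI; simp add: algebra_simps scaleR_conv_of_real)+

lemma contract_simps:
  "contract v 0 = 0" "contract v (\<alpha> + \<beta>) = contract v \<alpha> + contract v \<beta>"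
  "contract v (\<alpha> - \<beta>) = contract v \<alpha> - contract v \<beta>" "contract v (- \<alpha>) = - contract v \<alpha>"
  "contract v (r *\<^sub>R \<alpha>) = r *\<^sub>R contract v \<alpha>" "contract v (cscale c \<alpha>) = cscale c (contract v \<alpha>)"
  by (rule cform_eqI; simp)+

lemma contract_vector:
  "contract (v + w) \<alpha> = contract v \<alpha> + contract w \<alpha>" "contract (r *\<^sub>R v) \<alpha> = r *\<^sub>R contract v \<alpha>"
  "contract (- v) \<alpha> = - contract v \<alpha>"
  by (rule cform_eqI; simp add: alternating_slot[OF alternating_ev, of _ "[]", simplified])+

lemma linear_contract_vector: "linear (\<lambda>v. contract v \<alpha>)"
  by (rule linearI) (simp_all add: contract_vector)

lemma contract_vector_diff: "contract (v - w) \<alpha> = contract v \<alpha> - contract w \<alpha>"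
  by (rule linear_diff[OF linear_contract_vector])

lemma contract_anticommute: "contract v (contract w \<alpha>) = - contract w (contract v \<alpha>)"
  by (rule cform_eqI; simp) (rule alternating_swap[OF alternating_ev, of _ "[]", unfolded append_Nil])

lemma contract_wedge1:
  "linear \<eta> \<Longrightarrow> contract v (wedge1 \<eta> \<alpha>) = cscale (\<eta> v) \<alpha> - wedge1 \<eta> (contract v \<alpha>)"
  by (rule cform_eqI) (simp add: ev_wedge1 wedge_fun_simps ev_simps[abs_def])

lemma contract_derivation:
  "linear L \<Longrightarrow> contract v (derivation L \<alpha>) = derivation L (contract v \<alpha>) - contract (L v) \<alpha>"
  by (rule cform_eqI) (simp add: ev_derivation deriv_fun_simps ev_simps[abs_def])

lemma ev_Nil_op [simp]: "linear \<eta> \<Longrightarrow> ev (wedge1 \<eta> \<alpha>) [] = 0" "linear L \<Longrightarrow> ev (derivation L \<alpha>) [] = 0"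
  by (simp_all add: ev_wedge1 ev_derivation wedge_fun_simps deriv_fun_simps)

text \<open>Packages the induction on the argument list by which all operator identities below are proved.\<close>

lemma operator_eqI:
  assumes "\<And>\<alpha>. ev (S \<alpha>) [] = ev (T \<alpha>) []"
    and "\<And>v \<alpha> vs. (\<And>\<beta>. ev (S \<beta>) vs = ev (T \<beta>) vs) \<Longrightarrow> ev (contract v (S \<alpha>)) vs = ev (contract v (T \<alpha>)) vs"
  shows "S \<alpha> = T \<alpha>"
proof (rule cform_eqI)
  show "ev (S \<alpha>) vs = ev (T \<alpha>) vs" for vs
    by (induction vs arbitrary: \<alpha>) (use assms in simp_all)
qed

lemma wedge1_simps:
  assumes "linear \<eta>"
  shows "wedge1 \<eta> 0 = 0" "wedge1 \<eta> (\<alpha> + \<beta>) = wedge1 \<eta> \<alpha> + wedge1 \<eta> \<beta>"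
    "wedge1 \<eta> (\<alpha> - \<beta>) = wedge1 \<eta> \<alpha> - wedge1 \<eta> \<beta>" "wedge1 \<eta> (- \<alpha>) = - wedge1 \<eta> \<alpha>"
    "wedge1 \<eta> (r *\<^sub>R \<alpha>) = r *\<^sub>R wedge1 \<eta> \<alpha>" "wedge1 \<eta> (cscale c \<alpha>) = cscale c (wedge1 \<eta> \<alpha>)"
  by (rule cform_eqI; simp add: ev_wedge1 assms wedge_fun_def ev_simps[abs_def] sum_distrib_left sum_distrib_right
      sum.distrib sum_subtractf sum_negf scaleR_sum_right algebra_simps)+

lemma derivation_simps:
  assumes "linear L"
  shows "derivation L 0 = 0" "derivation L (\<alpha> + \<beta>) = derivation L \<alpha> + derivation L \<beta>"
    "derivation L (\<alpha> - \<beta>) = derivation L \<alpha> - derivation L \<beta>" "derivation L (- \<alpha>) = - derivation L \<alpha>"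
    "derivation L (r *\<^sub>R \<alpha>) = r *\<^sub>R derivation L \<alpha>" "derivation L (cscale c \<alpha>) = cscale c (derivation L \<alpha>)"
  by (rule cform_eqI; simp add: ev_derivation assms deriv_fun_def sum_distrib_left
      sum.distrib sum_subtractf sum_negf scaleR_sum_right)+

lemma wedge1_covector:
  assumes "linear \<eta>" "linear \<theta>"
  shows "wedge1 (\<lambda>v. \<eta> v + \<theta> v) \<alpha> = wedge1 \<eta> \<alpha> + wedge1 \<theta> \<alpha>"
  by (rule cform_eqI; simp add: ev_wedge1 assms linear_compose_add wedge_fun_def sum.distrib algebra_simps)

lemma linear_cmult: "linear \<eta> \<Longrightarrow> linear (\<lambda>v. c * \<eta> v :: complex)"
  by (auto simp: linear_iff algebra_simps)

lemma wedge1_cmult: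
  assumes "linear \<eta>"
  shows "wedge1 (\<lambda>v. c * \<eta> v) \<alpha> = cscale c (wedge1 \<eta> \<alpha>)"
  by (rule cform_eqI; simp add: ev_wedge1 assms linear_cmult wedge_fun_def sum_distrib_left algebra_simps)

lemma derivation_endo:
  assumes "linear L" "linear M"
  shows "derivation (\<lambda>v. a *\<^sub>R L v + b *\<^sub>R M v) \<alpha> = a *\<^sub>R derivation L \<alpha> + b *\<^sub>R derivation M \<alpha>"
proof (rule operator_eqI[where S = "derivation (\<lambda>v. a *\<^sub>R L v + b *\<^sub>R M v)" and T = "\<lambda>\<alpha>. a *\<^sub>R derivation L \<alpha> + b *\<^sub>R derivation M \<alpha>"])
  have l: "linear (\<lambda>v. a *\<^sub>R L v + b *\<^sub>R M v)"
    using assms by (intro linear_compose_add linear_compose_scale_right)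
  show "ev (derivation (\<lambda>v. a *\<^sub>R L v + b *\<^sub>R M v) \<alpha>) [] = ev (a *\<^sub>R derivation L \<alpha> + b *\<^sub>R derivation M \<alpha>) []" for \<alpha>
    using assms l by simp
  show "ev (contract v (derivation (\<lambda>v. a *\<^sub>R L v + b *\<^sub>R M v) \<alpha>)) vs
      = ev (contract v (a *\<^sub>R derivation L \<alpha> + b *\<^sub>R derivation M \<alpha>)) vs"
    if "\<And>\<beta>. ev (derivation (\<lambda>v. a *\<^sub>R L v + b *\<^sub>R M v) \<beta>) vs = ev (a *\<^sub>R derivation L \<beta> + b *\<^sub>R derivation M \<beta>) vs"
    for v \<alpha> vs
    unfolding contract_derivation[OF l] contract_simps contract_derivation[OF assms(1)] contract_derivation[OF assms(2)]
      contract_vector ev_simps(2-5) that by (simp add: algebra_simps del: ev_simps(7))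
qed

lemma wedge1_anticommute:
  assumes "linear \<eta>" "linear \<theta>"
  shows "wedge1 \<eta> (wedge1 \<theta> \<alpha>) = - wedge1 \<theta> (wedge1 \<eta> \<alpha>)"
proof (rule operator_eqI[where S = "\<lambda>\<alpha>. wedge1 \<eta> (wedge1 \<theta> \<alpha>)" and T = "\<lambda>\<alpha>. - wedge1 \<theta> (wedge1 \<eta> \<alpha>)"])
  show "ev (contract v (wedge1 \<eta> (wedge1 \<theta> \<alpha>))) vs = ev (contract v (- wedge1 \<theta> (wedge1 \<eta> \<alpha>))) vs"
    if "\<And>\<beta>. ev (wedge1 \<eta> (wedge1 \<theta> \<beta>)) vs = ev (- wedge1 \<theta> (wedge1 \<eta> \<beta>)) vs" for v \<alpha> vs
    using that[of "contract v \<alpha>"] assms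
    by (simp add: contract_wedge1 wedge1_simps contract_simps del: ev_simps(7))
qed (simp add: assms)

lemma derivation_wedge1:
  assumes "linear L" "linear \<eta>"
  shows "derivation L (wedge1 \<eta> \<alpha>) = wedge1 \<eta> (derivation L \<alpha>) - wedge1 (\<lambda>v. \<eta> (L v)) \<alpha>"
proof (rule operator_eqI[where S = "\<lambda>\<alpha>. derivation L (wedge1 \<eta> \<alpha>)" and T = "\<lambda>\<alpha>. wedge1 \<eta> (derivation L \<alpha>) - wedge1 (\<lambda>v. \<eta> (L v)) \<alpha>"])
  have l: "linear (\<lambda>v. \<eta> (L v))" using linear_compose[OF assms] by (simp add: o_def)
  show "ev (derivation L (wedge1 \<eta> \<alpha>)) [] = ev (wedge1 \<eta> (derivation L \<alpha>) - wedge1 (\<lambda>v. \<eta> (L v)) \<alpha>) []" for \<alpha>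
    using assms l by simp
  show "ev (contract v (derivation L (wedge1 \<eta> \<alpha>))) vs
      = ev (contract v (wedge1 \<eta> (derivation L \<alpha>) - wedge1 (\<lambda>v. \<eta> (L v)) \<alpha>)) vs"
    if "\<And>\<beta>. ev (derivation L (wedge1 \<eta> \<beta>)) vs = ev (wedge1 \<eta> (derivation L \<beta>) - wedge1 (\<lambda>v. \<eta> (L v)) \<beta>) vs" for v \<alpha> vs
    using that[of "contract v \<alpha>"] assms l
    by (simp add: contract_wedge1 contract_derivation wedge1_simps derivation_simps contract_simps del: ev_simps(7))
qed

lemma derivation_commutator:
  assumes "linear L" "linear M"
  shows "derivation L (derivation M \<alpha>) - derivation M (derivation L \<alpha>) = derivation (\<lambda>v. L (M v) - M (L v)) \<alpha>"
proof (rule operator_eqI[where S = "\<lambda>\<alpha>. derivation L (derivation M \<alpha>) - derivation M (derivation L \<alpha>)" and T = "derivation (\<lambda>v. L (M v) - M (L v))"])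
  have l: "linear (\<lambda>v. L (M v) - M (L v))"
    using linear_compose[OF assms] linear_compose[OF assms(2,1)] by (simp add: o_def linear_compose_sub)
  show "ev (derivation L (derivation M \<alpha>) - derivation M (derivation L \<alpha>)) [] = ev (derivation (\<lambda>v. L (M v) - M (L v)) \<alpha>) []" for \<alpha>
    using assms l by simp
  show "ev (contract v (derivation L (derivation M \<alpha>) - derivation M (derivation L \<alpha>))) vs
      = ev (contract v (derivation (\<lambda>v. L (M v) - M (L v)) \<alpha>)) vs"
    if "\<And>\<beta>. ev (derivation L (derivation M \<beta>) - derivation M (derivation L \<beta>)) vs = ev (derivation (\<lambda>v. L (M v) - M (L v)) \<beta>) vs" for v \<alpha> vs
    using that[of "contract v \<alpha>"] assms l
    by (simp add: contract_derivation derivation_simps contract_simps contract_vector_diff algebra_simps del: ev_simps(7))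
qed

definition Deg :: "nat \<Rightarrow> 'v::real_vector cform set" where
  "Deg m = {\<alpha>. \<forall>vs. length vs \<noteq> m \<longrightarrow> ev \<alpha> vs = 0}"

lemma subspace_Deg: "subspace (Deg m)"
  by (auto simp: subspace_def Deg_def)

lemma Deg_cscale: "\<alpha> \<in> Deg m \<Longrightarrow> cscale c \<alpha> \<in> Deg m" by (simp add: Deg_def)

lemma Deg_wedge1: "linear \<eta> \<Longrightarrow> \<alpha> \<in> Deg m \<Longrightarrow> wedge1 \<eta> \<alpha> \<in> Deg (Suc m)"
  by (auto simp: Deg_def ev_wedge1 wedge_fun_def intro!: sum.neutral)

lemma Deg_derivation: "linear L \<Longrightarrow> \<alpha> \<in> Deg m \<Longrightarrow> derivation L \<alpha> \<in> Deg m"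
  by (auto simp: Deg_def ev_derivation deriv_fun_def)

lemma Deg_contract: "\<alpha> \<in> Deg m \<Longrightarrow> contract v \<alpha> \<in> Deg (m - 1)"
  by (auto simp: Deg_def)

lemma Deg_0_contract: "\<alpha> \<in> Deg 0 \<Longrightarrow> contract v \<alpha> = 0"
  by (rule cform_eqI) (auto simp: Deg_def)

lemma Deg_0_derivation:
  assumes a: "linear L" "\<alpha> \<in> Deg 0"
  shows "derivation L \<alpha> = 0"
proof (rule cform_eqI)
  fix vs
  show "ev (derivation L \<alpha>) vs = ev 0 vs"
    using Deg_derivation[OF a] a(1) by (cases vs) (auto simp: Deg_def)
qed

lemma Deg_eq_0I: "\<alpha> \<in> Deg (Suc m) \<Longrightarrow> (\<And>v. contract v \<alpha> = 0) \<Longrightarrow> \<alpha> = 0"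
  by (rule cform_eqI_contract) (auto simp: Deg_def contract_simps)

text \<open>By multilinearity only lists of basis vectors matter, and these have repetitions.\<close>

lemma Deg_above_dim:
  fixes \<alpha> :: "'v::euclidean_space cform"
  assumes "\<alpha> \<in> Deg m" "m > DIM('v)"
  shows "\<alpha> = 0"
proof (rule cform_eqI)
  fix vs
  have *: "set us \<subseteq> Basis \<Longrightarrow> length us + length vs = m \<Longrightarrow> ev \<alpha> (us @ vs) = 0" for us
  proof (induction vs arbitrary: us)
    case Nil
    have "\<not> distinct us"
    proof
      assume "distinct us"
      then have "length us = card (set us)" by (simp add: distinct_card)
      also have "\<dots> \<le> DIM('v)" using Nil.prems(1) by (intro card_mono) auto
      finally show False using Nil.prems assms(2) by simp
    qed
    then obtain xs ys zs y where "us = xs @ [y] @ ys @ [y] @ zs" using not_distinct_decomp by blast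
    then show ?case using alternating_repeated[OF alternating_ev, of \<alpha> xs y ys zs] by simp
  next
    case (Cons v vs)
    have "ev \<alpha> (us @ v # vs) = ev \<alpha> (us @ (\<Sum>b\<in>Basis. (v \<bullet> b) *\<^sub>R b) # vs)"
      by (simp add: euclidean_representation)
    also have "\<dots> = (\<Sum>b\<in>Basis. (v \<bullet> b) *\<^sub>R ev \<alpha> (us @ b # vs))"
      using linear_sum[OF alternatingD(1)[OF alternating_ev]] linear_scale[OF alternatingD(1)[OF alternating_ev]]
      by (metis (no_types, lifting) sum.cong)
    also have "\<dots> = 0"
    proof (intro sum.neutral ballI)
      fix b :: 'v assume "b \<in> Basis"
      then show "(v \<bullet> b) *\<^sub>R ev \<alpha> (us @ b # vs) = 0" using Cons.IH[of "us @ [b]"] Cons.prems by simp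
    qed
    finally show ?case .
  qed
  show "ev \<alpha> vs = ev 0 vs"
    using *[of "[]"] assms(1) by (cases "length vs = m") (auto simp: Deg_def)
qed

text \<open>Second quantisation of \<open>L\<close>: derivations are sums of products of a wedge and a contraction.\<close>

lemma derivation_eq_basis_sum:
  fixes \<alpha> :: "'v::euclidean_space cform"
  assumes "linear L"
  shows "derivation L \<alpha> = - (\<Sum>b\<in>Basis. wedge1 (\<lambda>v. of_real (L v \<bullet> b)) (contract b \<alpha>))"
proof (rule operator_eqI[where S = "derivation L" and T = "\<lambda>\<alpha>. - (\<Sum>b\<in>Basis. wedge1 (\<lambda>v. of_real (L v \<bullet> b)) (contract b \<alpha>))"])
  have l: "linear (\<lambda>v. complex_of_real (L v \<bullet> b))" for b
    using assms by (auto simp: linear_iff inner_simps scaleR_conv_of_real)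
  show "ev (derivation L \<alpha>) [] = ev (- (\<Sum>b\<in>Basis. wedge1 (\<lambda>v. complex_of_real (L v \<bullet> b)) (contract b \<alpha>))) []" for \<alpha>
    using l assms by simp
  show "ev (contract v (derivation L \<alpha>)) vs = ev (contract v (- (\<Sum>b\<in>Basis. wedge1 (\<lambda>v. complex_of_real (L v \<bullet> b)) (contract b \<alpha>)))) vs"
    if IH: "\<And>\<beta>. ev (derivation L \<beta>) vs = ev (- (\<Sum>b\<in>Basis. wedge1 (\<lambda>v. complex_of_real (L v \<bullet> b)) (contract b \<beta>))) vs" for v \<alpha> vs
  proof -
    have "contract (L v) \<alpha> = contract (\<Sum>b\<in>Basis. (L v \<bullet> b) *\<^sub>R b) \<alpha>" by (simp add: euclidean_representation)
    also have "\<dots> = (\<Sum>b\<in>Basis. (L v \<bullet> b) *\<^sub>R contract b \<alpha>)"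
      by (simp only: linear_sum[OF linear_contract_vector] contract_vector)
    finally have Lv: "contract (L v) \<alpha> = (\<Sum>b\<in>Basis. (L v \<bullet> b) *\<^sub>R contract b \<alpha>)" .
    have lc: "linear (contract v)" by (rule linearI) (simp_all add: contract_simps)
    have "contract v (\<Sum>b\<in>Basis. wedge1 (\<lambda>v. complex_of_real (L v \<bullet> b)) (contract b \<alpha>))
      = (\<Sum>b\<in>Basis. (L v \<bullet> b) *\<^sub>R contract b \<alpha> + wedge1 (\<lambda>v. complex_of_real (L v \<bullet> b)) (contract b (contract v \<alpha>)))"
      unfolding linear_sum[OF lc]
      by (intro sum.cong refl)
         (simp add: contract_wedge1[OF l] cscale_simps contract_anticommute[of v] wedge1_simps[OF l])
    then have "contract v (- (\<Sum>b\<in>Basis. wedge1 (\<lambda>v. complex_of_real (L v \<bullet> b)) (contract b \<alpha>)))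
      = - contract (L v) \<alpha> + - (\<Sum>b\<in>Basis. wedge1 (\<lambda>v. complex_of_real (L v \<bullet> b)) (contract b (contract v \<alpha>)))"
      by (simp add: contract_simps sum.distrib Lv)
    then show ?thesis
      unfolding contract_derivation[OF assms] using IH[of "contract v \<alpha>"] by (simp del: ev_simps(7) ev_sum)
  qed
qed

lemma derivation_id:
  assumes "\<alpha> \<in> Deg m"
  shows "derivation (\<lambda>v. v) \<alpha> = - real m *\<^sub>R \<alpha>"
proof (rule cform_eqI)
  show "ev (derivation (\<lambda>v. v) \<alpha>) vs = ev (- real m *\<^sub>R \<alpha>) vs" for vs
    using assms by (cases "length vs = m") (auto simp: ev_derivation linear_iff deriv_fun_def Deg_def scaleR_conv_of_real)
qed

section \<open>The sl(2)-action on forms of a quaternionic vector space\<close>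

lemma shift_prod_linear_image:
  assumes "linear f" "\<And>a. f (T a) = T (f a) + c *\<^sub>R f a"
  shows "f (shift_prod T ss a) = shift_prod T (map (\<lambda>s. s - c) ss) (f a)"
proof (induction ss arbitrary: a)
  case (Cons s ss)
  have "f (T a - s *\<^sub>R a) = T (f a) - (s - c) *\<^sub>R f a"
    by (simp add: linear_diff[OF assms(1)] linear_scale[OF assms(1)] assms(2) scaleR_diff_left)
  then show ?case by (simp add: Cons.IH)
qed simp

lemma shift_prod_append: "shift_prod T (ss @ ts) a = shift_prod T ts (shift_prod T ss a)"
  by (induction ss arbitrary: a) auto

lemma shift_prod_in:
  assumes "subspace S" "\<And>a. a \<in> S \<Longrightarrow> T a \<in> S"
  shows "a \<in> S \<Longrightarrow> shift_prod T ss a \<in> S"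
  by (induction ss arbitrary: a) (auto simp: assms subspace_diff subspace_scale)

text \<open>All six products of distinct units are assumed, so that every word in \<open>I\<close>, \<open>J\<close>, \<open>K\<close> is simplified
  by rewriting.\<close>

locale quaternionic_triple =
  fixes I J K :: "'v::euclidean_space \<Rightarrow> 'v"
  assumes linear_I: "linear I" and linear_J: "linear J" and linear_K: "linear K"
    and triple: "I (I v) = - v" "J (J v) = - v" "K (K v) = - v" "I (J v) = K v" "J (I v) = - K v"
      "J (K v) = I v" "K (J v) = - I v" "K (I v) = J v" "I (K v) = - J v"
begin

abbreviation "DI \<equiv> derivation I"
abbreviation "DJ \<equiv> derivation J"
abbreviation "DK \<equiv> derivation K"

lemmas D_simps = derivation_simps[OF linear_I] derivation_simps[OF linear_J] derivation_simps[OF linear_K]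

lemma D_commutators:
  "DJ (DI a) = DI (DJ a) - 2 *\<^sub>R DK a"
  "DK (DI a) = DI (DK a) + 2 *\<^sub>R DJ a"
  "DK (DJ a) = DJ (DK a) - 2 *\<^sub>R DI a"
proof -
  have 2: "derivation (\<lambda>v. 2 *\<^sub>R L v) a = 2 *\<^sub>R derivation L a" if "linear L" for L
    using derivation_endo[OF that that, of 2 0] by simp
  have "(\<lambda>v. J (I v) - I (J v)) = (\<lambda>v. - 2 *\<^sub>R K v)" "(\<lambda>v. K (I v) - I (K v)) = (\<lambda>v. 2 *\<^sub>R J v)"
    "(\<lambda>v. K (J v) - J (K v)) = (\<lambda>v. - 2 *\<^sub>R I v)"
    by (auto simp: triple scaleR_2)
  then show "DJ (DI a) = DI (DJ a) - 2 *\<^sub>R DK a" "DK (DI a) = DI (DK a) + 2 *\<^sub>R DJ a"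
    "DK (DJ a) = DJ (DK a) - 2 *\<^sub>R DI a"
    using derivation_commutator[OF linear_J linear_I, of a] derivation_commutator[OF linear_K linear_I, of a]
      derivation_commutator[OF linear_K linear_J, of a]
      derivation_endo[OF linear_K linear_K, of "-2" 0] derivation_endo[OF linear_J linear_J, of 2 0]
      derivation_endo[OF linear_I linear_I, of "-2" 0]
    by (simp_all add: algebra_simps)
qed

text \<open>Since \<open>[D\<^sub>I, D\<^sub>J] = 2 D\<^sub>K\<close> etc. the anti-Hermitian generators are turned into an sl(2)-triple. The
  weight is \<open>p - q\<close> for forms of type \<open>(p, q)\<close> with respect to \<open>I\<close> in the convention
  \<open>\<alpha> \<circ> I = \<i> \<alpha>\<close> for type \<open>(1, 0)\<close>.\<close>

definition H :: "'v cform \<Rightarrow> 'v cform" where "H a = cscale \<i> (DI a)"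
definition X :: "'v cform \<Rightarrow> 'v cform" where "X a = cscale (1/2) (DJ a + cscale \<i> (DK a))"
definition Y :: "'v cform \<Rightarrow> 'v cform" where "Y a = cscale (- 1/2) (DJ a - cscale \<i> (DK a))"

lemmas HXY = H_def X_def Y_def

sublocale sl2 H X Y
proof (rule sl2.intro)
  show "linear H" "linear X" "linear Y"
    by (auto intro!: linearI simp: HXY D_simps cscale_simps algebra_simps)
  show "H (X a) = X (H a) + 2 *\<^sub>R X a" "H (Y a) = Y (H a) - 2 *\<^sub>R Y a" "X (Y a) = Y (X a) + H a" for a
    by (rule cform_eqI; simp add: HXY D_simps D_commutators cscale_simps; simp add: field_simps scaleR_conv_of_real)+
qed

lemma Cas_eq: "Cas a = DI (DI a) + DJ (DJ a) + DK (DK a)"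
  by (rule cform_eqI; simp add: Cas_def HXY D_simps D_commutators cscale_simps; simp add: field_simps scaleR_conv_of_real)

lemma Deg_H: "a \<in> Deg m \<Longrightarrow> H a \<in> Deg m" and Deg_X: "a \<in> Deg m \<Longrightarrow> X a \<in> Deg m"
  and Deg_Y: "a \<in> Deg m \<Longrightarrow> Y a \<in> Deg m"
  by (simp_all add: HXY Deg_cscale Deg_derivation linear_I linear_J linear_K subspace_add subspace_diff subspace_Deg)

lemma contract_D: "contract v (DI a) = DI (contract v a) - contract (I v) a"
  "contract v (DJ a) = DJ (contract v a) - contract (J v) a"
  "contract v (DK a) = DK (contract v a) - contract (K v) a"
  by (simp_all add: contract_derivation linear_I linear_J linear_K)

text \<open>Contraction with the \<open>(1, 0)\<close>-part of \<open>2 v\<close>; it lowers the weight by 1, and \<open>contract01\<close> raises it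
  by 1.\<close>

definition contract10 :: "'v \<Rightarrow> 'v cform \<Rightarrow> 'v cform" where
  "contract10 v a = contract v a - cscale \<i> (contract (I v) a)"

definition contract01 :: "'v \<Rightarrow> 'v cform \<Rightarrow> 'v cform" where
  "contract01 v a = contract v a + cscale \<i> (contract (I v) a)"

lemma contract_split: "contract v a = (1/2) *\<^sub>R (contract10 v a + contract01 v a)"
  by (simp add: contract10_def contract01_def flip: scaleR_2)

lemma linear_contract10: "linear (contract10 v)" and linear_contract01: "linear (contract01 v)"
  by (auto intro!: linearI simp: contract10_def contract01_def contract_simps cscale_simps algebra_simps)

lemma contract10_H: "contract10 v (H a) = H (contract10 v a) + contract10 v a"
  by (rule cform_eqI; simp add: contract10_def H_def contract_simps contract_D D_simps cscale_simps triple contract_vector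
      del: ev_simps(7); simp add: algebra_simps del: ev_simps(7))

lemma contract01_H: "contract01 v (H a) = H (contract01 v a) + (-1) *\<^sub>R contract01 v a"
  by (rule cform_eqI; simp add: contract01_def H_def contract_simps contract_D D_simps cscale_simps triple contract_vector
      del: ev_simps(7); simp add: algebra_simps del: ev_simps(7))

lemma Deg_contract10: "a \<in> Deg m \<Longrightarrow> contract10 v a \<in> Deg (m - 1)"
  and Deg_contract01: "a \<in> Deg m \<Longrightarrow> contract01 v a \<in> Deg (m - 1)"
  unfolding contract10_def contract01_def
  by (auto simp only: intro!: subspace_add subspace_diff subspace_Deg Deg_cscale Deg_contract)

text \<open>Both parts of a contraction shift the weight by one and lower the degree. They carry the product
  \<open>\<Prod>\<^sub>j (H - (m + 1 - 2j))\<close> to a multiple of the corresponding product for degree \<open>m\<close>.\<close>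

lemma Deg_weights: "a \<in> Deg m \<Longrightarrow> shift_prod H (map (\<lambda>j. real m - 2 * real j) [0..<Suc m]) a = 0"
proof (induction m arbitrary: a)
  case 0
  then show ?case by (simp add: H_def Deg_0_derivation linear_I cscale_simps)
next
  case (Suc m)
  define ws where "ws m = map (\<lambda>j. real m - 2 * real j) [0..<Suc m]" for m
  have split1: "map (\<lambda>s. s - 1) (ws (Suc m)) = ws m @ [- real m - 2]"
    by (simp add: ws_def)
  have split2: "map (\<lambda>s. s - - 1) (ws (Suc m)) = (real m + 2) # ws m"
  proof -
    have "map (\<lambda>s. s - - 1) (ws (Suc m)) = map (\<lambda>j. real m + 2 - 2 * real j) (0 # map Suc [0..<Suc m])"
      unfolding ws_def map_Suc_upt by (subst upt_conv_Cons) auto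
    also have "\<dots> = (real m + 2) # ws m" by (simp add: ws_def o_def del: upt_Suc)
    finally show ?thesis .
  qed
  show ?case unfolding ws_def[symmetric]
  proof (rule Deg_eq_0I)
    show "shift_prod H (ws (Suc m)) a \<in> Deg (Suc m)"
      by (rule shift_prod_in[OF subspace_Deg Deg_H Suc.prems])
    fix v
    have "contract10 v a \<in> Deg m" "contract01 v a \<in> Deg m"
      using Deg_contract10[OF Suc.prems] Deg_contract01[OF Suc.prems] by auto
    then have "shift_prod H (ws m) (contract10 v a) = 0"
      "shift_prod H (ws m) (H (contract01 v a) - (real m + 2) *\<^sub>R contract01 v a) = 0"
      unfolding ws_def using Suc.IH by (auto simp: Deg_H subspace_diff subspace_scale subspace_Deg simp del: upt_Suc)
    then have "contract10 v (shift_prod H (ws (Suc m)) a) = 0" "contract01 v (shift_prod H (ws (Suc m)) a) = 0"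
      unfolding shift_prod_linear_image[OF linear_contract10, where c=1, unfolded scaleR_one, OF contract10_H]
        shift_prod_linear_image[OF linear_contract01, where c="-1", OF contract01_H] split1 split2
      by (simp_all add: shift_prod_append H_simps)
    then show "contract v (shift_prod H (ws (Suc m)) a) = 0" by (simp add: contract_split)
  qed
qed

text \<open>\<open>I\<close> is a product \<open>J K = - K J\<close>, and the trace is symmetric in the factors.\<close>

lemma trace_I: "(\<Sum>b\<in>Basis. I b \<bullet> b) = 0"
proof -
  have jk: "(\<Sum>b\<in>Basis. L (M b) \<bullet> b) = (\<Sum>b\<in>Basis. \<Sum>c\<in>Basis. (M b \<bullet> c) * (L c \<bullet> b))" if "linear L" for L M :: "'v \<Rightarrow> 'v"
  proof (rule sum.cong[OF refl])
    fix b :: 'v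
    have "L (M b) \<bullet> b = L (\<Sum>c\<in>Basis. (M b \<bullet> c) *\<^sub>R c) \<bullet> b" by (simp add: euclidean_representation)
    then show "L (M b) \<bullet> b = (\<Sum>c\<in>Basis. (M b \<bullet> c) * (L c \<bullet> b))"
      by (simp add: linear_sum[OF that] linear_scale[OF that] inner_sum_left)
  qed
  have "(\<Sum>b\<in>Basis. J (K b) \<bullet> b) = (\<Sum>b\<in>Basis. K (J b) \<bullet> b)"
    unfolding jk[OF linear_J] jk[OF linear_K] by (subst sum.swap) (simp add: mult.commute)
  then show ?thesis by (simp add: triple sum_negf)
qed

text \<open>With \<open>\<eta> b\<close> the \<open>(1, 0)\<close>-part of the coordinate covector of \<open>b\<close>, the sum of
  \<open>wedge \<circ> contract\<close> over the basis counts the type: it is \<open>p = (m + h)/2\<close>. The sum in the other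
  order is therefore \<open>dim V / 2 - p\<close>, because \<open>I\<close> has trace 0. By induction downwards in the degree
  all wedges of \<open>a\<close> with \<open>(1, 0)\<close>-covectors vanish, so this nonzero scalar kills \<open>a\<close>.\<close>

lemma Deg_top:
  assumes "a \<in> Deg m" "a \<in> weight_space h" "real m + h > real DIM('v)"
  shows "a = 0"
  using assms
proof (induction "DIM('v) + 1 - m" arbitrary: m a h)
  case 0
  then show ?case using Deg_above_dim[of a m] by simp
next
  case (Suc n)
  define \<eta> where "\<eta> b v = (1/2 :: complex) * (of_real (v \<bullet> b) + - \<i> * of_real (I v \<bullet> b))" for b v
  have l1: "linear (\<lambda>v. complex_of_real (v \<bullet> b))" for b :: 'v
    by (auto simp: linear_iff inner_simps scaleR_conv_of_real)
  have l2: "linear (\<lambda>v. complex_of_real (I v \<bullet> b))" for b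
    using linear_I by (auto simp: linear_iff inner_simps scaleR_conv_of_real)
  note l3 = linear_compose_add[OF l1 linear_cmult[OF l2]]
  have \<eta>: "linear (\<eta> b)" for b unfolding \<eta>_def by (rule linear_cmult[OF l3])
  have w\<eta>: "wedge1 (\<eta> b) x = cscale (1/2) (wedge1 (\<lambda>v. of_real (v \<bullet> b)) x - cscale \<i> (wedge1 (\<lambda>v. of_real (I v \<bullet> b)) x))" for b x
    unfolding \<eta>_def wedge1_cmult[OF l3] wedge1_covector[OF l1 linear_cmult[OF l2]] wedge1_cmult[OF l2]
    by (simp add: cscale_simps)
  have lin_half: "linear (\<lambda>x. cscale c x)" for c :: complex and x :: "'v cform"
    by (rule linearI) (simp_all add: cscale_simps)
  have Ha: "H a = h *\<^sub>R a" using Suc.prems(2) by (simp add: weight_space_def)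
  have number: "(\<Sum>b\<in>Basis. wedge1 (\<eta> b) (contract b a)) = ((real m + h) / 2) *\<^sub>R a"
  proof -
    have "(\<Sum>b\<in>Basis. wedge1 (\<eta> b) (contract b a)) = cscale (1/2) (- derivation (\<lambda>v. v) a + cscale \<i> (DI a))"
      unfolding derivation_eq_basis_sum[OF linear_ident] derivation_eq_basis_sum[OF linear_I] w\<eta>
      by (simp add: cscale_simps linear_sum[OF lin_half] sum_subtractf)
    also have "\<dots> = cscale (1/2) (real m *\<^sub>R a + h *\<^sub>R a)"
      using Ha by (simp add: derivation_id[OF Suc.prems(1)] H_def)
    also have "\<dots> = ((real m + h) / 2) *\<^sub>R a"
      by (rule cform_eqI) (simp add: scaleR_conv_of_real field_simps)
    finally show ?thesis .
  qed
  have "contract b (wedge1 (\<eta> b) a) = 0" if "b \<in> Basis" for b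
  proof -
    have "wedge1 (\<eta> b) a = 0"
    proof (rule Suc.hyps(1))
      show "n = DIM('v) + 1 - Suc m" using Suc.hyps(2) by simp
      show "wedge1 (\<eta> b) a \<in> Deg (Suc m)" by (rule Deg_wedge1[OF \<eta> Suc.prems(1)])
      have "(\<lambda>v. \<eta> b (I v)) = (\<lambda>v. \<i> * \<eta> b v)"
        by (auto simp: \<eta>_def triple algebra_simps fun_eq_iff)
      then show "wedge1 (\<eta> b) a \<in> weight_space (h + 1)"
        using Ha
        by (simp add: weight_space_def H_def derivation_wedge1[OF linear_I \<eta>] wedge1_cmult[OF \<eta>] cscale_simps
            scaleR_add_left wedge1_simps(6)[OF \<eta>, symmetric])
           (simp add: wedge1_simps[OF \<eta>])
      show "real DIM('v) < real (Suc m) + (h + 1)" using Suc.prems(3) by simp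
    qed
    then show ?thesis by (simp add: contract_simps)
  qed
  then have "0 = (\<Sum>b\<in>Basis. contract b (wedge1 (\<eta> b) a))" by simp
  also have "\<dots> = (\<Sum>b\<in>Basis. cscale (\<eta> b b) a) - ((real m + h) / 2) *\<^sub>R a"
    by (simp add: contract_wedge1[OF \<eta>] sum_subtractf number)
  also have "(\<Sum>b\<in>Basis. cscale (\<eta> b b) a) = cscale (\<Sum>b\<in>Basis. \<eta> b b) a"
    by (rule cform_eqI) (simp add: sum_distrib_right)
  also have "(\<Sum>b\<in>Basis. \<eta> b b) = of_real (real DIM('v) / 2)"
  proof -
    have "(\<Sum>b\<in>Basis. \<eta> b b) = (1/2) * (\<Sum>b\<in>(Basis::'v set). of_real (b \<bullet> b)) + (- \<i> / 2) * of_real (\<Sum>b\<in>Basis. I b \<bullet> b)"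
    proof -
      have "\<eta> b b = (1/2) * of_real (b \<bullet> b) + (- \<i> / 2) * of_real (I b \<bullet> b)" for b
        by (simp add: \<eta>_def algebra_simps)
      then show ?thesis by (simp only: sum.distrib sum_distrib_left of_real_sum)
    qed
    also have "(\<Sum>b\<in>(Basis::'v set). complex_of_real (b \<bullet> b)) = (\<Sum>b\<in>(Basis::'v set). 1)"
      by (intro sum.cong) auto
    finally show ?thesis by (simp add: trace_I)
  qed
  finally have "((real DIM('v) - (real m + h)) / 2) *\<^sub>R a = 0"
    by (simp only: cscale_simps) (simp add: diff_divide_distrib scaleR_diff_left)
  then show ?case using Suc.prems(3) by simp
qed

end

lemma wedge1_self: "linear \<eta> \<Longrightarrow> wedge1 \<eta> (wedge1 \<eta> a) = 0"
proof -
  assume "linear \<eta>"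
  then have "wedge1 \<eta> (wedge1 \<eta> a) + wedge1 \<eta> (wedge1 \<eta> a) = 0"
    by (metis wedge1_anticommute add.left_inverse)
  then show ?thesis by (simp flip: scaleR_2)
qed

text \<open>\<open>u\<close> is dual to \<open>\<xi>\<close> in the quaternionic sense.\<close>

locale quaternionic_covector = quaternionic_triple I J K for I J K :: "'v::euclidean_space \<Rightarrow> 'v" +
  fixes \<xi> :: "'v \<Rightarrow> real" and u :: 'v
  assumes linear_\<xi>: "linear \<xi>" and dual: "\<xi> u = 1" "\<xi> (I u) = 0" "\<xi> (J u) = 0" "\<xi> (K u) = 0"
begin

text \<open>\<open>\<xi>1\<close> is the \<open>(1, 0)\<close>-part of \<open>\<xi>\<close>, and \<open>\<xi>2\<close> the image of its \<open>(0, 1)\<close>-part under \<open>X\<close>; hence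
  \<open>\<xi> = \<xi>1 + Y \<xi>2\<close> (see \<open>wedge_eq\<close>).\<close>

definition \<xi>1 :: "'v \<Rightarrow> complex" where "\<xi>1 v = (of_real (\<xi> v) - \<i> * of_real (\<xi> (I v))) / 2"
definition \<xi>2 :: "'v \<Rightarrow> complex" where "\<xi>2 v = - (of_real (\<xi> (J v)) + \<i> * of_real (\<xi> (K v))) / 2"

lemmas \<xi>_simps = linear_add[OF linear_\<xi>] linear_scale[OF linear_\<xi>] linear_neg[OF linear_\<xi>]

lemma linear_\<xi>12: "linear \<xi>1" "linear \<xi>2"
  by (auto intro!: linearI simp: \<xi>1_def \<xi>2_def \<xi>_simps linear_add[OF linear_I] linear_scale[OF linear_I]
      linear_add[OF linear_J] linear_scale[OF linear_J] linear_add[OF linear_K] linear_scale[OF linear_K]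
      scaleR_conv_of_real field_simps)

abbreviation "x1 \<equiv> wedge1 \<xi>1"
abbreviation "x2 \<equiv> wedge1 \<xi>2"
abbreviation "i1 \<equiv> contract10 u"
abbreviation "i2 \<equiv> contract10 (J u)"

lemma linear_comp: "linear \<eta> \<Longrightarrow> linear (\<lambda>v. \<eta> (I v))" "linear \<eta> \<Longrightarrow> linear (\<lambda>v. \<eta> (J v))"
  "linear \<eta> \<Longrightarrow> linear (\<lambda>v. \<eta> (K v))" for \<eta> :: "'v \<Rightarrow> 'b::real_vector"
  using linear_compose[OF linear_I, of \<eta>] linear_compose[OF linear_J, of \<eta>] linear_compose[OF linear_K, of \<eta>]
  by (simp_all add: o_def)

lemma highest_wedge1:
  assumes "linear \<eta>" "\<And>v. \<eta> (I v) = \<i> * \<eta> v" "\<And>v. \<eta> (K v) = \<i> * \<eta> (J v)"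
  shows "highest_operator (wedge1 \<eta>)"
proof -
  have JJ: "\<eta> (J (J v)) = - \<eta> v" for v using linear_neg[OF assms(1)] by (simp add: triple)
  have I: "(\<lambda>v. \<eta> (I v)) = (\<lambda>v. \<i> * \<eta> v)" and K: "(\<lambda>v. \<eta> (K v)) = (\<lambda>v. \<i> * \<eta> (J v))"
    using assms by auto
  define \<theta> where "\<theta> v = \<eta> (J v)" for v
  have \<theta>: "linear \<theta>" unfolding \<theta>_def by (rule linear_comp[OF assms(1)])
  have \<theta>J: "(\<lambda>v. \<theta> (J v)) = (\<lambda>v. (-1) * \<eta> v)" by (simp add: \<theta>_def JJ)
  have \<theta>K: "(\<lambda>v. \<theta> (K v)) = (\<lambda>v. \<i> * \<eta> v)" by (simp add: \<theta>_def triple assms)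
  have D: "DI (wedge1 \<eta> a) = wedge1 \<eta> (DI a) - cscale \<i> (wedge1 \<eta> a)"
    "DJ (wedge1 \<eta> a) = wedge1 \<eta> (DJ a) - wedge1 \<theta> a"
    "DK (wedge1 \<eta> a) = wedge1 \<eta> (DK a) - cscale \<i> (wedge1 \<theta> a)"
    "DJ (wedge1 \<theta> a) = wedge1 \<theta> (DJ a) + wedge1 \<eta> a"
    "DK (wedge1 \<theta> a) = wedge1 \<theta> (DK a) - cscale \<i> (wedge1 \<eta> a)" for a
    using wedge1_cmult[OF assms(1)] wedge1_cmult[OF \<theta>]
    by (simp_all only: derivation_wedge1 linear_I linear_J linear_K assms(1) \<theta> I K \<theta>J \<theta>K flip: \<theta>_def)
       (simp_all add: cscale_simps)
  note s = wedge1_simps[OF assms(1)] wedge1_simps[OF \<theta>] cscale_simps D D_simps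
  have "linear (wedge1 \<eta>)" by (rule linearI) (simp_all add: s)
  moreover have "X (wedge1 \<eta> a) = wedge1 \<eta> (X a)" for a
    by (rule cform_eqI; simp add: X_def s; simp add: field_simps)
  moreover have "H (wedge1 \<eta> a) = wedge1 \<eta> (H a) + wedge1 \<eta> a" for a
    by (rule cform_eqI; simp add: H_def s; simp add: field_simps)
  moreover have "Y (wedge1 \<eta> a) = wedge1 \<eta> (Y a) + wedge1 \<theta> a" for a
    by (rule cform_eqI; simp add: Y_def s; simp add: field_simps)
  moreover have "Y (wedge1 \<theta> a) = wedge1 \<theta> (Y a)" for a
    by (rule cform_eqI; simp add: Y_def s; simp add: field_simps)
  ultimately show ?thesis
    unfolding highest_operator_def by (simp add: Y_simps scaleR_2)
qed

lemma \<xi>12_type: "\<xi>1 (I v) = \<i> * \<xi>1 v" "\<xi>1 (K v) = \<i> * \<xi>1 (J v)" "\<xi>2 (I v) = \<i> * \<xi>2 v" "\<xi>2 (K v) = \<i> * \<xi>2 (J v)"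
  by (simp_all add: \<xi>1_def \<xi>2_def triple \<xi>_simps field_simps)

lemma \<xi>12_dual: "\<xi>1 u = 1/2" "\<xi>1 (I u) = \<i>/2" "\<xi>1 (J u) = 0" "\<xi>1 (K u) = 0"
  "\<xi>2 u = 0" "\<xi>2 (I u) = 0" "\<xi>2 (J u) = 1/2" "\<xi>2 (K u) = \<i>/2"
  by (simp_all add: \<xi>1_def \<xi>2_def triple \<xi>_simps dual)

lemma contract10_wedge1:
  assumes "linear \<eta>"
  shows "contract10 v (wedge1 \<eta> a) = cscale (\<eta> v - \<i> * \<eta> (I v)) a - wedge1 \<eta> (contract10 v a)"
  by (rule cform_eqI; simp add: contract10_def contract_wedge1 assms wedge1_simps cscale_simps del: ev_simps(7);
      simp add: algebra_simps del: ev_simps(7))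

sublocale sl2_symbol H X Y Deg "DIM('v)" x1 x2 i1 i2
proof (intro sl2_symbol.intro sl2_symbol_axioms.intro)
  show "sl2 H X Y" by (rule sl2_axioms)
  fix a :: "'v cform" and m h
  show "subspace (Deg m :: 'v cform set)" by (rule subspace_Deg)
  show "linear i1" "linear i2" by (rule linear_contract10)+
  show "H (i1 a) = i1 (H a) - i1 a" "H (i2 a) = i2 (H a) - i2 a" by (simp_all add: contract10_H)
  show "x1 (x1 a) = 0" "x2 (x2 a) = 0" "x2 (x1 a) = - x1 (x2 a)"
    by (rule wedge1_self wedge1_anticommute linear_\<xi>12)+
  have *: "\<xi>1 u - \<i> * \<xi>1 (I u) = 1" "\<xi>2 u - \<i> * \<xi>2 (I u) = 0"
     "\<xi>1 (J u) - \<i> * \<xi>1 (I (J u)) = 0" "\<xi>2 (J u) - \<i> * \<xi>2 (I (J u)) = 1"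
    by (simp_all add: \<xi>12_dual triple)
  show "i1 (x1 a) = a - x1 (i1 a)" "i1 (x2 a) = - x2 (i1 a)" "i2 (x1 a) = - x1 (i2 a)" "i2 (x2 a) = a - x2 (i2 a)"
    by (simp_all only: contract10_wedge1 linear_\<xi>12 *) (simp_all add: cscale_simps)
  show "highest_operator x1" "highest_operator x2"
    by (rule highest_wedge1 linear_\<xi>12 \<xi>12_type)+
next
  fix a :: "'v cform" and m h
  assume a: "a \<in> Deg m"
  show "H a \<in> Deg m" "X a \<in> Deg m" "Y a \<in> Deg m" by (rule Deg_H Deg_X Deg_Y a)+
  show "x1 a \<in> Deg (Suc m)" "x2 a \<in> Deg (Suc m)" by (rule Deg_wedge1 linear_\<xi>12 a)+
  show "i1 a \<in> Deg (m - 1)" "i2 a \<in> Deg (m - 1)" by (rule Deg_contract10 a)+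
  show "shift_prod H (map (\<lambda>j. real m - 2 * real j) [0..<Suc m]) a = 0" by (rule Deg_weights[OF a])
  show "a = 0" if "a \<in> weight_space h" "real DIM('v) < real m + h" by (rule Deg_top[OF a that])
next
  fix a :: "'v cform"
  assume a: "a \<in> Deg 0"
  show "i1 a = 0" "i2 a = 0" by (simp_all add: contract10_def Deg_0_contract[OF a] cscale_simps)
qed

lemma wedge_eq: "wedge a = wedge1 (\<lambda>v. of_real (\<xi> v)) a"
proof -
  have l: "linear (\<lambda>v. complex_of_real (\<xi> v))"
    by (rule linearI) (simp_all add: \<xi>_simps scaleR_conv_of_real)
  have "lower x2 a = cscale (1/2) (wedge1 (\<lambda>v. \<xi>2 (J v)) a + cscale (- \<i>) (wedge1 (\<lambda>v. \<xi>2 (K v)) a))"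
    by (rule cform_eqI;
        simp add: lower_def Y_def derivation_wedge1 linear_J linear_K linear_\<xi>12 wedge1_simps cscale_simps;
        simp add: field_simps)
  also have "\<dots> = wedge1 (\<lambda>v. (1/2) * (\<xi>2 (J v) + (- \<i>) * \<xi>2 (K v))) a"
    by (simp only: wedge1_cmult wedge1_covector linear_compose_add linear_cmult linear_comp linear_\<xi>12)
  finally have "wedge a = wedge1 (\<lambda>v. \<xi>1 v + (1/2) * (\<xi>2 (J v) + (- \<i>) * \<xi>2 (K v))) a"
    by (simp only: wedge_def wedge1_covector linear_compose_add linear_cmult linear_comp linear_\<xi>12)
  also have "(\<lambda>v. \<xi>1 v + (1/2) * (\<xi>2 (J v) + (- \<i>) * \<xi>2 (K v))) = (\<lambda>v. of_real (\<xi> v))"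
    by (rule ext) (simp add: \<xi>1_def \<xi>2_def triple \<xi>_simps field_simps)
  finally show ?thesis .
qed

end

section \<open>Descent to real forms\<close>

definition cform_of :: "('v::real_vector list \<Rightarrow> real) \<Rightarrow> 'v cform" where
  "cform_of \<alpha> = Abs_cform (\<lambda>vs. of_real (\<alpha> vs))"

definition re_form :: "'v::real_vector cform \<Rightarrow> 'v list \<Rightarrow> real" where
  "re_form \<omega> vs = Re (ev \<omega> vs)"

definition real_forms :: "nat \<Rightarrow> ('v::real_vector list \<Rightarrow> real) set" where
  "real_forms k = {\<alpha>. alternating \<alpha> \<and> (\<forall>vs. length vs \<noteq> k \<longrightarrow> \<alpha> vs = 0)}"

lemma ev_cform_of:
  assumes "alternating \<alpha>"
  shows "ev (cform_of \<alpha>) vs = of_real (\<alpha> vs)"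
proof -
  have "linear (of_real :: real \<Rightarrow> complex)" by (simp add: linear_iff scaleR_conv_of_real)
  from alternating_compose[OF this assms] show ?thesis
    unfolding cform_of_def by (subst Abs_cform_inverse) auto
qed

lemma alternating_re: "alternating (re_form \<omega>)"
proof -
  have "linear Re" by (simp add: linear_iff)
  from alternating_compose[OF this alternating_ev] show ?thesis unfolding re_form_def[abs_def] .
qed

lemma re_cform_of: "alternating \<alpha> \<Longrightarrow> re_form (cform_of \<alpha>) = \<alpha>"
  by (rule ext) (simp add: re_form_def ev_cform_of)

lemma real_formsD: "\<alpha> \<in> real_forms k \<Longrightarrow> alternating \<alpha>" by (simp add: real_forms_def)

lemma re_real_forms: "\<omega> \<in> Deg k \<Longrightarrow> re_form \<omega> \<in> real_forms k"
  by (simp add: real_forms_def alternating_re Deg_def) (simp add: re_form_def)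

lemma cform_of_Deg: "\<alpha> \<in> real_forms k \<Longrightarrow> cform_of \<alpha> \<in> Deg k"
  by (simp add: real_forms_def Deg_def ev_cform_of)

lemma cform_of_inject: "alternating \<alpha> \<Longrightarrow> alternating \<beta> \<Longrightarrow> cform_of \<alpha> = cform_of \<beta> \<Longrightarrow> \<alpha> = \<beta>"
  using re_cform_of by metis

lemma cform_of_derivation:
  "linear L \<Longrightarrow> alternating \<alpha> \<Longrightarrow> cform_of (deriv_fun L \<alpha>) = derivation L (cform_of \<alpha>)"
  by (rule cform_eqI) (simp add: ev_cform_of alternating_deriv ev_derivation deriv_fun_def)

lemma linear_of_real_comp: "linear \<xi> \<Longrightarrow> linear (\<lambda>v. complex_of_real (\<xi> v))"
  by (auto simp: linear_iff scaleR_conv_of_real)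

lemma cform_of_wedge:
  "linear \<xi> \<Longrightarrow> alternating \<alpha> \<Longrightarrow> cform_of (wedge_fun \<xi> \<alpha>) = wedge1 (\<lambda>v. of_real (\<xi> v)) (cform_of \<alpha>)"
  by (rule cform_eqI) (simp add: ev_cform_of alternating_wedge ev_wedge1 linear_of_real_comp wedge_fun_def)

lemma re_derivation: "linear L \<Longrightarrow> re_form (derivation L \<omega>) = deriv_fun L (re_form \<omega>)"
  by (rule ext) (simp add: re_form_def ev_derivation deriv_fun_def)

lemma re_wedge: "linear \<xi> \<Longrightarrow> re_form (wedge1 (\<lambda>v. of_real (\<xi> v)) \<omega>) = wedge_fun \<xi> (re_form \<omega>)"
  by (rule ext) (simp add: re_form_def ev_wedge1 linear_of_real_comp wedge_fun_def)

lemma wedge_real_forms: "linear \<xi> \<Longrightarrow> \<alpha> \<in> real_forms k \<Longrightarrow> wedge_fun \<xi> \<alpha> \<in> real_forms (Suc k)"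
  by (auto simp: real_forms_def alternating_wedge) (auto simp: wedge_fun_def intro!: sum.neutral)

definition real_part :: "'v::real_vector cform \<Rightarrow> 'v cform" where
  "real_part \<omega> = cform_of (re_form \<omega>)"

lemma ev_real_part: "ev (real_part \<omega>) vs = of_real (Re (ev \<omega> vs))"
  by (simp add: real_part_def ev_cform_of alternating_re re_form_def)

lemma real_part_simps:
  "real_part (\<alpha> + \<beta>) = real_part \<alpha> + real_part \<beta>" "real_part (\<alpha> - \<beta>) = real_part \<alpha> - real_part \<beta>"
  "real_part (r *\<^sub>R \<alpha>) = r *\<^sub>R real_part \<alpha>" "real_part 0 = 0"
  "real_part (- \<alpha>) = - real_part \<alpha>"
  by (rule cform_eqI; simp add: ev_real_part scaleR_conv_of_real)+

lemma real_part_cform_of: "alternating \<alpha> \<Longrightarrow> real_part (cform_of \<alpha>) = cform_of \<alpha>"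
  by (simp add: real_part_def re_cform_of)

lemma real_part_derivation: "linear L \<Longrightarrow> real_part (derivation L \<alpha>) = derivation L (real_part \<alpha>)"
  by (simp add: real_part_def re_derivation cform_of_derivation alternating_re)

lemma real_part_wedge: "linear \<xi> \<Longrightarrow>
    real_part (wedge1 (\<lambda>v. of_real (\<xi> v)) \<alpha>) = wedge1 (\<lambda>v. of_real (\<xi> v)) (real_part \<alpha>)"
  by (simp add: real_part_def re_wedge cform_of_wedge alternating_re)

context quaternionic_triple
begin

text \<open>The Casimir operator is real, although \<open>H\<close>, \<open>X\<close>, \<open>Y\<close> are not.\<close>

lemma real_part_isotypic: "\<alpha> \<in> isotypic r \<Longrightarrow> real_part \<alpha> \<in> isotypic r"
proof -
  assume "\<alpha> \<in> isotypic r"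
  then have "real_part (Cas \<alpha>) = real_part (- (r * (r + 2)) *\<^sub>R \<alpha>)" by (simp add: isotypic_def)
  then show ?thesis
    by (simp only: isotypic_def mem_Collect_eq)
       (simp add: Cas_eq real_part_simps real_part_derivation linear_I linear_J linear_K)
qed

definition real_casimir :: "('v list \<Rightarrow> real) \<Rightarrow> 'v list \<Rightarrow> real" where
  "real_casimir \<alpha> vs = deriv_fun I (deriv_fun I \<alpha>) vs + deriv_fun J (deriv_fun J \<alpha>) vs + deriv_fun K (deriv_fun K \<alpha>) vs"

text \<open>If \<open>I\<close>, \<open>J\<close>, \<open>K\<close> come from an adapted frame, this is the fibre of \<open>E\<^bsub>k,r\<^esub>\<close> (\<open>E_bundle_eq\<close>).\<close>

definition E_fiber :: "nat \<Rightarrow> nat \<Rightarrow> ('v list \<Rightarrow> real) set" where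
  "E_fiber k r = {\<alpha> \<in> real_forms k. \<forall>vs. real_casimir \<alpha> vs = - (real r * (real r + 2)) * \<alpha> vs}"

lemma ev_Cas_cform_of:
  assumes a: "alternating \<alpha>"
  shows "ev (Cas (cform_of \<alpha>)) vs = of_real (real_casimir \<alpha> vs)"
proof -
  have "Cas (cform_of \<alpha>) = cform_of (deriv_fun I (deriv_fun I \<alpha>)) + cform_of (deriv_fun J (deriv_fun J \<alpha>))
      + cform_of (deriv_fun K (deriv_fun K \<alpha>))"
    by (simp add: Cas_eq cform_of_derivation a alternating_deriv linear_I linear_J linear_K)
  then show ?thesis
    by (simp add: ev_cform_of a alternating_deriv linear_I linear_J linear_K real_casimir_def)
qed

lemma E_fiber_iff: "\<alpha> \<in> E_fiber k r \<longleftrightarrow> \<alpha> \<in> real_forms k \<and> cform_of \<alpha> \<in> isotypic (real r)"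
proof (cases "\<alpha> \<in> real_forms k")
  case True
  note a = real_formsD[OF True]
  note C = ev_Cas_cform_of[OF a]
  have "cform_of \<alpha> \<in> isotypic (real r) \<longleftrightarrow> (\<forall>vs. ev (Cas (cform_of \<alpha>)) vs = ev (- (real r * (real r + 2)) *\<^sub>R cform_of \<alpha>) vs)"
    unfolding isotypic_def mem_Collect_eq by (metis cform_eqI)
  also have "\<dots> \<longleftrightarrow> (\<forall>vs. real_casimir \<alpha> vs = - (real r * (real r + 2)) * \<alpha> vs)"
    unfolding C ev_simps(5) ev_cform_of[OF a] scaleR_conv_of_real of_real_mult[symmetric] of_real_eq_iff ..
  finally show ?thesis using True by (simp add: E_fiber_def)
qed (simp add: E_fiber_def)

lemma E_fiber_decomposition_unique:
  assumes "\<And>s. \<gamma> s \<in> E_fiber k s" "\<And>s. \<delta> s \<in> E_fiber k s"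
    and "\<And>vs. (\<Sum>s\<le>k. \<gamma> s vs) = (\<Sum>s\<le>k. \<delta> s vs)" "r \<le> k"
  shows "\<gamma> r = \<delta> r"
proof -
  have alt: "alternating (\<gamma> s)" "alternating (\<delta> s)" for s
    using assms(1,2) by (auto simp: E_fiber_iff dest: real_formsD)
  have "cform_of (\<gamma> r) - cform_of (\<delta> r) = 0"
  proof (rule eigen_sum_zero[OF linear_Cas, of "{..k}" "\<lambda>s. - (real s * (real s + 2))"])
    show "inj_on (\<lambda>s. - (real s * (real s + 2))) {..k}"
    proof (rule inj_onI)
      fix s t assume "- (real s * (real s + 2)) = - (real t * (real t + 2))"
      then have "(real s - real t) * (real s + real t + 2) = 0" by (simp add: algebra_simps)
      then show "s = t" by auto
    qed
    show "Cas (cform_of (\<gamma> s) - cform_of (\<delta> s)) = - (real s * (real s + 2)) *\<^sub>R (cform_of (\<gamma> s) - cform_of (\<delta> s))"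
      if "s \<in> {..k}" for s
      using assms(1)[of s] assms(2)[of s] subspace_diff[OF subspace_isotypic]
      unfolding E_fiber_iff by (intro isotypicD) blast
    show "(\<Sum>s\<le>k. cform_of (\<gamma> s) - cform_of (\<delta> s)) = 0"
      by (rule cform_eqI) (simp add: ev_cform_of alt sum_subtractf assms(3) flip: of_real_sum)
  qed (use assms(4) in auto)
  then show ?thesis using cform_of_inject[OF alt] by simp
qed

lemma zero_real_E: "(\<lambda>vs. 0) \<in> E_fiber k r"
  by (simp add: E_fiber_def real_forms_def alternating_zero real_casimir_def deriv_fun_def)

end

context quaternionic_covector
begin

definition real_symbol :: "nat \<Rightarrow> ('v list \<Rightarrow> real) \<Rightarrow> ('v list \<Rightarrow> real) \<Rightarrow> bool" where
  "real_symbol r \<alpha> \<beta> \<longleftrightarrow> symbol_rel r (cform_of \<alpha>) (cform_of \<beta>)"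

lemma wedge_cform_of: "alternating \<alpha> \<Longrightarrow> wedge (cform_of \<alpha>) = cform_of (wedge_fun \<xi> \<alpha>)"
  by (simp add: wedge_eq cform_of_wedge linear_\<xi>)

text \<open>The projections and the wedge with \<open>\<xi>\<close> are real operators, so complex solutions of the symbol equations
  have real parts that are solutions as well.\<close>

lemma symbol_rel_real_part:
  assumes "symbol_rel r a b"
  shows "symbol_rel r (real_part a) (real_part b)"
proof -
  have "wedge (real_part a) = real_part (wedge a)"
    by (simp add: wedge_eq real_part_wedge linear_\<xi>)
  then show ?thesis
    using assms real_part_isotypic by (auto simp: symbol_rel_def simp flip: real_part_simps)
qed

lemma E_fiber_Iso: "\<alpha> \<in> E_fiber m r \<Longrightarrow> cform_of \<alpha> \<in> Iso m r"
  by (simp add: E_fiber_iff Iso_def cform_of_Deg)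

lemma re_Iso: "b \<in> Iso m r \<Longrightarrow> re_form b \<in> E_fiber m r"
  using real_part_isotypic by (auto simp: E_fiber_iff Iso_def re_real_forms simp flip: real_part_def)

lemma E_fiber_alternating: "\<alpha> \<in> E_fiber m r \<Longrightarrow> alternating \<alpha>"
  by (auto simp: E_fiber_iff real_formsD)

lemma real_symbol_exists:
  assumes "\<alpha> \<in> E_fiber m r" "m = r + 2 * k"
  shows "\<exists>\<beta>\<in>E_fiber (Suc m) (Suc r). real_symbol r \<alpha> \<beta>"
proof -
  obtain b where b: "b \<in> Iso (Suc m) (Suc r)" "symbol_rel r (cform_of \<alpha>) b"
    using symbol_exists[OF E_fiber_Iso[OF assms(1)] assms(2)] by blast
  have "real_symbol r \<alpha> (re_form b)"
    using symbol_rel_real_part[OF b(2)] real_part_cform_of[OF E_fiber_alternating[OF assms(1)]]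
    by (simp add: real_symbol_def real_part_def[of b])
  then show ?thesis using re_Iso[OF b(1)] by blast
qed

lemma real_symbol_unique:
  "real_symbol r \<alpha> \<beta> \<Longrightarrow> real_symbol r \<alpha> \<beta>' \<Longrightarrow> alternating \<beta> \<Longrightarrow> alternating \<beta>' \<Longrightarrow> \<beta> = \<beta>'"
  unfolding real_symbol_def using symbol_rel_unique cform_of_inject by blast

lemma cform_of_zero: "cform_of (\<lambda>vs. 0) = 0"
  by (rule cform_eqI) (simp add: ev_cform_of alternating_zero)

lemma real_symbol_symbol:
  assumes "\<alpha> \<in> E_fiber m r" "m = r + 2 * k" "real_symbol r \<alpha> \<beta>" "real_symbol (Suc r) \<beta> \<gamma>" "alternating \<gamma>"
  shows "\<gamma> = (\<lambda>vs. 0)"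
proof -
  have "cform_of \<gamma> = cform_of (\<lambda>vs. 0)"
    using symbol_symbol[OF E_fiber_Iso[OF assms(1)] assms(2)] assms(3,4) by (simp add: real_symbol_def cform_of_zero)
  then show ?thesis by (rule cform_of_inject[OF assms(5) alternating_zero])
qed

lemma real_symbol_exact:
  assumes \<alpha>: "\<alpha> \<in> E_fiber (Suc m) (Suc r)" and k: "m = r + 2 * k"
    and closed: "real_symbol (Suc r) \<alpha> (\<lambda>vs. 0) \<or> m + r + 4 > DIM('v)"
    and r: "r \<ge> 1 \<or> k = 0"
  shows "\<exists>\<beta>\<in>E_fiber m r. real_symbol r \<beta> \<alpha>"
proof -
  obtain b where b: "b \<in> Iso m r" "symbol_rel r b (cform_of \<alpha>)"
    using symbol_exact[OF E_fiber_Iso[OF \<alpha>] k _ r] closed by (auto simp: real_symbol_def cform_of_zero)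
  have "real_symbol r (re_form b) \<alpha>"
    using symbol_rel_real_part[OF b(2)] real_part_cform_of[OF E_fiber_alternating[OF \<alpha>]]
    by (simp add: real_symbol_def real_part_def[of b])
  then show ?thesis using re_Iso[OF b(1)] by blast
qed

lemma real_symbol_injective_low_degree:
  assumes \<alpha>: "\<alpha> \<in> E_fiber m 0" and m: "m = 2 * k" "k \<le> 1" and "real_symbol 0 \<alpha> (\<lambda>vs. 0)"
  shows "\<alpha> = (\<lambda>vs. 0)"
proof -
  have "cform_of \<alpha> = cform_of (\<lambda>vs. 0)"
    using wedge_injective_low_degree[OF E_fiber_Iso[OF \<alpha>] m] assms(4)
    by (simp add: real_symbol_def symbol_rel_def cform_of_zero)
  then show ?thesis by (rule cform_of_inject[OF E_fiber_alternating[OF \<alpha>] alternating_zero])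
qed

lemma real_symbol_decomposition:
  assumes \<alpha>: "\<alpha> \<in> E_fiber m r" and "\<beta> \<in> E_fiber (Suc m) (Suc r)" "real_symbol r \<alpha> \<beta>" "r \<le> m"
  shows "\<exists>\<gamma>. (\<forall>s. \<gamma> s \<in> E_fiber (Suc m) s) \<and> (\<forall>vs. wedge_fun \<xi> \<alpha> vs = (\<Sum>s\<le>Suc m. \<gamma> s vs)) \<and> \<beta> = \<gamma> (Suc r)"
proof -
  note alt = E_fiber_alternating[OF \<alpha>] E_fiber_alternating[OF assms(2)]
  define \<delta> where "\<delta> vs = wedge_fun \<xi> \<alpha> vs - \<beta> vs" for vs
  have \<delta>: "\<delta> \<in> real_forms (Suc m)"
    using wedge_real_forms[OF linear_\<xi>, of \<alpha> m] \<alpha> assms(2) alternating_add[OF _ alternating_minus]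
    by (force simp: E_fiber_iff real_forms_def \<delta>_def[abs_def])
  have c\<delta>: "cform_of \<delta> = wedge (cform_of \<alpha>) - cform_of \<beta>"
    by (rule cform_eqI)
       (simp add: ev_cform_of real_formsD[OF \<delta>] wedge_cform_of alt alternating_wedge[OF linear_\<xi>], simp add: \<delta>_def)
  define \<gamma> where "\<gamma> s = (if s = Suc r then \<beta> else if Suc s = r then \<delta> else (\<lambda>vs. 0))" for s
  have "\<gamma> s \<in> E_fiber (Suc m) s" for s
  proof -
    have "\<delta> \<in> E_fiber (Suc m) s" if "Suc s = r"
      using assms(3) \<delta> c\<delta> that by (auto simp: real_symbol_def symbol_rel_def E_fiber_iff)
    then show ?thesis using assms(2) zero_real_E by (auto simp: \<gamma>_def)
  qed
  moreover have "wedge_fun \<xi> \<alpha> vs = (\<Sum>s\<le>Suc m. \<gamma> s vs)" for vs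
  proof (cases r)
    case 0
    then have "cform_of \<delta> = 0" using assms(3) c\<delta> by (simp add: real_symbol_def symbol_rel_def)
    then have "\<delta> vs = 0" using ev_cform_of[OF real_formsD[OF \<delta>], of vs] by simp
    moreover have "(\<Sum>s\<le>Suc m. \<gamma> s vs) = (\<Sum>s\<in>{Suc r}. \<gamma> s vs)"
      using 0 by (intro sum.mono_neutral_right) (auto simp: \<gamma>_def)
    ultimately show ?thesis by (simp add: \<delta>_def \<gamma>_def)
  next
    case (Suc r')
    have "(\<Sum>s\<le>Suc m. \<gamma> s vs) = (\<Sum>s\<in>{Suc r, r'}. \<gamma> s vs)"
      using Suc assms(4) by (intro sum.mono_neutral_right) (auto simp: \<gamma>_def)
    then show ?thesis using Suc by (simp add: \<gamma>_def \<delta>_def)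
  qed
  ultimately show ?thesis by (intro exI[of _ \<gamma>]) (simp add: \<gamma>_def)
qed

end

section \<open>Calculus of times-differentiable functions\<close>

lemma frechet_derivative_cong_open:
  assumes "open S" "x \<in> S" "\<And>y. y \<in> S \<Longrightarrow> f y = g y"
  shows "frechet_derivative f (at x) = frechet_derivative g (at x)"
proof -
  have "(f has_derivative D) (at x) \<longleftrightarrow> (g has_derivative D) (at x)" for D
    using assms has_derivative_transform_within_open by metis
  then show ?thesis by (simp add: frechet_derivative_def)
qed

lemma differentiable_cong_open:
  assumes "open S" "x \<in> S" "\<And>y. y \<in> S \<Longrightarrow> f y = g y"
  shows "f differentiable (at x) \<longleftrightarrow> g differentiable (at x)"
  unfolding differentiable_def using assms has_derivative_transform_within_open by metis

lemma times_diff_cong: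
  assumes "open S" "\<And>y. y \<in> S \<Longrightarrow> f y = g y"
  shows "times_differentiable_on m S f \<longleftrightarrow> times_differentiable_on m S g"
  using assms(2)
proof (induction m arbitrary: f g)
  case 0
  then show ?case by (simp cong: continuous_on_cong)
next
  case (Suc m)
  have "times_differentiable_on m S (\<lambda>x. frechet_derivative f (at x) v) \<longleftrightarrow>
      times_differentiable_on m S (\<lambda>x. frechet_derivative g (at x) v)" for v
    by (rule Suc.IH) (simp add: frechet_derivative_cong_open[OF assms(1) _ Suc.prems])
  then show ?case
    using differentiable_cong_open[OF assms(1) _ Suc.prems] by simp
qed

lemma times_diff_subset: "times_differentiable_on m S f \<Longrightarrow> T \<subseteq> S \<Longrightarrow> times_differentiable_on m T f"
  by (induction m arbitrary: f) (auto intro: continuous_on_subset)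

lemma times_diff_SucD: "times_differentiable_on (Suc m) S f \<Longrightarrow> times_differentiable_on m S f"
proof (induction m arbitrary: f)
  case 0
  then show ?case
    by (auto intro!: continuous_at_imp_continuous_on differentiable_imp_continuous_within)
next
  case (Suc m)
  then show ?case by (simp del: times_differentiable_on.simps(1)) 
qed

lemma times_diff_has_derivative:
  "times_differentiable_on (Suc m) S f \<Longrightarrow> x \<in> S \<Longrightarrow> (f has_derivative frechet_derivative f (at x)) (at x)"
  by (simp add: frechet_derivative_works)

text \<open>To differentiate once more it suffices to know some derivative \<open>f'\<close>, not
  \<open>frechet_derivative\<close> itself.\<close>

lemma times_diff_SucI:
  assumes "open S" "\<And>x. x \<in> S \<Longrightarrow> (f has_derivative f' x) (at x)"
    and "\<And>v. times_differentiable_on m S (\<lambda>x. f' x v)"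
  shows "times_differentiable_on (Suc m) S f"
proof -
  have "frechet_derivative f (at x) = f' x" if "x \<in> S" for x
    using frechet_derivative_at[OF assms(2)[OF that]] by simp
  then have "times_differentiable_on m S (\<lambda>x. frechet_derivative f (at x) v)" for v
    using times_diff_cong[OF assms(1), of "\<lambda>x. frechet_derivative f (at x) v" "\<lambda>x. f' x v" m] assms(3) by simp
  then show ?thesis using assms(2) by (auto simp: differentiable_def)
qed

lemma times_diff_const: "times_differentiable_on m S (\<lambda>x. c)"
  by (induction m arbitrary: c) (simp_all add: frechet_derivative_const)

lemma times_diff_linear:
  assumes "open S" "bounded_linear L"
  shows "times_differentiable_on m S f \<Longrightarrow> times_differentiable_on m S (\<lambda>x. L (f x))"
proof (induction m arbitrary: f)
  case 0
  then show ?case by (auto intro: bounded_linear.continuous_on[OF assms(2)])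
next
  case (Suc m)
  show ?case
  proof (rule times_diff_SucI[OF assms(1)])
    show "((\<lambda>x. L (f x)) has_derivative (\<lambda>v. L (frechet_derivative f (at x) v))) (at x)" if "x \<in> S" for x
      by (rule bounded_linear.has_derivative[OF assms(2) times_diff_has_derivative[OF Suc.prems that]])
    show "times_differentiable_on m S (\<lambda>x. L (frechet_derivative f (at x) v))" for v
      using Suc by simp
  qed
qed

lemma times_diff_add:
  assumes "open S"
  shows "times_differentiable_on m S f \<Longrightarrow> times_differentiable_on m S g \<Longrightarrow>
    times_differentiable_on m S (\<lambda>x. f x + g x)"
proof (induction m arbitrary: f g)
  case 0
  then show ?case by (auto intro: continuous_on_add)
next
  case (Suc m)
  show ?case
  proof (rule times_diff_SucI[OF assms])
    show "((\<lambda>x. f x + g x) has_derivative (\<lambda>v. frechet_derivative f (at x) v + frechet_derivative g (at x) v)) (at x)"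
      if "x \<in> S" for x
      by (rule has_derivative_add[OF times_diff_has_derivative[OF Suc.prems(1) that] times_diff_has_derivative[OF Suc.prems(2) that]])
    show "times_differentiable_on m S (\<lambda>x. frechet_derivative f (at x) v + frechet_derivative g (at x) v)" for v
      using Suc by simp
  qed
qed

lemma times_diff_scaleR:
  fixes f :: "'v::real_normed_vector \<Rightarrow> real"
  assumes "open S"
  shows "times_differentiable_on m S f \<Longrightarrow> times_differentiable_on m S g \<Longrightarrow>
    times_differentiable_on m S (\<lambda>x. f x *\<^sub>R g x)"
proof (induction m arbitrary: f g)
  case 0
  then show ?case by (auto intro: continuous_on_scaleR)
next
  case (Suc m)
  note low = times_diff_SucD[OF Suc.prems(1)] times_diff_SucD[OF Suc.prems(2)]
  show ?case
  proof (rule times_diff_SucI[OF assms])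
    show "((\<lambda>x. f x *\<^sub>R g x) has_derivative
       (\<lambda>v. f x *\<^sub>R frechet_derivative g (at x) v + frechet_derivative f (at x) v *\<^sub>R g x)) (at x)"
      if "x \<in> S" for x
      by (rule has_derivative_scaleR[OF times_diff_has_derivative[OF Suc.prems(1) that] times_diff_has_derivative[OF Suc.prems(2) that]])
    show "times_differentiable_on m S (\<lambda>x. f x *\<^sub>R frechet_derivative g (at x) v + frechet_derivative f (at x) v *\<^sub>R g x)" for v
      using Suc low by (auto intro!: times_diff_add assms)
  qed
qed

lemma times_diff_sum:
  assumes "open S" "\<And>i. i \<in> F \<Longrightarrow> times_differentiable_on m S (f i)"
  shows "times_differentiable_on m S (\<lambda>x. \<Sum>i\<in>F. f i x)"
  using assms(2)
proof (induction F rule: infinite_finite_induct)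
  case (insert i F)
  then show ?case by (simp add: times_diff_add[OF assms(1)])
qed (simp_all add: times_diff_const)

lemma linear_expand:
  fixes L :: "'v::euclidean_space \<Rightarrow> 'w::real_vector"
  assumes "linear L"
  shows "L w = (\<Sum>b\<in>Basis. (w \<bullet> b) *\<^sub>R L b)"
  using linear_sum[OF assms, of "\<lambda>b. (w \<bullet> b) *\<^sub>R b" Basis]
  by (simp add: euclidean_representation linear_scale[OF assms])

lemma times_diff_apply:
  fixes L :: "'p::real_normed_vector \<Rightarrow> 'v::euclidean_space \<Rightarrow> 'w::real_normed_vector"
  assumes "open S" "\<And>x. x \<in> S \<Longrightarrow> linear (L x)" "\<And>v. times_differentiable_on m S (\<lambda>x. L x v)"
    and "times_differentiable_on m S w"
  shows "times_differentiable_on m S (\<lambda>x. L x (w x))"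
proof -
  have "times_differentiable_on m S (\<lambda>x. \<Sum>b\<in>Basis. (w x \<bullet> b) *\<^sub>R L x b)"
    by (intro times_diff_sum times_diff_scaleR assms times_diff_linear[OF assms(1) bounded_linear_inner_left])
  then show ?thesis
    using times_diff_cong[OF assms(1), of "\<lambda>x. L x (w x)" "\<lambda>x. \<Sum>b\<in>Basis. (w x \<bullet> b) *\<^sub>R L x b" m]
      linear_expand[OF assms(2)] by blast
qed

lemma linear_inv_bij:
  fixes f :: "'v::real_vector \<Rightarrow> 'w::real_vector"
  assumes "linear f" "bij f"
  shows "linear (inv f)"
proof (rule linearI)
  have s: "f (inv f v) = v" and i: "inv f (f w) = w" for v w
    using assms(2) by (auto simp: bij_is_surj surj_f_inv_f bij_is_inj inv_f_f)
  fix a b c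
  show "inv f (a + b) = inv f a + inv f b"
    using i[of "inv f a + inv f b"] by (simp add: linear_add[OF assms(1)] s)
  show "inv f (c *\<^sub>R a) = c *\<^sub>R inv f a"
    using i[of "c *\<^sub>R inv f a"] by (simp add: linear_scale[OF assms(1)] s)
qed

text \<open>The map \<open>(y, u) \<mapsto> (y, M y u)\<close> has the inverse \<open>(y, v) \<mapsto> (y, inv (M y) v)\<close>. The theorem on
  derivatives of inverse functions in its strong form does not ask for continuity of the inverse, so no estimate on
  \<open>inv (M y)\<close> is needed.\<close>

lemma has_derivative_inverse_family:
  fixes M :: "'p::euclidean_space \<Rightarrow> 'v::euclidean_space \<Rightarrow> 'v"
  assumes S: "open S" and lin: "\<And>x. x \<in> S \<Longrightarrow> linear (M x)" and bij: "\<And>x. x \<in> S \<Longrightarrow> bij (M x)"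
    and td: "\<And>v. times_differentiable_on (Suc 0) S (\<lambda>x. M x v)" and x: "x \<in> S"
  shows "((\<lambda>y. inv (M y) v) has_derivative
      (\<lambda>h. - inv (M x) (frechet_derivative (\<lambda>y. M y (inv (M x) v)) (at x) h))) (at x)"
proof -
  define D where "D h u = frechet_derivative (\<lambda>y. M y u) (at x) h" for h u
  have M_der: "((\<lambda>y. M y u) has_derivative (\<lambda>h. D h u)) (at x)" if "x \<in> S" for u
    unfolding D_def by (rule times_diff_has_derivative[OF td that])
  have linv: "linear (inv (M y))" if "y \<in> S" for y
    using lin[OF that] bij[OF that] by (rule linear_inv_bij)
  define \<Phi> where "\<Phi> p = (fst p, M (fst p) (snd p))" for p :: "'p \<times> 'v"
  define \<Psi> where "\<Psi> p = (fst p, inv (M (fst p)) (snd p))" for p :: "'p \<times> 'v"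
  define u where "u = inv (M x) v"
  have Mu: "M x u = v" unfolding u_def using bij[OF x] by (simp add: bij_is_surj surj_f_inv_f)
  have open': "open (S \<times> (UNIV :: 'v set))" by (intro open_Times S open_UNIV)
  have \<Phi>_eq: "\<Phi> p = (fst p, \<Sum>b\<in>Basis. (snd p \<bullet> b) *\<^sub>R M (fst p) b)" if "p \<in> S \<times> UNIV" for p
    using that linear_expand[OF lin] by (auto simp: \<Phi>_def)
  have cont: "continuous_on (S \<times> UNIV) \<Phi>"
  proof -
    have "continuous_on (S \<times> UNIV) (\<lambda>p. M (fst p) b)" for b
    proof (rule continuous_on_compose2[of S "\<lambda>y. M y b"])
      show "continuous_on S (\<lambda>y. M y b)" using times_diff_SucD[OF td] by simp
    qed (auto intro: continuous_intros)
    then have "continuous_on (S \<times> (UNIV::'v set)) (\<lambda>p. (fst p, \<Sum>b\<in>Basis. (snd p \<bullet> b) *\<^sub>R M (fst p) b))"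
      by (intro continuous_intros)
    then show ?thesis using \<Phi>_eq by (simp cong: continuous_on_cong)
  qed
  define \<Phi>' where "\<Phi>' = (\<lambda>(h, w). (h, D h u + M x w))"
  define \<Psi>' where "\<Psi>' = (\<lambda>(h, w). (h, inv (M x) (w - D h u)))"
  have der\<Phi>: "(\<Phi> has_derivative \<Phi>') (at (x, u))"
  proof -
    have "((\<lambda>p. M (fst p) b) has_derivative (\<lambda>k. D (fst k) b)) (at (x, u))" for b
      using has_derivative_compose[of fst fst "(x,u)" UNIV "\<lambda>y. M y b" "\<lambda>h. D h b"] M_der[OF x]
      by (simp add: has_derivative_fst)
    then have "((\<lambda>p. (fst p, \<Sum>b\<in>Basis. (snd p \<bullet> b) *\<^sub>R M (fst p) b)) has_derivative
       (\<lambda>k. (fst k, \<Sum>b\<in>Basis. (u \<bullet> b) *\<^sub>R D (fst k) b + (snd k \<bullet> b) *\<^sub>R M x b))) (at (x, u))"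
      by (auto intro!: derivative_eq_intros simp: fun_eq_iff)
    moreover have "(\<lambda>k. (fst k, \<Sum>b\<in>Basis. (u \<bullet> b) *\<^sub>R D (fst k) b + (snd k \<bullet> b) *\<^sub>R M x b)) = \<Phi>'"
    proof -
      have "D h u = (\<Sum>b\<in>Basis. (u \<bullet> b) *\<^sub>R D h b)" for h
      proof -
        have "((\<lambda>y. \<Sum>b\<in>Basis. (u \<bullet> b) *\<^sub>R M y b) has_derivative (\<lambda>h. \<Sum>b\<in>Basis. (u \<bullet> b) *\<^sub>R D h b)) (at x)"
          by (auto intro!: derivative_eq_intros M_der x)
        then have "((\<lambda>y. M y u) has_derivative (\<lambda>h. \<Sum>b\<in>Basis. (u \<bullet> b) *\<^sub>R D h b)) (at x)"
          by (rule has_derivative_transform_within_open[OF _ S x]) (simp add: linear_expand[OF lin, symmetric])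
        from has_derivative_unique[OF this M_der[OF x]] show ?thesis by metis
      qed
      note Du = this
      show ?thesis
        unfolding \<Phi>'_def split_beta sum.distrib Du[symmetric] linear_expand[OF lin[OF x], symmetric] ..
    qed
    ultimately have "((\<lambda>p. (fst p, \<Sum>b\<in>Basis. (snd p \<bullet> b) *\<^sub>R M (fst p) b)) has_derivative \<Phi>') (at (x, u))" by simp
    then show ?thesis
      by (rule has_derivative_transform_within_open[OF _ open']) (use x \<Phi>_eq in auto)
  qed
  have "(\<Psi> has_derivative \<Psi>') (at (\<Phi> (x, u)))"
  proof (rule has_derivative_inverse_strong[OF open' _ cont _ der\<Phi>])
    show "(x, u) \<in> S \<times> UNIV" using x by simp
    show "\<And>p. p \<in> S \<times> UNIV \<Longrightarrow> \<Psi> (\<Phi> p) = p"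
      using bij by (auto simp: \<Psi>_def \<Phi>_def inv_f_f bij_is_inj)
    show "\<Phi>' \<circ> \<Psi>' = id"
      using bij[OF x] by (auto simp: \<Phi>'_def \<Psi>'_def fun_eq_iff bij_is_surj surj_f_inv_f)
  qed
  then have "(\<Psi> has_derivative \<Psi>') (at (x, v))" by (simp add: \<Phi>_def Mu)
  then have "((\<lambda>y. \<Psi> (y, v)) has_derivative (\<lambda>h. \<Psi>' (h, 0))) (at x)"
    by (rule has_derivative_compose[of "\<lambda>y. (y, v)" "\<lambda>h. (h, 0)" x UNIV, rotated])
       (auto intro!: derivative_eq_intros)
  from has_derivative_snd[OF this] show ?thesis
    by (simp add: \<Psi>_def \<Psi>'_def D_def u_def linear_neg[OF linv[OF x]])
qed

text \<open>By induction: the derivative of \<open>M\<^sup>-\<^sup>1 v\<close> is \<open>- M\<^sup>-\<^sup>1 (dM (M\<^sup>-\<^sup>1 v))\<close>, which involves only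
  \<open>M\<^sup>-\<^sup>1\<close> and one derivative of \<open>M\<close>.\<close>

lemma times_diff_inverse_family:
  fixes M :: "'p::euclidean_space \<Rightarrow> 'v::euclidean_space \<Rightarrow> 'v"
  assumes S: "open S" and lin: "\<And>x. x \<in> S \<Longrightarrow> linear (M x)" and bij: "\<And>x. x \<in> S \<Longrightarrow> bij (M x)"
    and td: "\<And>m v. times_differentiable_on m S (\<lambda>x. M x v)"
  shows "times_differentiable_on m S (\<lambda>x. inv (M x) v)"
proof (induction m arbitrary: v)
  case 0
  have "(\<lambda>y. inv (M y) v) differentiable (at x)" if "x \<in> S" for x
    using has_derivative_inverse_family[OF S lin bij td that] unfolding differentiable_def by blast
  then show ?case
    by (auto intro!: continuous_at_imp_continuous_on differentiable_imp_continuous_within)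
next
  case (Suc m)
  have linv: "linear (inv (M x))" if "x \<in> S" for x
    using lin[OF that] bij[OF that] by (rule linear_inv_bij)
  define D where "D h x u = frechet_derivative (\<lambda>y. M y u) (at x) h" for h x u
  have D: "times_differentiable_on m S (\<lambda>x. D h x u)" for h u
    using td[of "Suc m" u] by (simp add: D_def)
  have linD: "linear (D h x)" if "x \<in> S" for h x
  proof (rule linearI)
    have M_der: "((\<lambda>y. M y u) has_derivative (\<lambda>h. D h x u)) (at x)" for u
      unfolding D_def by (rule times_diff_has_derivative[OF td that])
    fix u w c
    have "((\<lambda>y. M y (u + w)) has_derivative (\<lambda>h. D h x u + D h x w)) (at x)"
      by (rule has_derivative_transform_within_open[OF has_derivative_add[OF M_der M_der] S that])
         (simp add: linear_add[OF lin])
    then show "D h x (u + w) = D h x u + D h x w" using has_derivative_unique[OF _ M_der] by metis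
    have "((\<lambda>y. M y (c *\<^sub>R u)) has_derivative (\<lambda>h. c *\<^sub>R D h x u)) (at x)"
      by (rule has_derivative_transform_within_open[OF has_derivative_scaleR_right[OF M_der] S that])
         (simp add: linear_scale[OF lin])
    then show "D h x (c *\<^sub>R u) = c *\<^sub>R D h x u" using has_derivative_unique[OF _ M_der] by metis
  qed
  show ?case
  proof (rule times_diff_SucI[OF S])
    show "((\<lambda>y. inv (M y) v) has_derivative (\<lambda>h. - inv (M x) (D h x (inv (M x) v)))) (at x)" if "x \<in> S" for x
      unfolding D_def by (rule has_derivative_inverse_family[OF S lin bij td that])
    show "times_differentiable_on m S (\<lambda>x. - inv (M x) (D h x (inv (M x) v)))" for h
    proof -
      have "times_differentiable_on m S (\<lambda>x. D h x (inv (M x) v))"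
        by (rule times_diff_apply[where L = "D h", OF S linD D Suc.IH])
      from times_diff_apply[where L = "\<lambda>x. inv (M x)", OF S linv Suc.IH this]
      show ?thesis by (rule times_diff_linear[OF S bounded_linear_minus[OF bounded_linear_ident]])
    qed
  qed
qed

lemma times_diff_multilinear:
  fixes \<alpha> :: "'v::euclidean_space list \<Rightarrow> real"
  assumes "open S" "\<And>us vs. linear (\<lambda>v. \<alpha> (us @ v # vs))"
    and "\<And>v. times_differentiable_on m S (\<lambda>x. L x v)"
  shows "times_differentiable_on m S (\<lambda>x. \<alpha> (us @ map (L x) vs))"
proof (induction vs arbitrary: us)
  case Nil
  then show ?case by (simp add: times_diff_const)
next
  case (Cons v vs)
  have "times_differentiable_on m S (\<lambda>x. (\<lambda>w. \<alpha> (us @ w # map (L x) vs)) (L x v))"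
  proof (rule times_diff_apply[OF assms(1) _ _ assms(3)])
    show "linear (\<lambda>w. \<alpha> (us @ w # map (L x) vs))" for x by (rule assms(2))
    show "times_differentiable_on m S (\<lambda>x. \<alpha> (us @ w # map (L x) vs))" for w
      using Cons.IH[of "us @ [w]"] by simp
  qed
  then show ?case by simp
qed

section \<open>Adapted frames\<close>

lemma qmult_bilinear:
  "qmult (p + p') q = qmult p q + qmult p' q" "qmult (c *\<^sub>R p) q = c *\<^sub>R qmult p q"
  "qmult p (q + q') = qmult p q + qmult p q'" "qmult p (c *\<^sub>R q) = c *\<^sub>R qmult p q"
  "qmult 0 q = 0" "qmult p 0 = 0"
  by (simp_all add: qmult_def vec_eq_iff forall_4 algebra_simps)

lemma qmult_sum: "qmult p (sum f S) = (\<Sum>s\<in>S. qmult p (f s))" "qmult (sum f S) q = (\<Sum>s\<in>S. qmult (f s) q)"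
  by (induction S rule: infinite_finite_induct) (simp_all add: qmult_bilinear)

lemma linear_lmul: "linear (lmul p)"
  by (rule linearI) (simp_all add: lmul_def vec_eq_iff qmult_bilinear)

lemma linear_rmul: "linear (\<lambda>v. rmul v A)"
  by (rule linearI) (simp_all add: rmul_def vec_eq_iff qmult_bilinear sum.distrib scaleR_sum_right)

lemma lmul_lmul: "lmul p (lmul q v) = lmul (qmult p q) v"
  by (simp add: lmul_def vec_eq_iff qmult_assoc)

lemma lmul_add: "lmul (p + q) v = lmul p v + lmul q v" "lmul (c *\<^sub>R p) v = c *\<^sub>R lmul p v"
  by (simp_all add: lmul_def vec_eq_iff qmult_bilinear)

lemma lmul_uminus: "lmul (- p) v = - lmul p v"
  using lmul_add(2)[of "-1" p v] by simp

lemma lmul_q1: "lmul q1 v = v"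
  by (simp add: lmul_def vec_eq_iff quat_units)

lemma lmul_rmul: "lmul p (rmul v A) = rmul (lmul p v) A"
  by (simp add: lmul_def rmul_def vec_eq_iff qmult_sum qmult_assoc)

lemma rmul_rmul: "rmul (rmul v A) B = rmul v (qmat_mult A B)"
proof -
  have "(\<Sum>j\<in>UNIV. qmult (\<Sum>i\<in>UNIV. qmult (v $ i) (A $ i $ j)) (B $ j $ l))
    = (\<Sum>i\<in>UNIV. qmult (v $ i) (\<Sum>j\<in>UNIV. qmult (A $ i $ j) (B $ j $ l)))" for l
    unfolding qmult_sum qmult_assoc by (rule sum.swap)
  then show ?thesis by (simp add: rmul_def qmat_mult_def vec_eq_iff)
qed

lemma rmul_one: "rmul v qmat_one = v"
proof -
  have "qmult (v $ i) (if i = j then q1 else 0) = (if i = j then v $ i else 0)" for i j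
    by (simp add: quat_units qmult_bilinear)
  then have "(\<Sum>i\<in>UNIV. qmult (v $ i) (qmat_one $ i $ j)) = v $ j" for j
    by (simp only: qmat_one_def vec_lambda_beta) simp
  then show ?thesis by (simp add: rmul_def vec_eq_iff)
qed

definition qconj :: "quat \<Rightarrow> quat" where
  "qconj q = vector [q $ 1, - q $ 2, - q $ 3, - q $ 4]"

lemma norm_quat: "(norm q)\<^sup>2 = (q $ 1)\<^sup>2 + (q $ 2)\<^sup>2 + (q $ 3)\<^sup>2 + (q $ 4)\<^sup>2" for q :: quat
  by (simp only: power2_norm_eq_inner) (simp add: inner_vec_def sum_4 power2_eq_square)

lemma qconj_inverse:
  assumes "norm q = 1"
  shows "qmult q (qconj q) = q1" "qmult (qconj q) q = q1"
  using norm_quat[of q] assms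
  by (simp_all add: qmult_def qconj_def q1_def vec_eq_iff forall_4 power2_eq_square algebra_simps)

text \<open>The structure group acts on the left multiplications through conjugation by the unit quaternion \<open>q\<close>, as
  right multiplication by matrices commutes with them.\<close>

lemma Sp1GLnH_elem:
  assumes "g \<in> Sp1GLnH"
  obtains q where "norm q = 1" "linear g" "bij g" "\<And>p v. g (lmul p v) = lmul (qmult (qmult q p) (qconj q)) (g v)"
proof -
  obtain q A B where g: "g = (\<lambda>v. rmul (lmul q v) A)" "norm q = 1"
    and AB: "qmat_mult A B = qmat_one" "qmat_mult B A = qmat_one"
    using assms by (auto simp: Sp1GLnH_def GLnH_def)
  have "linear g" using linear_compose[OF linear_lmul linear_rmul] by (simp add: g o_def)
  moreover have "bij g"
  proof (rule o_bij)
    let ?h = "\<lambda>v. lmul (qconj q) (rmul v B)"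
    show "?h \<circ> g = id" "g \<circ> ?h = id"
      by (auto simp: g fun_eq_iff rmul_rmul lmul_rmul AB rmul_one lmul_lmul qconj_inverse[OF g(2)] lmul_q1)
  qed
  moreover have "g (lmul p v) = lmul (qmult (qmult q p) (qconj q)) (g v)" for p v
  proof -
    have "qmult (qmult (qmult q p) (qconj q)) q = qmult q p"
      by (simp add: qmult_assoc qconj_inverse[OF g(2)] quat_units)
    then show ?thesis by (simp add: g lmul_rmul lmul_lmul)
  qed
  ultimately show thesis using that g(2) by blast
qed

lemma frame_triple:
  assumes "linear e" "bij e"
  shows "quaternionic_triple (frame_acs e qi) (frame_acs e qj) (frame_acs e qk)"
proof -
  have lin: "linear (frame_acs e p)" for p
    unfolding frame_acs_def
    by (intro linear_compose linear_inv_bij assms linear_lmul)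
  have comp: "frame_acs e p (frame_acs e q v) = frame_acs e (qmult p q) v" for p q v
    using assms(2) by (simp add: frame_acs_def bij_is_inj inv_f_f lmul_lmul)
  have minus: "frame_acs e (- p) v = - frame_acs e p v" for p v
    by (simp add: frame_acs_def lmul_uminus linear_neg[OF assms(1)])
  have one: "frame_acs e q1 v = v" for v
    using assms(2) by (simp add: frame_acs_def lmul_q1 bij_is_surj surj_f_inv_f)
  have neg: "qmult qj qi = - qk" "qmult qk qj = - qi" "qmult qi qk = - qj"
    by (simp_all add: qmult_def qi_def qj_def qk_def vec_eq_iff forall_4)
  show ?thesis
    by (rule quaternionic_triple.intro) (simp_all only: lin comp quat_units neg minus one)
qed

text \<open>A sum of squares does not change if the three summands are rotated.\<close>

lemma (in quaternionic_triple) Cas_rotated: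
  assumes "\<And>v. I' v = a1 *\<^sub>R I v + (b1 *\<^sub>R J v + c1 *\<^sub>R K v)" "\<And>v. J' v = a2 *\<^sub>R I v + (b2 *\<^sub>R J v + c2 *\<^sub>R K v)"
    "\<And>v. K' v = a3 *\<^sub>R I v + (b3 *\<^sub>R J v + c3 *\<^sub>R K v)"
    and orth: "a1\<^sup>2 + a2\<^sup>2 + a3\<^sup>2 = 1" "b1\<^sup>2 + b2\<^sup>2 + b3\<^sup>2 = 1" "c1\<^sup>2 + c2\<^sup>2 + c3\<^sup>2 = 1"
     "a1 * b1 + a2 * b2 + a3 * b3 = 0" "a1 * c1 + a2 * c2 + a3 * c3 = 0" "b1 * c1 + b2 * c2 + b3 * c3 = 0"
  shows "derivation I' (derivation I' \<alpha>) + derivation J' (derivation J' \<alpha>) + derivation K' (derivation K' \<alpha>) = Cas \<alpha>"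
proof -
  have D: "derivation (\<lambda>v. a *\<^sub>R I v + (b *\<^sub>R J v + c *\<^sub>R K v)) \<beta> = a *\<^sub>R DI \<beta> + (b *\<^sub>R DJ \<beta> + c *\<^sub>R DK \<beta>)" for a b c \<beta>
  proof -
    have "linear (\<lambda>v. b *\<^sub>R J v + c *\<^sub>R K v)"
      by (intro linear_compose_add linear_compose_scale_right linear_J linear_K)
    from derivation_endo[OF linear_I this, of a 1 \<beta>] show ?thesis
      using derivation_endo[OF linear_J linear_K, of b c \<beta>] by simp
  qed
  have e: "I' = (\<lambda>v. a1 *\<^sub>R I v + (b1 *\<^sub>R J v + c1 *\<^sub>R K v))" "J' = (\<lambda>v. a2 *\<^sub>R I v + (b2 *\<^sub>R J v + c2 *\<^sub>R K v))"
    "K' = (\<lambda>v. a3 *\<^sub>R I v + (b3 *\<^sub>R J v + c3 *\<^sub>R K v))" using assms(1-3) by auto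
  have "derivation I' (derivation I' \<alpha>) + derivation J' (derivation J' \<alpha>) + derivation K' (derivation K' \<alpha>)
    = (a1\<^sup>2 + a2\<^sup>2 + a3\<^sup>2) *\<^sub>R DI (DI \<alpha>) + (b1\<^sup>2 + b2\<^sup>2 + b3\<^sup>2) *\<^sub>R DJ (DJ \<alpha>) + (c1\<^sup>2 + c2\<^sup>2 + c3\<^sup>2) *\<^sub>R DK (DK \<alpha>)
      + (a1 * b1 + a2 * b2 + a3 * b3) *\<^sub>R (DI (DJ \<alpha>) + DJ (DI \<alpha>))
      + (a1 * c1 + a2 * c2 + a3 * c3) *\<^sub>R (DI (DK \<alpha>) + DK (DI \<alpha>))
      + (b1 * c1 + b2 * c2 + b3 * c3) *\<^sub>R (DJ (DK \<alpha>) + DK (DJ \<alpha>))"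
    unfolding e D by (simp add: D_simps scaleR_add_left scaleR_add_right power2_eq_square mult.commute)
  then show ?thesis by (simp add: orth Cas_eq)
qed

text \<open>Conjugation by a unit quaternion is a rotation of the imaginary quaternions; the entries are those of the
  Euler-Rodrigues formula.\<close>

lemma quat_rotation:
  assumes "norm q = 1"
  obtains a1 b1 c1 a2 b2 c2 a3 b3 c3 :: real where
    "qmult (qmult q qi) (qconj q) = a1 *\<^sub>R qi + (b1 *\<^sub>R qj + c1 *\<^sub>R qk)"
    "qmult (qmult q qj) (qconj q) = a2 *\<^sub>R qi + (b2 *\<^sub>R qj + c2 *\<^sub>R qk)"
    "qmult (qmult q qk) (qconj q) = a3 *\<^sub>R qi + (b3 *\<^sub>R qj + c3 *\<^sub>R qk)"
    "a1\<^sup>2 + a2\<^sup>2 + a3\<^sup>2 = 1" "b1\<^sup>2 + b2\<^sup>2 + b3\<^sup>2 = 1" "c1\<^sup>2 + c2\<^sup>2 + c3\<^sup>2 = 1"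
     "a1 * b1 + a2 * b2 + a3 * b3 = 0" "a1 * c1 + a2 * c2 + a3 * c3 = 0" "b1 * c1 + b2 * c2 + b3 * c3 = 0"
proof -
  define a b c d where "a = q $ 1" "b = q $ 2" "c = q $ 3" "d = q $ 4"
  define n where "n = a\<^sup>2 + b\<^sup>2 + c\<^sup>2 + d\<^sup>2"
  have n: "n = 1" using norm_quat[of q] assms by (simp add: n_def a_b_c_d_def)
  have nn: "n\<^sup>2 = 1" by (simp add: n)
  show thesis
  proof (rule that[of "a\<^sup>2 + b\<^sup>2 - c\<^sup>2 - d\<^sup>2" "2*b*c + 2*a*d" "2*b*d - 2*a*c"
        "2*b*c - 2*a*d" "a\<^sup>2 - b\<^sup>2 + c\<^sup>2 - d\<^sup>2" "2*c*d + 2*a*b"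
        "2*b*d + 2*a*c" "2*c*d - 2*a*b" "a\<^sup>2 - b\<^sup>2 - c\<^sup>2 + d\<^sup>2"])
    show "(a\<^sup>2 + b\<^sup>2 - c\<^sup>2 - d\<^sup>2)\<^sup>2 + (2*b*c - 2*a*d)\<^sup>2 + (2*b*d + 2*a*c)\<^sup>2 = 1"
      "(2*b*c + 2*a*d)\<^sup>2 + (a\<^sup>2 - b\<^sup>2 + c\<^sup>2 - d\<^sup>2)\<^sup>2 + (2*c*d - 2*a*b)\<^sup>2 = 1"
      "(2*b*d - 2*a*c)\<^sup>2 + (2*c*d + 2*a*b)\<^sup>2 + (a\<^sup>2 - b\<^sup>2 - c\<^sup>2 + d\<^sup>2)\<^sup>2 = 1"
      unfolding nn[symmetric] n_def by algebra+
    show "(a\<^sup>2 + b\<^sup>2 - c\<^sup>2 - d\<^sup>2) * (2*b*c + 2*a*d) + (2*b*c - 2*a*d) * (a\<^sup>2 - b\<^sup>2 + c\<^sup>2 - d\<^sup>2)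
        + (2*b*d + 2*a*c) * (2*c*d - 2*a*b) = 0"
      "(a\<^sup>2 + b\<^sup>2 - c\<^sup>2 - d\<^sup>2) * (2*b*d - 2*a*c) + (2*b*c - 2*a*d) * (2*c*d + 2*a*b)
        + (2*b*d + 2*a*c) * (a\<^sup>2 - b\<^sup>2 - c\<^sup>2 + d\<^sup>2) = 0"
      "(2*b*c + 2*a*d) * (2*b*d - 2*a*c) + (a\<^sup>2 - b\<^sup>2 + c\<^sup>2 - d\<^sup>2) * (2*c*d + 2*a*b)
        + (2*c*d - 2*a*b) * (a\<^sup>2 - b\<^sup>2 - c\<^sup>2 + d\<^sup>2) = 0"
      by algebra+
  qed (simp add: qmult_def qconj_def qi_def qj_def qk_def vec_eq_iff forall_4 flip: a_b_c_d_def;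
       simp add: power2_eq_square algebra_simps)+
qed

lemma alt_forms_eq: "alt_forms k = real_forms k"
proof (intro set_eqI iffI)
  fix \<alpha> :: "'n::finite form" assume "\<alpha> \<in> alt_forms k"
  then have sup: "\<And>vs. length vs \<noteq> k \<Longrightarrow> \<alpha> vs = 0"
    and lin: "\<And>vs i. length vs = k \<Longrightarrow> i < k \<Longrightarrow> linear (\<lambda>v. \<alpha> (vs[i := v]))"
    and alt: "\<And>vs i j. length vs = k \<Longrightarrow> i < j \<Longrightarrow> j < k \<Longrightarrow> vs ! i = vs ! j \<Longrightarrow> \<alpha> vs = 0"
    unfolding alt_forms_def by blast+
  have "linear (\<lambda>v. \<alpha> (us @ v # vs))" for us vs
  proof (cases "length us + Suc (length vs) = k")
    case True
    then have "linear (\<lambda>v. \<alpha> ((us @ 0 # vs)[length us := v]))" by (intro lin) auto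
    then show ?thesis by simp
  next
    case False
    then have "(\<lambda>v. \<alpha> (us @ v # vs)) = (\<lambda>v. 0)" using sup by auto
    then show ?thesis by (simp add: linear_iff)
  qed
  moreover have "\<alpha> (us @ v # v # vs) = 0" for us v vs
  proof (cases "length us + Suc (Suc (length vs)) = k")
    case True
    then show ?thesis by (intro alt[of _ "length us" "Suc (length us)"]) (auto simp: nth_append)
  qed (auto intro: sup)
  ultimately show "\<alpha> \<in> real_forms k" using sup by (simp add: real_forms_def alternating_def)
next
  fix \<alpha> :: "'n::finite form" assume "\<alpha> \<in> real_forms k"
  then have sup: "\<And>vs. length vs \<noteq> k \<Longrightarrow> \<alpha> vs = 0" and a: "alternating \<alpha>" by (auto simp: real_forms_def)
  have "linear (\<lambda>v. \<alpha> (vs[i := v]))" if "length vs = k" "i < k" for vs i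
    using alternatingD(1)[OF a, of "take i vs" "drop (Suc i) vs"] that by (simp add: upd_conv_take_nth_drop)
  moreover have "\<alpha> vs = 0" if "length vs = k" "i < j" "j < k" "vs ! i = vs ! j" for vs i j
  proof -
    have "vs = take i vs @ vs ! i # drop (Suc i) vs"
      by (rule id_take_nth_drop) (use that in simp)
    also have "drop (Suc i) vs = take (j - Suc i) (drop (Suc i) vs) @ vs ! j # drop (Suc j) vs"
      using id_take_nth_drop[of "j - Suc i" "drop (Suc i) vs"] that by simp
    finally have "vs = take i vs @ vs ! i # take (j - Suc i) (drop (Suc i) vs) @ vs ! i # drop (Suc j) vs"
      using that by simp
    then show ?thesis using alternating_repeated[OF a] by metis
  qed
  ultimately show "\<alpha> \<in> alt_forms k" using sup by (simp add: alt_forms_def) blast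
qed

lemma deriv_action_eq: "deriv_action L \<alpha> = deriv_fun L \<alpha>"
  by (rule ext) (simp add: deriv_action_def deriv_fun_def)

lemma casimir_eq:
  assumes "linear e" "bij e"
  shows "casimir e \<alpha> vs = quaternionic_triple.real_casimir (frame_acs e qi) (frame_acs e qj) (frame_acs e qk) \<alpha> vs"
proof -
  interpret quaternionic_triple "frame_acs e qi" "frame_acs e qj" "frame_acs e qk"
    by (rule frame_triple[OF assms])
  have "qi \<noteq> qj" "qi \<noteq> qk" "qj \<noteq> qk" by (auto simp: qi_def qj_def qk_def vec_eq_iff forall_4)
  then show ?thesis by (simp add: casimir_def real_casimir_def deriv_action_eq)
qed

lemma casimir_frame_independent:
  assumes e: "linear e" "bij e" and g: "g \<in> Sp1GLnH" and \<alpha>: "alternating \<alpha>"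
  shows "casimir (e \<circ> g) \<alpha> vs = casimir e \<alpha> vs"
proof -
  obtain q where q: "norm q = 1" "linear g" "bij g" "\<And>p v. g (lmul p v) = lmul (qmult (qmult q p) (qconj q)) (g v)"
    using Sp1GLnH_elem[OF g] by metis
  have eg: "linear (e \<circ> g)" "bij (e \<circ> g)"
    using e q by (auto intro: linear_compose bij_comp)
  have acs: "frame_acs (e \<circ> g) p = frame_acs e (qmult (qmult q p) (qconj q))" for p
  proof
    fix v
    have "inv (e \<circ> g) v = inv g (inv e v)" using o_inv_distrib[OF e(2) q(3)] by simp
    then show "frame_acs (e \<circ> g) p v = frame_acs e (qmult (qmult q p) (qconj q)) v"
      using q(3) by (simp add: frame_acs_def q(4) bij_is_surj surj_f_inv_f)
  qed
  have lin: "frame_acs e (a *\<^sub>R p + (b *\<^sub>R p' + c *\<^sub>R p'')) v = a *\<^sub>R frame_acs e p v + (b *\<^sub>R frame_acs e p' v + c *\<^sub>R frame_acs e p'' v)"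
    for a b c p p' p'' v
    by (simp add: frame_acs_def lmul_add linear_add[OF e(1)] linear_scale[OF e(1)])
  interpret t: quaternionic_triple "frame_acs e qi" "frame_acs e qj" "frame_acs e qk"
    by (rule frame_triple[OF e])
  interpret t': quaternionic_triple "frame_acs (e \<circ> g) qi" "frame_acs (e \<circ> g) qj" "frame_acs (e \<circ> g) qk"
    by (rule frame_triple[OF eg])
  obtain a1 b1 c1 a2 b2 c2 a3 b3 c3 :: real where R:
    "qmult (qmult q qi) (qconj q) = a1 *\<^sub>R qi + (b1 *\<^sub>R qj + c1 *\<^sub>R qk)"
    "qmult (qmult q qj) (qconj q) = a2 *\<^sub>R qi + (b2 *\<^sub>R qj + c2 *\<^sub>R qk)"
    "qmult (qmult q qk) (qconj q) = a3 *\<^sub>R qi + (b3 *\<^sub>R qj + c3 *\<^sub>R qk)"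
    "a1\<^sup>2 + a2\<^sup>2 + a3\<^sup>2 = 1" "b1\<^sup>2 + b2\<^sup>2 + b3\<^sup>2 = 1" "c1\<^sup>2 + c2\<^sup>2 + c3\<^sup>2 = 1"
     "a1 * b1 + a2 * b2 + a3 * b3 = 0" "a1 * c1 + a2 * c2 + a3 * c3 = 0" "b1 * c1 + b2 * c2 + b3 * c3 = 0"
    by (rule quat_rotation[OF q(1)])
  have "t'.Cas (cform_of \<alpha>) = t.Cas (cform_of \<alpha>)"
    unfolding t'.Cas_eq by (rule t.Cas_rotated[OF _ _ _ R(4-9)]) (simp_all only: acs R(1-3) lin)
  then have "t'.real_casimir \<alpha> vs = t.real_casimir \<alpha> vs"
    using t.ev_Cas_cform_of[OF \<alpha>] t'.ev_Cas_cform_of[OF \<alpha>] by (metis of_real_eq_iff)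
  then show ?thesis by (simp only: casimir_eq[OF e] casimir_eq[OF eg])
qed

lemma qmat_one_mult: "qmat_mult qmat_one qmat_one = qmat_one"
proof -
  have "qmult (if i = l then q1 else 0) (if l = j then q1 else 0) = (if i = l then (if i = j then q1 else 0) else 0)" for i l j :: 'a
    by (simp add: quat_units qmult_bilinear)
  then have "(\<Sum>l\<in>UNIV. qmult ((qmat_one :: 'a qmat) $ i $ l) (qmat_one $ l $ j)) = qmat_one $ i $ j" for i j
    by (simp only: qmat_one_def vec_lambda_beta) simp
  then show ?thesis by (simp add: qmat_mult_def vec_eq_iff)
qed

lemma id_Sp1GLnH: "id \<in> Sp1GLnH"
proof -
  have "norm q1 = 1" using norm_quat[of q1] by (simp add: q1_def) (metis norm_ge_zero one_power2 power2_eq_imp_eq zero_le_one)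
  moreover have "id = (\<lambda>v. rmul (lmul q1 v) qmat_one)" by (simp add: fun_eq_iff lmul_q1 rmul_one)
  moreover have "qmat_one \<in> GLnH" unfolding GLnH_def using qmat_one_mult by blast
  ultimately show ?thesis unfolding Sp1GLnH_def by blast
qed

lemma adapted_frame:
  assumes "Sp1GLnH_structure A Q" "e \<in> Q x"
  shows "linear e" "bij e"
proof -
  obtain e0 where e0: "linear e0" "bij e0" "Q x = {e0 \<circ> g | g. g \<in> Sp1GLnH}"
    using assms(1) unfolding Sp1GLnH_structure_def by blast
  then obtain g where g: "e = e0 \<circ> g" "g \<in> Sp1GLnH" using assms(2) by blast
  have "linear g" "bij g" using Sp1GLnH_elem[OF g(2)] by metis+
  then show "linear e" "bij e" using e0 g by (auto intro: linear_compose bij_comp)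
qed

lemma casimir_adapted:
  assumes "Sp1GLnH_structure A Q" "e \<in> Q x" "e' \<in> Q x" "alternating \<alpha>"
  shows "casimir e \<alpha> vs = casimir e' \<alpha> vs"
proof -
  obtain e0 where e0: "linear e0" "bij e0" "Q x = {e0 \<circ> g | g. g \<in> Sp1GLnH}"
    using assms(1) unfolding Sp1GLnH_structure_def by blast
  then obtain g g' where "e = e0 \<circ> g" "g \<in> Sp1GLnH" "e' = e0 \<circ> g'" "g' \<in> Sp1GLnH" using assms(2,3) by blast
  then show ?thesis by (simp add: casimir_frame_independent[OF e0(1,2) _ assms(4)])
qed

lemma E_bundle_eq:
  assumes "Sp1GLnH_structure A Q" "e \<in> Q x"
  shows "E_bundle Q k r x = quaternionic_triple.E_fiber (frame_acs e qi) (frame_acs e qj) (frame_acs e qk) k r"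
proof -
  interpret quaternionic_triple "frame_acs e qi" "frame_acs e qj" "frame_acs e qk"
    by (rule frame_triple[OF adapted_frame[OF assms]])
  have "(\<forall>e'\<in>Q x. \<forall>vs. casimir e' \<alpha> vs = - (real r * (real r + 2)) * \<alpha> vs) \<longleftrightarrow>
      (\<forall>vs. real_casimir \<alpha> vs = - (real r * (real r + 2)) * \<alpha> vs)" if "\<alpha> \<in> real_forms k" for \<alpha>
    using casimir_adapted[OF assms(1) _ assms(2) real_formsD[OF that]] casimir_eq[OF adapted_frame[OF assms]] assms(2)
    by (metis (no_types, lifting))
  then show ?thesis unfolding E_bundle_def E_fiber_def alt_forms_eq by blast
qed

lemma deriv_fun_pullback:
  assumes "\<And>v. L (M v) = M' (L v)"
  shows "deriv_fun M (\<lambda>vs. \<alpha> (map L vs)) vs = deriv_fun M' \<alpha> (map L vs)"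
  by (simp add: deriv_fun_def map_update assms)

lemma alternating_pullback:
  assumes "linear L" "alternating \<alpha>"
  shows "alternating (\<lambda>vs. \<alpha> (map L vs))"
  using linear_compose[OF assms(1) alternatingD(1)[OF assms(2)]] alternatingD(2)[OF assms(2)]
  by (auto simp: alternating_def o_def)

text \<open>Frames at two points identify the quaternionic structures of the tangent spaces, hence the fibres of
  \<open>E\<^bsub>k,r\<^esub>\<close>.\<close>

lemma E_bundle_pullback:
  assumes Q: "Sp1GLnH_structure A Q" and e: "e \<in> Q x" "e' \<in> Q y" and \<alpha>: "\<alpha> \<in> E_bundle Q k r x"
  shows "(\<lambda>vs. \<alpha> (map (e \<circ> inv e') vs)) \<in> E_bundle Q k r y"
proof -
  note f = adapted_frame[OF Q e(1)] and f' = adapted_frame[OF Q e(2)]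
  interpret t: quaternionic_triple "frame_acs e qi" "frame_acs e qj" "frame_acs e qk" by (rule frame_triple[OF f])
  interpret t': quaternionic_triple "frame_acs e' qi" "frame_acs e' qj" "frame_acs e' qk" by (rule frame_triple[OF f'])
  have \<alpha>': "\<alpha> \<in> t.E_fiber k r" using \<alpha> E_bundle_eq[OF Q e(1)] by blast
  have L: "linear (e \<circ> inv e')" by (intro linear_compose linear_inv_bij f f')
  have comm: "(e \<circ> inv e') (frame_acs e' p v) = frame_acs e p ((e \<circ> inv e') v)" for p v
    using f f' by (simp add: frame_acs_def bij_is_inj inv_f_f)
  have "t'.real_casimir (\<lambda>vs. \<alpha> (map (e \<circ> inv e') vs)) vs = t.real_casimir \<alpha> (map (e \<circ> inv e') vs)" for vs
    unfolding t.real_casimir_def t'.real_casimir_def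
    by (simp only: deriv_fun_pullback[of "e \<circ> inv e'" "frame_acs e' p" "frame_acs e p" for p, OF comm, abs_def])
  then have "(\<lambda>vs. \<alpha> (map (e \<circ> inv e') vs)) \<in> t'.E_fiber k r"
    using \<alpha>' alternating_pullback[OF L] by (auto simp: t.E_fiber_def t'.E_fiber_def real_forms_def)
  then show ?thesis using E_bundle_eq[OF Q e(2)] by blast
qed

section \<open>Computation of the principal symbol\<close>

locale manifold_atlas =
  fixes A :: "('a::{t2_space, second_countable_topology}, 'n::finite) chart set"
  assumes atlas: "smooth_atlas A"
begin

lemma chart_open: "c \<in> A \<Longrightarrow> open (fst c)" "c \<in> A \<Longrightarrow> open (snd c ` fst c)"
  and chart_homeo: "c \<in> A \<Longrightarrow> homeomorphism (fst c) (snd c ` fst c) (snd c) (chart_inv c)"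
  using atlas by (auto simp: smooth_atlas_def)

lemma chart_inv_chart: "c \<in> A \<Longrightarrow> y \<in> fst c \<Longrightarrow> chart_inv c (snd c y) = y"
  using chart_homeo homeomorphism_apply1 by blast

lemma chart_chart_inv: "c \<in> A \<Longrightarrow> p \<in> snd c ` fst c \<Longrightarrow> snd c (chart_inv c p) = p"
  using chart_homeo homeomorphism_apply2 by blast

lemma chart_at: "chart_at A x \<in> A" "x \<in> fst (chart_at A x)"
proof -
  have "x \<in> (\<Union>c\<in>A. fst c)" using atlas by (simp add: smooth_atlas_def)
  then have "\<exists>c. c \<in> A \<and> x \<in> fst c" by blast
  then have "chart_at A x \<in> A \<and> x \<in> fst (chart_at A x)" unfolding chart_at_def by (rule someI_ex)
  then show "chart_at A x \<in> A" "x \<in> fst (chart_at A x)" by auto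
qed

lemma chart_image_eq:
  assumes "c \<in> A"
  shows "snd c ` (fst c \<inter> U) = {p \<in> snd c ` fst c. chart_inv c p \<in> U}"
  using chart_inv_chart[OF assms] by force

lemma open_chart_image:
  assumes "c \<in> A" "open U"
  shows "open (snd c ` (fst c \<inter> U))"
proof -
  have "continuous_on (snd c ` fst c) (chart_inv c)"
    using chart_homeo[OF assms(1)] by (simp add: homeomorphism_def)
  then have "open (snd c ` fst c \<inter> chart_inv c -` U)"
    using chart_open(2)[OF assms(1)] assms(2) by (simp add: continuous_open_preimage)
  moreover have "snd c ` (fst c \<inter> U) = snd c ` fst c \<inter> chart_inv c -` U"
    unfolding chart_image_eq[OF assms(1)] by auto
  ultimately show ?thesis by simp
qed

lemma transition_smooth:
  assumes "c \<in> A" "c' \<in> A"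
  shows "times_differentiable_on m (snd c ` (fst c \<inter> fst c')) (\<lambda>p. snd c' (chart_inv c p))"
  using atlas assms unfolding smooth_atlas_def smooth_on_def o_def by blast

lemma transition_derivative:
  assumes "c \<in> A" "c' \<in> A" "y \<in> fst c" "y \<in> fst c'"
  shows "((\<lambda>p. snd c' (chart_inv c p)) has_derivative coord_change c c' y) (at (snd c y))"
  using times_diff_has_derivative[OF transition_smooth[OF assms(1,2)], of "snd c y"] assms(3,4)
  by (simp add: coord_change_def o_def)

lemma linear_coord_change: "c \<in> A \<Longrightarrow> c' \<in> A \<Longrightarrow> y \<in> fst c \<Longrightarrow> y \<in> fst c' \<Longrightarrow> linear (coord_change c c' y)"
  using transition_derivative has_derivative_linear by blast

lemma coord_change_compose:
  assumes c: "c \<in> A" "c' \<in> A" "c'' \<in> A" and y: "y \<in> fst c" "y \<in> fst c'" "y \<in> fst c''"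
  shows "coord_change c' c'' y (coord_change c c' y v) = coord_change c c'' y v"
proof -
  define S where "S = snd c ` (fst c \<inter> fst c')"
  have S: "open S" "snd c y \<in> S" unfolding S_def using open_chart_image[OF c(1) chart_open(1)[OF c(2)]] y by auto
  have "((\<lambda>p. snd c'' (chart_inv c' (snd c' (chart_inv c p)))) has_derivative
      (\<lambda>v. coord_change c' c'' y (coord_change c c' y v))) (at (snd c y))"
    by (rule has_derivative_compose[OF transition_derivative[OF c(1,2) y(1,2)]])
       (simp add: chart_inv_chart[OF c(1) y(1)] transition_derivative[OF c(2,3) y(2,3)])
  then have "((\<lambda>p. snd c'' (chart_inv c p)) has_derivative
      (\<lambda>v. coord_change c' c'' y (coord_change c c' y v))) (at (snd c y))"
    by (rule has_derivative_transform_within_open[OF _ S])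
       (auto simp: S_def chart_inv_chart[OF c(1)] chart_inv_chart[OF c(2)])
  from has_derivative_unique[OF this transition_derivative[OF c(1,3) y(1,3)]] show ?thesis by metis
qed

lemma coord_change_refl:
  assumes "c \<in> A" "y \<in> fst c"
  shows "coord_change c c y v = v"
proof -
  have "((\<lambda>p. p) has_derivative (\<lambda>v. v)) (at (snd c y))" by (rule has_derivative_ident)
  then have "((\<lambda>p. snd c (chart_inv c p)) has_derivative (\<lambda>v. v)) (at (snd c y))"
    by (rule has_derivative_transform_within_open[OF _ chart_open(2)[OF assms(1)]])
       (use assms chart_chart_inv in auto)
  from has_derivative_unique[OF this transition_derivative[OF assms(1,1,2,2)]] show ?thesis by metis
qed

lemma coord_change_inverse:
  assumes "c \<in> A" "c' \<in> A" "y \<in> fst c" "y \<in> fst c'"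
  shows "coord_change c' c y (coord_change c c' y v) = v"
  using coord_change_compose[OF assms(1,2,1,3,4,3)] coord_change_refl[OF assms(1,3)] by simp

lemma local_function_with_differential:
  fixes x :: 'a
  assumes "linear \<xi>"
  defines "f \<equiv> (\<lambda>y. \<xi> (snd (chart_at A x) y - snd (chart_at A x) x))"
  shows "U \<subseteq> fst (chart_at A x) \<Longrightarrow> open U \<Longrightarrow> smooth_fun A U f" and "f x = 0" and "differential A f x = \<xi>"
proof -
  let ?c = "chart_at A x"
  note bl = linear_conv_bounded_linear[THEN iffD1, OF assms(1)]
  have f: "f y = \<xi> (snd ?c y) + - \<xi> (snd ?c x)" for y by (simp add: f_def linear_diff[OF assms(1)])
  show "f x = 0" by (simp add: f)
  show "smooth_fun A U f" if U: "U \<subseteq> fst ?c" "open U"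
    unfolding smooth_fun_def smooth_on_def fun_in_chart_def f
  proof (intro ballI allI)
    fix c m assume c: "c \<in> A"
    have "times_differentiable_on m (snd c ` (fst c \<inter> U)) (\<lambda>p. snd ?c (chart_inv c p))"
      by (rule times_diff_subset[OF transition_smooth[OF c chart_at(1)]]) (use U in auto)
    then show "times_differentiable_on m (snd c ` (fst c \<inter> U)) (\<lambda>p. \<xi> (snd ?c (chart_inv c p)) + - \<xi> (snd ?c x))"
      by (rule times_diff_add[OF open_chart_image[OF c U(2)] times_diff_linear[OF open_chart_image[OF c U(2)] bl] times_diff_const])
  qed
  have "((\<lambda>p. \<xi> p + - \<xi> (snd ?c x)) has_derivative \<xi>) (at (coord_at A x))"
    using has_derivative_add[OF bounded_linear_imp_has_derivative[OF bl] has_derivative_const[of "- \<xi> (snd ?c x)"]] by simp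
  then have "((\<lambda>p. f (chart_inv ?c p)) has_derivative \<xi>) (at (coord_at A x))"
    by (rule has_derivative_transform_within_open[OF _ chart_open(2)[OF chart_at(1)[of x]]])
       (use chart_at[of x] chart_chart_inv[OF chart_at(1)] in \<open>auto simp: coord_at_def f\<close>)
  then show "differential A f x = \<xi>"
    unfolding differential_def fun_in_chart_def using frechet_derivative_at by metis
qed

text \<open>Transport \<open>\<alpha>\<close> along a smooth adapted frame \<open>e\<close>, by the maps \<open>e x \<circ> (e y)\<^sup>-\<^sup>1\<close> from
  \<open>T\<^sub>yM\<close> to \<open>T\<^sub>xM\<close>. In a chart the inverse frame becomes the inverse of a smooth family of invertible
  linear maps.\<close>

lemma E_section_through:
  assumes Q: "Sp1GLnH_structure A Q" and \<alpha>: "\<alpha> \<in> E_bundle Q k r x"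
  shows "\<exists>U s. open U \<and> x \<in> U \<and> smooth_section A (E_bundle Q k r) U s \<and> s x = \<alpha>"
proof -
  obtain U e where U: "open U" "x \<in> U" and e: "smooth_frame A Q U e"
    using Q unfolding Sp1GLnH_structure_def by blast
  have eQ: "e y \<in> Q y" if "y \<in> U" for y using e that by (simp add: smooth_frame_def)
  have lin: "linear (e y)" and bij: "bij (e y)" if "y \<in> U" for y
    using adapted_frame[OF Q eQ[OF that]] by auto
  have alt: "alternating \<alpha>" using \<alpha> by (auto simp: E_bundle_def alt_forms_eq real_forms_def)
  define s where "s y vs = \<alpha> (map (e x \<circ> inv (e y)) vs)" for y vs
  have "e x \<circ> inv (e x) = id"
    using bij[OF U(2)] by (simp add: fun_eq_iff bij_is_surj surj_f_inv_f)
  then have "s x = \<alpha>" unfolding s_def[abs_def] by simp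
  moreover have "s y \<in> E_bundle Q k r y" if "y \<in> U" for y
    using E_bundle_pullback[OF Q eQ[OF U(2)] eQ[OF that] \<alpha>] by (simp add: s_def[abs_def])
  moreover have "smooth_form A U s"
    unfolding smooth_form_def smooth_on_def
  proof (intro ballI allI)
    fix c vs m assume c: "c \<in> A"
    define S where "S = snd c ` (fst c \<inter> U)"
    \<comment> \<open>The components of the frame in the chart \<open>c\<close>; the coordinate change to the preferred chart of
      each point, over which nothing is known, is absorbed into the smooth family \<open>M\<close>.\<close>
    define M where "M p u = field_in_chart A c (\<lambda>y. e y u) p" for p u
    have S: "open S" unfolding S_def by (rule open_chart_image[OF c U(1)])
    have M: "M p = coord_change (chart_at A (chart_inv c p)) c (chart_inv c p) \<circ> e (chart_inv c p)" for p
      by (simp add: M_def field_in_chart_def fun_eq_iff Let_def)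
    have pt: "chart_inv c p \<in> fst c" "chart_inv c p \<in> U" if "p \<in> S" for p
      using that chart_inv_chart[OF c] by (auto simp: S_def)
    have inv1: "coord_change (chart_at A y) c y (coord_change c (chart_at A y) y v) = v"
      and inv2: "coord_change c (chart_at A y) y (coord_change (chart_at A y) c y v) = v" if "y \<in> fst c" for y v
      using coord_change_inverse c chart_at that by auto
    have Minv: "inv (M p) = inv (e (chart_inv c p)) \<circ> coord_change c (chart_at A (chart_inv c p)) (chart_inv c p)"
      and Mbij: "bij (M p)" if "p \<in> S" for p
    proof -
      let ?N = "inv (e (chart_inv c p)) \<circ> coord_change c (chart_at A (chart_inv c p)) (chart_inv c p)"
      have 1: "M p (?N v) = v" and 2: "?N (M p v) = v" for v
        using bij[OF pt(2)[OF that]]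
        by (simp_all add: M inv1 inv2 pt(1)[OF that] bij_is_surj surj_f_inv_f bij_is_inj inv_f_f)
      show "inv (M p) = ?N" by (rule inv_equality) (fact 2 1)+
      have "?N \<circ> M p = id" by (rule ext) (simp only: comp_apply[where f = ?N] 2 id_apply)
      moreover have "M p \<circ> ?N = id" by (rule ext) (simp only: comp_apply[where f = "M p"] 1 id_apply)
      ultimately show "bij (M p)" by (rule o_bij)
    qed
    have Mlin: "linear (M p)" if "p \<in> S" for p
      unfolding M by (intro linear_compose lin pt that linear_coord_change chart_at c)
    have Mtd: "times_differentiable_on m S (\<lambda>p. M p u)" for m u
      using e c unfolding smooth_frame_def smooth_field_def smooth_on_def M_def S_def by blast
    have "times_differentiable_on m S (\<lambda>p. inv (M p) v)" for v
      by (rule times_diff_inverse_family[OF S Mlin Mbij Mtd])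
    then have "times_differentiable_on m S (\<lambda>p. e x (inv (M p) v))" for v
      by (rule times_diff_linear[OF S linear_conv_bounded_linear[THEN iffD1, OF lin[OF U(2)]]])
    then have "times_differentiable_on m S (\<lambda>p. \<alpha> ([] @ map (\<lambda>v. e x (inv (M p) v)) vs))"
      by (rule times_diff_multilinear[OF S alternatingD(1)[OF alt]])
    note td1 = this
    have form: "form_in_chart A c s p vs = \<alpha> ([] @ map (\<lambda>v. e x (inv (M p) v)) vs)" if "p \<in> S" for p
      by (simp add: form_in_chart_def s_def Minv[OF that] Let_def o_def)
    show "times_differentiable_on m (snd c ` (fst c \<inter> U)) (\<lambda>p. form_in_chart A c s p vs)"
      unfolding S_def[symmetric] by (rule times_diff_cong[OF S form, THEN iffD2, OF _ td1])
  qed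
  ultimately show ?thesis using U by (auto simp: smooth_section_def)
qed

lemma smooth_section_subset:
  "smooth_section A F U s \<Longrightarrow> V \<subseteq> U \<Longrightarrow> smooth_section A F V s"
  unfolding smooth_section_def smooth_form_def smooth_on_def
  by (meson Int_mono image_mono order_refl subset_iff times_diff_subset)

text \<open>The definite description in the symbol denotes \<open>\<beta>\<close> as soon as all admissible pairs yield \<open>\<beta>\<close> and an
  admissible pair exists; a suitable function always exists.\<close>

lemma principal_symbol_eqI:
  assumes "linear \<xi>" and sec: "\<exists>U s. open U \<and> x \<in> U \<and> smooth_section A F U s \<and> s x = \<alpha>"
    and val: "\<And>U f s. open U \<Longrightarrow> x \<in> U \<Longrightarrow> smooth_fun A U f \<Longrightarrow> f x = 0 \<Longrightarrow> differential A f x = \<xi> \<Longrightarrow>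
       smooth_section A F U s \<Longrightarrow> s x = \<alpha> \<Longrightarrow> \<Phi> (\<lambda>y vs. f y * s y vs) x = \<beta>"
  shows "principal_symbol A F \<Phi> x \<xi> \<alpha> = \<beta>"
  unfolding principal_symbol_def
proof (rule the_equality)
  show "\<forall>U f s. open U \<and> x \<in> U \<and> smooth_fun A U f \<and> f x = 0 \<and> differential A f x = \<xi> \<and>
     smooth_section A F U s \<and> s x = \<alpha> \<longrightarrow> \<Phi> (\<lambda>y vs. f y * s y vs) x = \<beta>" using val by blast
next
  fix \<beta>' assume *: "\<forall>U f s. open U \<and> x \<in> U \<and> smooth_fun A U f \<and> f x = 0 \<and> differential A f x = \<xi> \<and>
     smooth_section A F U s \<and> s x = \<alpha> \<longrightarrow> \<Phi> (\<lambda>y vs. f y * s y vs) x = \<beta>'"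
  obtain U s where U: "open U" "x \<in> U" "smooth_section A F U s" "s x = \<alpha>" using sec by blast
  define V where "V = U \<inter> fst (chart_at A x)"
  have V: "open V" "x \<in> V" "V \<subseteq> fst (chart_at A x)" "V \<subseteq> U"
    using U(1,2) chart_at[of x] chart_open(1)[OF chart_at(1)] by (auto simp: V_def open_Int)
  note f = local_function_with_differential[where x = x and \<xi> = \<xi>, OF assms(1)]
  have s: "smooth_section A F V s" by (rule smooth_section_subset[OF U(3) V(4)])
  define f where "f y = \<xi> (snd (chart_at A x) y - snd (chart_at A x) x)" for y
  have a: "smooth_fun A V f" "f x = 0" "differential A f x = \<xi>"
    unfolding f_def[abs_def] using f(1)[OF V(3,1)] f(2,3) by auto
  have "\<Phi> (\<lambda>y vs. f y * s y vs) x = \<beta>'"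
    using *[rule_format, of V f s] V(1,2) a s U(4) by simp
  moreover have "\<Phi> (\<lambda>y vs. f y * s y vs) x = \<beta>"
    by (rule val[OF V(1,2) a s U(4)])
  ultimately show "\<beta>' = \<beta>" by simp
qed

text \<open>The Leibniz rule, where the term with \<open>d s\<close> drops out because \<open>f\<close> vanishes at \<open>x\<close>.\<close>

lemma ext_deriv_product:
  assumes U: "open U" "x \<in> U" and f: "smooth_fun A U f" "f x = 0" "differential A f x = \<xi>"
    and s: "smooth_form A U s"
  shows "ext_deriv A (\<lambda>y vs. f y * s y vs) x = wedge_fun \<xi> (s x)"
proof
  fix vs
  let ?c = "chart_at A x"
  let ?p = "coord_at A x"
  have c: "?c \<in> A" "x \<in> fst ?c" by (rule chart_at)+
  have p: "?p \<in> snd ?c ` (fst ?c \<inter> U)" using U c by (simp add: coord_at_def)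
  have inv_p: "chart_inv ?c ?p = x" by (simp add: coord_at_def chart_inv_chart[OF c])
  have df: "(fun_in_chart ?c f has_derivative \<xi>) (at ?p)"
  proof -
    have "times_differentiable_on (Suc 0) (snd ?c ` (fst ?c \<inter> U)) (fun_in_chart ?c f)"
      using f(1) c by (simp add: smooth_fun_def smooth_on_def del: times_differentiable_on.simps)
    from times_diff_has_derivative[OF this p] show ?thesis using f(3) by (simp add: differential_def)
  qed
  have "frechet_derivative (\<lambda>p. form_in_chart A ?c (\<lambda>y vs. f y * s y vs) p us) (at ?p) v = \<xi> v * s x us" for us v
  proof -
    define g where "g p = form_in_chart A ?c s p us" for p
    have "times_differentiable_on (Suc 0) (snd ?c ` (fst ?c \<inter> U)) g"
      using s c(1) unfolding smooth_form_def smooth_on_def g_def[abs_def] by blast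
    then have dg: "(g has_derivative frechet_derivative g (at ?p)) (at ?p)" by (rule times_diff_has_derivative[OF _ p])
    have fg: "(\<lambda>p. form_in_chart A ?c (\<lambda>y vs. f y * s y vs) p us) = (\<lambda>p. fun_in_chart ?c f p * g p)"
      by (simp add: form_in_chart_def fun_in_chart_def g_def Let_def)
    have gp: "g ?p = s x us"
      by (simp add: g_def form_in_chart_def Let_def inv_p coord_change_refl[OF c] map_idI)
    have fp: "fun_in_chart ?c f ?p = 0" by (simp add: fun_in_chart_def inv_p f(2))
    have "((\<lambda>p. fun_in_chart ?c f p * g p) has_derivative (\<lambda>v. \<xi> v * s x us)) (at ?p)"
      using has_derivative_mult[OF df dg] by (simp add: fp gp)
    from frechet_derivative_at[OF this] show ?thesis unfolding fg by metis
  qed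
  then show "ext_deriv A (\<lambda>y vs. f y * s y vs) x vs = wedge_fun \<xi> (s x) vs"
    by (simp add: ext_deriv_def wedge_fun_def)
qed

lemma principal_symbol_D_op:
  assumes Q: "Sp1GLnH_structure A Q" and "linear \<xi>" and \<alpha>: "\<alpha> \<in> E_bundle Q m r x"
  shows "principal_symbol A (E_bundle Q m r) (D_op A Q m r) x \<xi> \<alpha>
     = E_proj Q (m + 1) (r + 1) x (wedge_fun \<xi> \<alpha>)"
  by (rule principal_symbol_eqI[OF assms(2) E_section_through[OF Q \<alpha>]])
     (simp add: D_op_def ext_deriv_product smooth_section_def)

lemma principal_symbol_zero_op:
  assumes "linear \<xi>" "\<exists>U s. open U \<and> x \<in> U \<and> smooth_section A F U s \<and> s x = \<alpha>"
  shows "principal_symbol A F (\<lambda>\<omega> x vs. 0) x \<xi> \<alpha> = (\<lambda>vs. 0)"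
  by (rule principal_symbol_eqI[OF assms]) simp

lemma zero_bundle_section:
  "\<exists>U s. open U \<and> x \<in> U \<and> smooth_section A (\<lambda>x. {\<lambda>vs. 0}) U s \<and> s x = (\<lambda>vs. 0)"
  by (rule exI[of _ UNIV], rule exI[of _ "\<lambda>y vs. 0"])
     (simp add: smooth_section_def smooth_form_def smooth_on_def form_in_chart_def times_diff_const)

end

section \<open>Ellipticity\<close>

text \<open>Up to conjugation \<open>v \<mapsto> (\<xi> v, \<xi> (I v), \<xi> (J v), \<xi> (K v))\<close> is a quaternion-linear map to the
  quaternions, so a value that is not zero can be normalised to 1.\<close>

lemma (in quaternionic_triple) dual_vector_exists:
  assumes "linear \<xi>" "\<xi> \<noteq> (\<lambda>v. 0 :: real)"
  shows "\<exists>u. \<xi> u = 1 \<and> \<xi> (I u) = 0 \<and> \<xi> (J u) = 0 \<and> \<xi> (K u) = 0"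
proof -
  obtain w where w: "\<xi> w \<noteq> 0" using assms(2) by blast
  define a b c d where "a = \<xi> w" "b = \<xi> (I w)" "c = \<xi> (J w)" "d = \<xi> (K w)"
  define s where "s = a * a + b * b + c * c + d * d"
  have "0 < a * a" using w by (auto simp: a_b_c_d_def(1) zero_less_mult_iff)
  then have s: "s > 0" by (simp add: s_def add_pos_nonneg)
  define u where "u = (1 / s) *\<^sub>R (a *\<^sub>R w + b *\<^sub>R I w + c *\<^sub>R J w + d *\<^sub>R K w)"
  note lin = linear_add[OF assms(1)] linear_diff[OF assms(1)] linear_scale[OF assms(1)] linear_neg[OF assms(1)]
    linear_add[OF linear_I] linear_scale[OF linear_I] linear_add[OF linear_J] linear_scale[OF linear_J]
    linear_add[OF linear_K] linear_scale[OF linear_K]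
  have "\<xi> u = (1 / s) * s" by (simp add: u_def lin s_def flip: a_b_c_d_def)
  moreover have "\<xi> (I u) = 0" "\<xi> (J u) = 0" "\<xi> (K u) = 0"
    by (simp_all add: u_def lin triple algebra_simps flip: a_b_c_d_def)
  ultimately show ?thesis using s by (intro exI[of _ u]) simp
qed

definition unit_form :: "'v::real_vector cform" where
  "unit_form = cform_of (\<lambda>vs. if vs = [] then 1 else 0)"

lemma ev_unit_form: "ev unit_form vs = (if vs = [] then 1 else 0)"
  unfolding unit_form_def by (subst ev_cform_of) (auto simp: alternating_def linear_iff)

definition frame_covector :: "('n::finite qvec \<Rightarrow> 'n qvec) \<Rightarrow> 'n \<Rightarrow> 4 \<Rightarrow> 'n qvec \<Rightarrow> real" where
  "frame_covector e l p v = inv e v $ l $ p"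

definition frame_vector :: "('n::finite qvec \<Rightarrow> 'n qvec) \<Rightarrow> 'n \<Rightarrow> 4 \<Rightarrow> 'n qvec" where
  "frame_vector e l p = e (axis l (axis p 1))"

locale quaternionic_frame =
  fixes e :: "'n::finite qvec \<Rightarrow> 'n qvec"
  assumes linear_e: "linear e" and bij_e: "bij e"
begin

abbreviation "I \<equiv> frame_acs e qi"
abbreviation "J \<equiv> frame_acs e qj"
abbreviation "K \<equiv> frame_acs e qk"

sublocale quaternionic_triple I J K by (rule frame_triple[OF linear_e bij_e])

lemma linear_frame_covector: "linear (frame_covector e l p)"
  using linear_inv_bij[OF linear_e bij_e]
  by (auto intro!: linearI simp: frame_covector_def linear_add linear_scale)

lemma frame_dual: "frame_covector e l p (frame_vector e l' p') = (if l = l' \<and> p = p' then 1 else 0)"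
  using bij_e by (simp add: frame_covector_def frame_vector_def bij_is_inj inv_f_f axis_def)

lemma frame_covector_acs:
  "frame_covector e l 1 (I v) = - frame_covector e l 2 v" "frame_covector e l 2 (I v) = frame_covector e l 1 v"
  "frame_covector e l 3 (I v) = - frame_covector e l 4 v" "frame_covector e l 4 (I v) = frame_covector e l 3 v"
  "frame_covector e l 1 (J v) = - frame_covector e l 3 v" "frame_covector e l 2 (J v) = frame_covector e l 4 v"
  "frame_covector e l 3 (J v) = frame_covector e l 1 v" "frame_covector e l 4 (J v) = - frame_covector e l 2 v"
  "frame_covector e l 1 (K v) = - frame_covector e l 4 v" "frame_covector e l 2 (K v) = - frame_covector e l 3 v"
  "frame_covector e l 3 (K v) = frame_covector e l 2 v" "frame_covector e l 4 (K v) = frame_covector e l 1 v"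
  using bij_e
  by (simp_all add: frame_covector_def frame_acs_def bij_is_inj inv_f_f lmul_def qmult_def qi_def qj_def qk_def)

definition w :: "'n \<Rightarrow> 4 \<Rightarrow> 'n qvec cform \<Rightarrow> 'n qvec cform" where
  "w l p = wedge1 (\<lambda>v. of_real (frame_covector e l p v))"

lemma linear_fc: "linear (\<lambda>v. complex_of_real (frame_covector e l p v))"
  by (rule linear_of_real_comp[OF linear_frame_covector])

lemma w_neg: "wedge1 (\<lambda>v. - complex_of_real (frame_covector e l p v)) a = - w l p a"
  using wedge1_cmult[OF linear_fc, of "-1"] by (simp add: w_def cscale_simps)

lemmas w_simps = wedge1_simps[OF linear_fc, folded w_def]

lemma D_w:
  "DI (w l 1 a) = w l 1 (DI a) + w l 2 a" "DI (w l 2 a) = w l 2 (DI a) - w l 1 a"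
  "DI (w l 3 a) = w l 3 (DI a) + w l 4 a" "DI (w l 4 a) = w l 4 (DI a) - w l 3 a"
  "DJ (w l 1 a) = w l 1 (DJ a) + w l 3 a" "DJ (w l 2 a) = w l 2 (DJ a) - w l 4 a"
  "DJ (w l 3 a) = w l 3 (DJ a) - w l 1 a" "DJ (w l 4 a) = w l 4 (DJ a) + w l 2 a"
  "DK (w l 1 a) = w l 1 (DK a) + w l 4 a" "DK (w l 2 a) = w l 2 (DK a) + w l 3 a"
  "DK (w l 3 a) = w l 3 (DK a) - w l 2 a" "DK (w l 4 a) = w l 4 (DK a) - w l 1 a"
  by (simp_all add: w_def derivation_wedge1 linear_fc linear_I linear_J linear_K frame_covector_acs w_neg[unfolded w_def])

lemma w_anticommute:
  "w l 2 (w l 1 a) = - w l 1 (w l 2 a)" "w l 3 (w l 1 a) = - w l 1 (w l 3 a)" "w l 4 (w l 1 a) = - w l 1 (w l 4 a)"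
  "w l 3 (w l 2 a) = - w l 2 (w l 3 a)" "w l 4 (w l 2 a) = - w l 2 (w l 4 a)" "w l 4 (w l 3 a) = - w l 3 (w l 4 a)"
  "w l p (w l p a) = 0"
  unfolding w_def by (rule wedge1_anticommute wedge1_self linear_fc)+

lemma contract_w: "contract (frame_vector e l p) (w l' p' a) =
    (if l = l' \<and> p = p' then a else 0) - w l' p' (contract (frame_vector e l p) a)"
  by (simp add: w_def contract_wedge1[OF linear_fc] frame_dual cscale_simps)

lemma Deg_w: "a \<in> Deg m \<Longrightarrow> w l p a \<in> Deg (Suc m)"
  unfolding w_def by (rule Deg_wedge1[OF linear_fc])

definition invariant :: "'n qvec cform set" where
  "invariant = {a. DI a = 0 \<and> DJ a = 0 \<and> DK a = 0}"

text \<open>Wedge with the volume form of the \<open>l\<close>-th quaternionic line.\<close>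

definition volume_wedge :: "'n \<Rightarrow> 'n qvec cform \<Rightarrow> 'n qvec cform" where
  "volume_wedge l a = w l 1 (w l 2 (w l 3 (w l 4 a)))"

text \<open>Wedge with a 2-form of the \<open>l\<close>-th quaternionic line that is invariant under \<open>I\<close>, \<open>J\<close>, \<open>K\<close>; the sign is forced
  by invariance.\<close>

definition asd_wedge :: "'n \<Rightarrow> 'n qvec cform \<Rightarrow> 'n qvec cform" where
  "asd_wedge l a = w l 1 (w l 2 a) - w l 3 (w l 4 a)"

lemma invariant_volume: "a \<in> invariant \<Longrightarrow> volume_wedge l a \<in> invariant"
  by (simp add: invariant_def volume_wedge_def D_w w_anticommute w_simps)

lemma invariant_asd: "a \<in> invariant \<Longrightarrow> asd_wedge l a \<in> invariant"
  by (simp add: invariant_def asd_wedge_def D_w w_anticommute w_simps D_simps)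

lemma contract_volume:
  "(\<And>p. contract (frame_vector e l p) a = 0) \<Longrightarrow>
   contract (frame_vector e l 4) (contract (frame_vector e l 3) (contract (frame_vector e l 2) (contract (frame_vector e l 1) (volume_wedge l a)))) = a"
  by (simp add: volume_wedge_def contract_w w_simps contract_simps)

lemma contract_asd:
  "(\<And>p. contract (frame_vector e l p) a = 0) \<Longrightarrow>
   contract (frame_vector e l 2) (contract (frame_vector e l 1) (asd_wedge l a)) = a"
  by (simp add: asd_wedge_def contract_w w_simps contract_simps)

lemma contract_other:
  "l \<noteq> l' \<Longrightarrow> contract (frame_vector e l p) a = 0 \<Longrightarrow> contract (frame_vector e l p) (volume_wedge l' a) = 0"
  "l \<noteq> l' \<Longrightarrow> contract (frame_vector e l p) a = 0 \<Longrightarrow> contract (frame_vector e l p) (asd_wedge l' a) = 0"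
  by (simp_all add: volume_wedge_def asd_wedge_def contract_w w_simps contract_simps)

lemma Deg_volume: "a \<in> Deg (2 * j) \<Longrightarrow> volume_wedge l a \<in> Deg (2 * Suc (Suc j))"
  and Deg_asd: "a \<in> Deg (2 * j) \<Longrightarrow> asd_wedge l a \<in> Deg (2 * Suc j)"
  using Deg_w[OF Deg_w[OF Deg_w[OF Deg_w]], of a "2 * j" l 1 l 2 l 3 l 4] Deg_w[OF Deg_w, of a "2 * j" l 1 l 2]
    Deg_w[OF Deg_w, of a "2 * j" l 3 l 4]
  by (auto simp: volume_wedge_def asd_wedge_def intro: subspace_diff[OF subspace_Deg])

text \<open>Multiply volume forms of quaternionic lines and, if \<open>j\<close> is odd, one invariant 2-form of a further line.
  Contraction with the vectors of the lines already used recovers the factors, so the product is not zero.\<close>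

lemma invariant_form_exists:
  "finite L \<Longrightarrow> j \<le> 2 * card L \<Longrightarrow>
   \<exists>a\<in>Deg (2 * j) \<inter> invariant. a \<noteq> 0 \<and> (\<forall>l p. l \<notin> L \<longrightarrow> contract (frame_vector e l p) a = 0)"
proof (induction L arbitrary: j rule: finite_induct)
  case empty
  have D: "unit_form \<in> Deg 0" by (simp add: Deg_def ev_unit_form)
  have "ev (unit_form :: 'n qvec cform) [] \<noteq> ev 0 []" by (simp add: ev_unit_form)
  then have "unit_form \<noteq> (0 :: 'n qvec cform)" by metis
  then show ?case using D empty Deg_0_derivation[OF _ D] Deg_0_contract[OF D] linear_I linear_J linear_K
    by (intro bexI[of _ unit_form]) (auto simp: invariant_def)
next
  case (insert l L)
  consider "j \<le> 2 * card L" | j' where "j = Suc j'" "j' \<le> 2 * card L" | j' where "j = Suc (Suc j')" "j' \<le> 2 * card L"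
    using insert by (cases j; cases "j - 1") (fastforce simp: le_Suc_eq)+
  then show ?case
  proof cases
    case 1
    then show ?thesis using insert.IH[of j] by blast
  next
    case (2 j')
    then obtain a where a: "a \<in> Deg (2 * j')" "a \<in> invariant" "a \<noteq> 0"
      "\<And>l p. l \<notin> L \<Longrightarrow> contract (frame_vector e l p) a = 0" using insert.IH[of j'] by blast
    have "asd_wedge l a \<noteq> 0" using contract_asd[of l a] a(3,4) insert.hyps(2) by (auto simp: contract_simps)
    then show ?thesis using a 2 Deg_asd[of a j' l] invariant_asd contract_other(2)
      by (intro bexI[of _ "asd_wedge l a"]) auto
  next
    case (3 j')
    then obtain a where a: "a \<in> Deg (2 * j')" "a \<in> invariant" "a \<noteq> 0"
      "\<And>l p. l \<notin> L \<Longrightarrow> contract (frame_vector e l p) a = 0" using insert.IH[of j'] by blast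
    have "volume_wedge l a \<noteq> 0" using contract_volume[of l a] a(3,4) insert.hyps(2) by (auto simp: contract_simps)
    then show ?thesis using a 3 Deg_volume[of a j' l] invariant_volume contract_other(1)
      by (intro bexI[of _ "volume_wedge l a"]) auto
  qed
qed

text \<open>The line \<open>l\<close> contributes its full volume form, which is why wedging with its first covector gives 0.\<close>

lemma real_invariant_form_exists:
  assumes "2 \<le> j" "j \<le> 2 * CARD('n)"
  shows "\<exists>b. b \<in> real_forms (2 * j) \<and> cform_of b \<in> invariant \<and> cform_of b \<noteq> 0 \<and> w l 1 (cform_of b) = 0"
proof -
  have "card (UNIV - {l}) = CARD('n) - 1" by (simp add: card_Diff_singleton)
  then have "j - 2 \<le> 2 * card (UNIV - {l})" using assms by simp
  from invariant_form_exists[OF finite this] obtain a where a: "a \<in> Deg (2 * (j - 2))" "a \<in> invariant" "a \<noteq> 0"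
    "\<And>p. contract (frame_vector e l p) a = 0" by blast
  define B where "B = volume_wedge l a"
  have B: "B \<in> Deg (2 * j)" "B \<in> invariant" "B \<noteq> 0" "w l 1 B = 0"
  proof -
    have "2 * Suc (Suc (j - 2)) = 2 * j" using assms(1) by simp
    then show "B \<in> Deg (2 * j)" using Deg_volume[OF a(1), of l] unfolding B_def by metis
    show "B \<in> invariant" unfolding B_def by (rule invariant_volume[OF a(2)])
    show "B \<noteq> 0" using contract_volume[of l a] a(3,4) by (auto simp: B_def contract_simps)
    show "w l 1 B = 0" by (simp add: B_def volume_wedge_def w_anticommute)
  qed
  \<comment> \<open>A nonzero complex form has a nonzero real or imaginary part; both are real parts of multiples.\<close>
  have "\<exists>c. real_part (cscale c B) \<noteq> 0"
  proof (rule ccontr)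
    assume "\<not> ?thesis"
    then have "Re (c * ev B vs) = 0" for c vs
      using ev_real_part[of "cscale c B" vs for c] by (metis ev_simps(1,6) of_real_eq_0_iff)
    from this[of 1] this[of "- \<i>"] have "ev B vs = 0" for vs by (simp add: complex_eq_iff)
    then show False using B(3) by (metis cform_eqI ev_simps(1))
  qed
  then obtain c where c: "real_part (cscale c B) \<noteq> 0" ..
  have "w l 1 (real_part (cscale c B)) = real_part (cscale c (w l 1 B))"
    unfolding w_def by (simp only: real_part_wedge[OF linear_frame_covector, symmetric] wedge1_simps(6)[OF linear_fc])
  moreover have "real_part (cscale c B) \<in> invariant"
    using B(2)
    by (simp add: invariant_def D_simps real_part_simps cscale_simps
        real_part_derivation[OF linear_I, symmetric] real_part_derivation[OF linear_J, symmetric]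
        real_part_derivation[OF linear_K, symmetric])
  ultimately show ?thesis
    using c re_real_forms[OF Deg_cscale[OF B(1)]] B(4)
    by (intro exI[of _ "re_form (cscale c B)"]) (simp add: real_part_def[symmetric] cscale_simps real_part_simps)
qed

lemma invariant_isotypic: "a \<in> invariant \<Longrightarrow> a \<in> isotypic 0"
  by (simp add: invariant_def isotypic_def Cas_eq D_simps)

text \<open>Contraction maps vectors, which form copies of the two-dimensional representation, equivariantly to forms.\<close>

lemma contract_invariant_isotypic:
  assumes "a \<in> invariant"
  shows "contract u a \<in> isotypic 1"
proof -
  have "DI (contract v a) = contract (I v) a" "DJ (contract v a) = contract (J v) a" "DK (contract v a) = contract (K v) a" for v
    using contract_D[of v a] assms by (simp_all add: invariant_def contract_simps)
  then have "Cas (contract u a) = - contract u a - contract u a - contract u a"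
    by (simp add: Cas_eq triple contract_vector)
  also have "\<dots> = - (1 * (1 + 2)) *\<^sub>R contract u a"
    by (rule cform_eqI) (simp add: scaleR_conv_of_real)
  finally show ?thesis by (simp only: isotypic_def mem_Collect_eq)
qed

end

text \<open>The principal symbol of the operator from \<open>E\<^bsub>m,r\<^esub>\<close> to \<open>E\<^bsub>m+1,r+1\<^esub>\<close>.\<close>

definition symbol_map :: "('a, 'n::finite) frames \<Rightarrow> 'a \<Rightarrow> ('n qvec \<Rightarrow> real) \<Rightarrow> nat \<Rightarrow> nat \<Rightarrow> 'n form \<Rightarrow> 'n form" where
  "symbol_map Q x \<xi> m r \<alpha> = E_proj Q (m + 1) (r + 1) x (wedge_fun \<xi> \<alpha>)"

locale frame_covector_at = quaternionic_frame e + quaternionic_covector "frame_acs e qi" "frame_acs e qj" "frame_acs e qk" \<xi> u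
  for e :: "'n::finite qvec \<Rightarrow> 'n qvec" and \<xi> u +
  fixes A :: "('a::topological_space, 'n) chart set" and Q :: "('a, 'n) frames" and x :: 'a
  assumes Q: "Sp1GLnH_structure A Q" and eQ: "e \<in> Q x"
begin

lemma E_eq: "E_bundle Q m r x = E_fiber m r" by (rule E_bundle_eq[OF Q eQ])

lemma symbol_map:
  assumes \<alpha>: "\<alpha> \<in> E_bundle Q m r x" and m: "m = r + 2 * k"
  shows "symbol_map Q x \<xi> m r \<alpha> \<in> E_bundle Q (Suc m) (Suc r) x" "real_symbol r \<alpha> (symbol_map Q x \<xi> m r \<alpha>)"
proof -
  obtain \<beta> where \<beta>: "\<beta> \<in> E_fiber (Suc m) (Suc r)" "real_symbol r \<alpha> \<beta>"
    using real_symbol_exists[of \<alpha> m r k] \<alpha> m unfolding E_eq by blast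
  obtain \<gamma> where \<gamma>: "\<And>s. \<gamma> s \<in> E_fiber (Suc m) s" "\<And>vs. wedge_fun \<xi> \<alpha> vs = (\<Sum>s\<le>Suc m. \<gamma> s vs)" "\<beta> = \<gamma> (Suc r)"
    using real_symbol_decomposition[OF \<alpha>[unfolded E_eq] \<beta>] m by auto
  have "symbol_map Q x \<xi> m r \<alpha> = \<beta>"
    unfolding symbol_map_def E_proj_def E_eq
  proof (rule the_equality)
    show "\<exists>\<gamma>. (\<forall>s. \<gamma> s \<in> E_fiber (m + 1) s) \<and> (\<forall>vs. wedge_fun \<xi> \<alpha> vs = (\<Sum>s\<le>m + 1. \<gamma> s vs)) \<and> \<beta> = \<gamma> (r + 1)"
      using \<gamma> by (intro exI[of _ \<gamma>]) simp
    fix \<beta>' assume "\<exists>\<gamma>. (\<forall>s. \<gamma> s \<in> E_fiber (m + 1) s) \<and> (\<forall>vs. wedge_fun \<xi> \<alpha> vs = (\<Sum>s\<le>m + 1. \<gamma> s vs)) \<and> \<beta>' = \<gamma> (r + 1)"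
    then obtain \<delta> where \<delta>: "\<And>s. \<delta> s \<in> E_fiber (Suc m) s" "\<And>vs. wedge_fun \<xi> \<alpha> vs = (\<Sum>s\<le>Suc m. \<delta> s vs)" "\<beta>' = \<delta> (Suc r)"
      by auto
    have "\<delta> (Suc r) = \<gamma> (Suc r)"
      by (rule E_fiber_decomposition_unique[OF \<delta>(1) \<gamma>(1)]) (use \<delta>(2) \<gamma>(2) m in auto)
    then show "\<beta>' = \<beta>" using \<delta>(3) \<gamma>(3) by simp
  qed
  then show "symbol_map Q x \<xi> m r \<alpha> \<in> E_bundle Q (Suc m) (Suc r) x" "real_symbol r \<alpha> (symbol_map Q x \<xi> m r \<alpha>)"
    using \<beta> by (auto simp: E_eq)
qed

lemma symbol_map_eqI:
  assumes \<alpha>: "\<alpha> \<in> E_bundle Q m r x" and m: "m = r + 2 * k" and "real_symbol r \<alpha> \<beta>" "alternating \<beta>"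
  shows "symbol_map Q x \<xi> m r \<alpha> = \<beta>"
  using real_symbol_unique[OF symbol_map(2)[OF \<alpha> m] assms(3) _ assms(4)] symbol_map(1)[OF \<alpha> m]
    E_fiber_alternating unfolding E_eq by blast

lemma symbol_map_squared:
  assumes "\<alpha> \<in> E_bundle Q m r x" "m = r + 2 * k"
  shows "symbol_map Q x \<xi> (Suc m) (Suc r) (symbol_map Q x \<xi> m r \<alpha>) = (\<lambda>vs. 0)"
proof -
  note 1 = symbol_map[OF assms]
  have "Suc m = Suc r + 2 * k" using assms(2) by simp
  note 2 = symbol_map[OF 1(1) this]
  show ?thesis
    using real_symbol_symbol[OF assms(1)[unfolded E_eq] assms(2) 1(2) 2(2)] 2(1) E_fiber_alternating unfolding E_eq by blast
qed

lemma symbol_map_exact: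
  assumes \<alpha>: "\<alpha> \<in> E_bundle Q (Suc m) (Suc r) x" and m: "m = r + 2 * k"
    and closed: "symbol_map Q x \<xi> (Suc m) (Suc r) \<alpha> = (\<lambda>vs. 0) \<or> m + r + 4 > 4 * CARD('n)"
    and "r \<ge> 1 \<or> k = 0"
  shows "\<alpha> \<in> symbol_map Q x \<xi> m r ` E_bundle Q m r x"
proof -
  have "Suc m = Suc r + 2 * k" using m by simp
  from symbol_map(2)[OF \<alpha> this] closed
  have "real_symbol (Suc r) \<alpha> (\<lambda>vs. 0) \<or> m + r + 4 > DIM('n qvec)" by auto
  from real_symbol_exact[OF \<alpha>[unfolded E_eq] m this assms(4)]
  obtain \<beta> where \<beta>: "\<beta> \<in> E_fiber m r" "real_symbol r \<beta> \<alpha>" by blast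
  then have "symbol_map Q x \<xi> m r \<beta> = \<alpha>"
    using symbol_map_eqI[of \<beta> m r k \<alpha>] m \<alpha> E_fiber_alternating unfolding E_eq by blast
  then show ?thesis using \<beta>(1) unfolding E_eq by blast
qed

lemma symbol_map_injective:
  assumes "\<alpha> \<in> E_bundle Q (2 * k) 0 x" "k \<le> 1" "symbol_map Q x \<xi> (2 * k) 0 \<alpha> = (\<lambda>vs. 0)"
  shows "\<alpha> = (\<lambda>vs. 0)"
proof -
  have "real_symbol 0 \<alpha> (\<lambda>vs. 0)" using symbol_map(2)[OF assms(1), of k] assms(3) by simp
  then show ?thesis
    using real_symbol_injective_low_degree[of \<alpha> "2 * k" k] assms(1,2) unfolding E_eq by blast
qed

lemma symbol_map_not_injective:
  assumes b: "b \<in> real_forms (2 * k)" "cform_of b \<in> invariant" "wedge (cform_of b) = 0"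
  shows "b \<in> E_bundle Q (2 * k) 0 x" "symbol_map Q x \<xi> (2 * k) 0 b = (\<lambda>vs. 0)"
proof -
  show "b \<in> E_bundle Q (2 * k) 0 x" using b invariant_isotypic by (simp add: E_eq E_fiber_iff)
  moreover have "real_symbol 0 b (\<lambda>vs. 0)"
    using b(3) by (simp add: real_symbol_def symbol_rel_def cform_of_zero subspace_0[OF subspace_isotypic])
  ultimately show "symbol_map Q x \<xi> (2 * k) 0 b = (\<lambda>vs. 0)"
    by (intro symbol_map_eqI[of _ _ _ k]) (auto simp: alternating_zero)
qed

text \<open>\<open>f\<close> is the contraction of an invariant form \<open>b\<close> with \<open>u\<close>, and \<open>\<xi> \<and> f = b\<close>. A form
  \<open>\<xi> \<and> g\<close> would be killed by \<open>\<xi>\<close>, but \<open>f\<close> is not.\<close>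

lemma symbol_map_not_exact:
  assumes b: "b \<in> real_forms (2 * Suc k)" "cform_of b \<in> invariant" "wedge (cform_of b) = 0" "cform_of b \<noteq> 0"
  defines "f \<equiv> (\<lambda>vs. b (u # vs))"
  shows "f \<in> E_bundle Q (2 * k + 1) 1 x" "symbol_map Q x \<xi> (2 * k + 1) 1 f = (\<lambda>vs. 0)"
    "f \<notin> symbol_map Q x \<xi> (2 * k) 0 ` E_bundle Q (2 * k) 0 x"
proof -
  have alt: "alternating f" unfolding f_def by (rule alternating_Cons[OF real_formsD[OF b(1)]])
  have cf: "cform_of f = contract u (cform_of b)"
    by (rule cform_eqI) (simp add: ev_cform_of alt real_formsD[OF b(1)], simp add: f_def)
  have wf: "wedge (cform_of f) = cform_of b"
    using b(3) contract_wedge1[OF linear_of_real_comp[OF linear_\<xi>], of u "cform_of b"]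
    by (simp add: cf wedge_eq dual cscale_simps contract_simps)
  have "f \<in> real_forms (2 * k + 1)"
    using b(1) alt by (auto simp: real_forms_def f_def)
  then show E: "f \<in> E_bundle Q (2 * k + 1) 1 x"
    using contract_invariant_isotypic[OF b(2)] by (simp add: E_eq E_fiber_iff cf)
  have "real_symbol 1 f (\<lambda>vs. 0)"
    using invariant_isotypic[OF b(2)]
    by (simp add: real_symbol_def symbol_rel_def cform_of_zero subspace_0[OF subspace_isotypic] wf)
  then show "symbol_map Q x \<xi> (2 * k + 1) 1 f = (\<lambda>vs. 0)"
    using E by (intro symbol_map_eqI[of _ _ _ k]) (auto simp: alternating_zero)
  show "f \<notin> symbol_map Q x \<xi> (2 * k) 0 ` E_bundle Q (2 * k) 0 x"
  proof
    assume "f \<in> symbol_map Q x \<xi> (2 * k) 0 ` E_bundle Q (2 * k) 0 x"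
    then obtain g where g: "g \<in> E_bundle Q (2 * k) 0 x" "f = symbol_map Q x \<xi> (2 * k) 0 g" by blast
    have "wedge (cform_of g) = cform_of f"
      using symbol_map(2)[OF g(1), of k] g(2) by (simp add: real_symbol_def symbol_rel_def)
    then have "cform_of b = wedge (wedge (cform_of g))" using wf by simp
    also have "\<dots> = 0" unfolding wedge_eq by (rule wedge1_self[OF linear_of_real_comp[OF linear_\<xi>]])
    finally show False using b(4) by simp
  qed
qed

end

lemma structure_frame:
  assumes "Sp1GLnH_structure A Q"
  shows "\<exists>e. e \<in> Q x"
proof -
  obtain e where "Q x = {e \<circ> g | g. g \<in> Sp1GLnH}"
    using assms unfolding Sp1GLnH_structure_def by blast
  then have "e \<circ> id \<in> Q x" using id_Sp1GLnH by blast
  then show ?thesis by blast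
qed

lemma frame_covector_at_exists:
  assumes "Sp1GLnH_structure A Q" "linear \<xi>" "\<xi> \<noteq> (\<lambda>v. 0)"
  shows "\<exists>e u. frame_covector_at e \<xi> u A Q x"
proof -
  obtain e where e: "e \<in> Q x" using structure_frame[OF assms(1)] by blast
  interpret quaternionic_frame e
    by (rule quaternionic_frame.intro[OF adapted_frame[OF assms(1) e]])
  obtain u where "\<xi> u = 1 \<and> \<xi> (I u) = 0 \<and> \<xi> (J u) = 0 \<and> \<xi> (K u) = 0"
    using dual_vector_exists[OF assms(2,3)] by blast
  then have "frame_covector_at e \<xi> u A Q x"
    using assms(1,2) e by unfold_locales (auto simp: linear_add linear_scale)
  then show ?thesis by blast
qed

lemma frame_covector_at_special:
  assumes "Sp1GLnH_structure A Q" "e \<in> Q x"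
  shows "frame_covector_at e (frame_covector e l 1) (frame_vector e l 1) A Q x"
proof -
  interpret quaternionic_frame e
    by (rule quaternionic_frame.intro[OF adapted_frame[OF assms]])
  show ?thesis
    using assms linear_frame_covector[of l 1]
    by unfold_locales (auto simp: linear_add linear_scale frame_covector_acs frame_dual)
qed

lemma special_covector_nonzero:
  assumes "Sp1GLnH_structure A Q" "e \<in> Q x"
  shows "linear (frame_covector e l 1)" "frame_covector e l 1 \<noteq> (\<lambda>v. 0)"
proof -
  interpret frame_covector_at e "frame_covector e l 1" "frame_vector e l 1" A Q x
    by (rule frame_covector_at_special[OF assms])
  show "linear (frame_covector e l 1)" by (rule linear_\<xi>)
  show "frame_covector e l 1 \<noteq> (\<lambda>v. 0)" using dual(1) by (metis zero_neq_one)
qed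

lemma kernel_at_0:
  fixes Q :: "('a::topological_space, 'n::finite) frames"
  assumes "Sp1GLnH_structure A Q" "e \<in> Q x" "2 \<le> k" "k \<le> 2 * CARD('n)"
  shows "\<exists>b\<in>E_bundle Q (2 * k) 0 x. b \<noteq> (\<lambda>vs. 0) \<and> symbol_map Q x (frame_covector e l 1) (2 * k) 0 b = (\<lambda>vs. 0)"
proof -
  interpret frame_covector_at e "frame_covector e l 1" "frame_vector e l 1" A Q x
    by (rule frame_covector_at_special[OF assms(1,2)])
  obtain b where b: "b \<in> real_forms (2 * k)" "cform_of b \<in> invariant" "cform_of b \<noteq> 0" "w l 1 (cform_of b) = 0"
    using real_invariant_form_exists[OF assms(3,4)] by blast
  have "wedge (cform_of b) = 0" using b(4) by (simp add: wedge_eq w_def)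
  from symbol_map_not_injective[OF b(1,2) this] b(3) cform_of_zero show ?thesis by metis
qed

lemma homology_at_1:
  fixes Q :: "('a::topological_space, 'n::finite) frames"
  assumes "Sp1GLnH_structure A Q" "e \<in> Q x" "1 \<le> k" "k < 2 * CARD('n)"
  shows "\<exists>f\<in>E_bundle Q (2 * k + 1) 1 x. symbol_map Q x (frame_covector e l 1) (2 * k + 1) 1 f = (\<lambda>vs. 0) \<and>
    f \<notin> symbol_map Q x (frame_covector e l 1) (2 * k) 0 ` E_bundle Q (2 * k) 0 x"
proof -
  interpret frame_covector_at e "frame_covector e l 1" "frame_vector e l 1" A Q x
    by (rule frame_covector_at_special[OF assms(1,2)])
  have "2 \<le> Suc k" "Suc k \<le> 2 * CARD('n)" using assms(3,4) by auto
  then obtain b where b: "b \<in> real_forms (2 * Suc k)" "cform_of b \<in> invariant" "cform_of b \<noteq> 0" "w l 1 (cform_of b) = 0"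
    using real_invariant_form_exists by blast
  have "wedge (cform_of b) = 0" using b(4) by (simp add: wedge_eq w_def)
  from symbol_map_not_exact[OF b(1,2) this b(3)] show ?thesis by blast
qed

definition symbol_image :: "('a, 'n::finite) frames \<Rightarrow> nat \<Rightarrow> 'a \<Rightarrow> ('n qvec \<Rightarrow> real) \<Rightarrow> nat \<Rightarrow> 'n form set" where
  "symbol_image Q k x \<xi> j = (if j = 0 then {\<lambda>vs. 0}
     else symbol_map Q x \<xi> (2 * k + (j - 1)) (j - 1) ` E_bundle Q (2 * k + (j - 1)) (j - 1) x)"

text \<open>At the last position \<open>2n - k\<close> the outgoing operator is zero and the kernel is the whole fibre.\<close>

definition symbol_kernel :: "('a, 'n::finite) frames \<Rightarrow> nat \<Rightarrow> 'a \<Rightarrow> ('n qvec \<Rightarrow> real) \<Rightarrow> nat \<Rightarrow> 'n form set" where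
  "symbol_kernel Q k x \<xi> j = {\<alpha> \<in> E_bundle Q (2 * k + j) j x.
     j < 2 * CARD('n) - k \<longrightarrow> symbol_map Q x \<xi> (2 * k + j) j \<alpha> = (\<lambda>vs. 0)}"

lemma (in manifold_atlas) elliptic_at_iff:
  assumes Q: "Sp1GLnH_structure A Q" and k: "k < 2 * CARD('n)" and j: "j \<le> 2 * CARD('n) - k"
  shows "elliptic_at A (quat_bundle Q k) (quat_op A Q k) (int j) \<longleftrightarrow>
    (\<forall>x \<xi>. linear \<xi> \<and> \<xi> \<noteq> (\<lambda>v. 0) \<longrightarrow> symbol_image Q k x \<xi> j = symbol_kernel Q k x \<xi> j)"
proof -
  have bundle_at: "quat_bundle Q k (int i) = E_bundle Q (2 * k + i) i" if "i \<le> 2 * CARD('n) - k" for i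
    using that k by (auto simp: quat_bundle_def)
  have oper: "quat_op A Q k (int (Suc i)) = (if i < 2 * CARD('n) - k then D_op A Q (2 * k + i) i else (\<lambda>\<omega> x vs. 0))" for i
    using k by (auto simp: quat_op_def)
  have image: "principal_symbol A (quat_bundle Q k (int j - 1)) (quat_op A Q k (int j)) x \<xi> ` quat_bundle Q k (int j - 1) x
      = symbol_image Q k x \<xi> j" if "linear \<xi>" for x \<xi>
  proof (cases j)
    case 0
    have "quat_bundle Q k (- 1) = (\<lambda>x. {\<lambda>vs. 0})" "quat_op A Q k 0 = (\<lambda>\<omega> x vs. 0)"
      by (simp_all add: quat_bundle_def quat_op_def)
    then show ?thesis
      using principal_symbol_zero_op[OF that zero_bundle_section] by (simp add: 0 symbol_image_def)
  next
    case (Suc i)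
    have "int j - 1 = int i" "i < 2 * CARD('n) - k" "i \<le> 2 * CARD('n) - k" using Suc j by auto
    then have "quat_bundle Q k (int j - 1) = E_bundle Q (2 * k + i) i" "quat_op A Q k (int j) = D_op A Q (2 * k + i) i"
      using bundle_at oper Suc by auto
    then show ?thesis
      using principal_symbol_D_op[OF Q that]
      by (auto simp: Suc symbol_image_def symbol_map_def intro!: image_cong)
  qed
  have kernel: "{\<alpha> \<in> quat_bundle Q k (int j) x. principal_symbol A (quat_bundle Q k (int j)) (quat_op A Q k (int j + 1)) x \<xi> \<alpha> = (\<lambda>vs. 0)}
     = symbol_kernel Q k x \<xi> j" if "linear \<xi>" for x \<xi>
  proof -
    have "int j + 1 = int (Suc j)" by simp
    then show ?thesis
      using principal_symbol_D_op[OF Q that] principal_symbol_zero_op[OF that E_section_through[OF Q]]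
      unfolding bundle_at[OF j] \<open>int j + 1 = int (Suc j)\<close> oper
      by (auto simp: symbol_kernel_def symbol_map_def)
  qed
  show ?thesis
    unfolding elliptic_at_def
  proof (intro iff_allI imp_cong refl)
    fix x and \<xi> :: "'n qvec \<Rightarrow> real"
    assume "linear \<xi> \<and> \<xi> \<noteq> (\<lambda>v. 0)"
    then have "linear \<xi>" by simp
    then show "(principal_symbol A (quat_bundle Q k (int j - 1)) (quat_op A Q k (int j)) x \<xi> ` quat_bundle Q k (int j - 1) x =
        {\<alpha> \<in> quat_bundle Q k (int j) x. principal_symbol A (quat_bundle Q k (int j)) (quat_op A Q k (int j + 1)) x \<xi> \<alpha> = (\<lambda>vs. 0)})
      \<longleftrightarrow> symbol_image Q k x \<xi> j = symbol_kernel Q k x \<xi> j"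
      by (simp only: image kernel)
  qed
qed

lemma symbol_image_subset_kernel:
  assumes Q: "Sp1GLnH_structure A Q" and "linear \<xi>" "\<xi> \<noteq> (\<lambda>v. 0)" "j \<ge> 1"
  shows "symbol_image Q k x \<xi> j \<subseteq> symbol_kernel Q k x \<xi> j"
proof -
  obtain e u where "frame_covector_at e \<xi> u A Q x" using frame_covector_at_exists[OF assms(1-3)] by blast
  then interpret frame_covector_at e \<xi> u A Q x .
  obtain i where i: "j = Suc i" using assms(4) by (cases j) auto
  have m: "2 * k + i = i + 2 * k" by simp
  show ?thesis
    using symbol_map(1)[OF _ m] symbol_map_squared[OF _ m]
    by (auto simp: i symbol_image_def symbol_kernel_def)
qed

lemma symbol_kernel_subset_image:
  fixes Q :: "('a::topological_space, 'n::finite) frames"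
  assumes Q: "Sp1GLnH_structure A Q" and "linear \<xi>" "\<xi> \<noteq> (\<lambda>v. 0)"
    and "j \<ge> 1" "j \<ge> 2 \<or> k = 0" "j \<le> 2 * CARD('n) - k"
  shows "symbol_kernel Q k x \<xi> j \<subseteq> symbol_image Q k x \<xi> j"
proof -
  obtain e u where "frame_covector_at e \<xi> u A Q x" using frame_covector_at_exists[OF assms(1-3)] by blast
  then interpret frame_covector_at e \<xi> u A Q x .
  obtain i where i: "j = Suc i" using assms(4) by (cases j) auto
  show ?thesis
  proof
    fix \<alpha> assume \<alpha>: "\<alpha> \<in> symbol_kernel Q k x \<xi> j"
    have "\<alpha> \<in> symbol_map Q x \<xi> (2 * k + i) i ` E_bundle Q (2 * k + i) i x"
    proof (rule symbol_map_exact)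
      show "\<alpha> \<in> E_bundle Q (Suc (2 * k + i)) (Suc i) x" using \<alpha> by (simp add: symbol_kernel_def i)
      show "symbol_map Q x \<xi> (Suc (2 * k + i)) (Suc i) \<alpha> = (\<lambda>vs. 0) \<or> 4 * CARD('n) < 2 * k + i + i + 4"
        using \<alpha> assms(6) by (cases "j < 2 * CARD('n) - k") (auto simp: symbol_kernel_def i)
    qed (use assms(5) i in auto)
    then show "\<alpha> \<in> symbol_image Q k x \<xi> j" by (simp add: symbol_image_def i)
  qed
qed

lemma symbol_kernel_at_0:
  fixes Q :: "('a::topological_space, 'n::finite) frames"
  assumes Q: "Sp1GLnH_structure A Q" and "linear \<xi>" "\<xi> \<noteq> (\<lambda>v. 0)" "k \<le> 1"
  shows "symbol_image Q k x \<xi> 0 = symbol_kernel Q k x \<xi> 0"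
proof -
  obtain e u where "frame_covector_at e \<xi> u A Q x" using frame_covector_at_exists[OF assms(1-3)] by blast
  then interpret frame_covector_at e \<xi> u A Q x .
  have pos: "0 < 2 * CARD('n) - k" using assms(4) zero_less_card_finite[where 'a='n] by linarith
  have zero: "(\<lambda>vs. 0) \<in> E_bundle Q (2 * k) 0 x" unfolding E_eq by (rule zero_real_E)
  have "real_symbol 0 (\<lambda>vs. 0) (\<lambda>vs. 0)"
    by (simp add: real_symbol_def symbol_rel_def cform_of_zero subspace_0[OF subspace_isotypic] linear_0[OF linear_wedge])
  then have "symbol_map Q x \<xi> (2 * k) 0 (\<lambda>vs. 0) = (\<lambda>vs. 0)"
    using zero by (intro symbol_map_eqI[of _ _ _ k]) (auto simp: alternating_zero)
  then show ?thesis
    using zero pos symbol_map_injective[OF _ assms(4)]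
    by (auto simp: symbol_image_def symbol_kernel_def)
qed

theorem theorem5p1:
  fixes A :: "('a::{t2_space, second_countable_topology}, 'n::finite) chart set"
    and Q :: "('a, 'n) frames"
    and k :: nat
  assumes "quaternionic_manifold A Q"
    and "k \<le> 2 * CARD('n) - 1"
  shows
    "(2 * k \<ge> 4 \<longrightarrow> (\<forall>i\<in>{0..2 * int CARD('n) - int k}.
        elliptic_at A (quat_bundle Q k) (quat_op A Q k) i \<longleftrightarrow> i \<noteq> 0 \<and> i \<noteq> 1)) \<and>
     (k = 1 \<longrightarrow> (\<forall>i\<in>{0..2 * int CARD('n) - int k}.
        elliptic_at A (quat_bundle Q k) (quat_op A Q k) i \<longleftrightarrow> i \<noteq> 1)) \<and>
     (k = 0 \<longrightarrow> (\<forall>i\<in>{0..2 * int CARD('n) - int k}.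
        elliptic_at A (quat_bundle Q k) (quat_op A Q k) i))"
proof -
  have Q: "Sp1GLnH_structure A Q" and "smooth_atlas A"
    using assms(1) by (auto simp: quaternionic_manifold_def)
  then interpret manifold_atlas A by unfold_locales
  have k: "k < 2 * CARD('n)" using assms(2) zero_less_card_finite[where 'a='n] by linarith
  note iff = elliptic_at_iff[OF Q k]
  have elliptic: "elliptic_at A (quat_bundle Q k) (quat_op A Q k) (int j)"
    if "j \<ge> 1" "j \<ge> 2 \<or> k = 0" "j \<le> 2 * CARD('n) - k" for j
    unfolding iff[OF that(3)]
    using symbol_image_subset_kernel[OF Q _ _ that(1)] symbol_kernel_subset_image[OF Q _ _ that] by blast
  have elliptic_0: "elliptic_at A (quat_bundle Q k) (quat_op A Q k) (int 0)" if "k \<le> 1"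
    unfolding iff[of 0, OF le0] using symbol_kernel_at_0[OF Q _ _ that] by blast
  obtain e where e: "e \<in> Q undefined" using structure_frame[OF Q] by blast
  define \<xi> where "\<xi> = frame_covector e undefined 1"
  have \<xi>: "linear \<xi> \<and> \<xi> \<noteq> (\<lambda>v. 0)" using special_covector_nonzero[OF Q e] by (simp add: \<xi>_def)
  have not_elliptic_0: "\<not> elliptic_at A (quat_bundle Q k) (quat_op A Q k) (int 0)" if k2: "k \<ge> 2"
  proof -
    obtain b where "b \<in> E_bundle Q (2 * k) 0 undefined" "b \<noteq> (\<lambda>vs. 0)" "symbol_map Q undefined \<xi> (2 * k) 0 b = (\<lambda>vs. 0)"
      using kernel_at_0[OF Q e k2 less_imp_le[OF k]] unfolding \<xi>_def by blast
    then have "b \<in> symbol_kernel Q k undefined \<xi> 0" "b \<notin> symbol_image Q k undefined \<xi> 0"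
      by (auto simp: symbol_kernel_def symbol_image_def)
    then show ?thesis unfolding iff[of 0, OF le0] using \<xi> by blast
  qed
  have not_elliptic_1: "\<not> elliptic_at A (quat_bundle Q k) (quat_op A Q k) (int 1)" if k1: "k \<ge> 1"
  proof -
    obtain f where "f \<in> E_bundle Q (2 * k + 1) 1 undefined" "symbol_map Q undefined \<xi> (2 * k + 1) 1 f = (\<lambda>vs. 0)"
      "f \<notin> symbol_map Q undefined \<xi> (2 * k) 0 ` E_bundle Q (2 * k) 0 undefined"
      using homology_at_1[OF Q e k1 k] unfolding \<xi>_def by blast
    then have "f \<in> symbol_kernel Q k undefined \<xi> 1" "f \<notin> symbol_image Q k undefined \<xi> 1"
      by (auto simp: symbol_kernel_def symbol_image_def)
    moreover have "1 \<le> 2 * CARD('n) - k" using k by simp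
    ultimately show ?thesis unfolding iff[of 1, OF \<open>1 \<le> 2 * CARD('n) - k\<close>] using \<xi> by blast
  qed
  have pos: "\<exists>j. i = int j \<and> j \<le> 2 * CARD('n) - k" if "i \<in> {0..2 * int CARD('n) - int k}" for i
    using that k by (intro exI[of _ "nat i"]) auto
  have cases_i: "elliptic_at A (quat_bundle Q k) (quat_op A Q k) i \<longleftrightarrow> (i = 0 \<longrightarrow> k \<le> 1) \<and> (i = 1 \<longrightarrow> k = 0)"
    if i: "i \<in> {0..2 * int CARD('n) - int k}" for i
  proof -
    obtain j where j: "i = int j" "j \<le> 2 * CARD('n) - k" using pos[OF i] by blast
    consider "j = 0" | "j = 1" | "j \<ge> 2" by linarith
    then show ?thesis
    proof cases
      case 1 then show ?thesis using elliptic_0 not_elliptic_0 j by (cases "k \<le> 1") auto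
    next
      case 2 then show ?thesis using elliptic[of 1] not_elliptic_1 j by (cases "k = 0") auto
    next
      case 3 then show ?thesis using elliptic[of j] j by auto
    qed
  qed
  show ?thesis
  proof (intro conjI impI ballI)
    fix i assume i: "i \<in> {0..2 * int CARD('n) - int k}"
    show "elliptic_at A (quat_bundle Q k) (quat_op A Q k) i \<longleftrightarrow> i \<noteq> 0 \<and> i \<noteq> 1" if "2 * k \<ge> 4"
      using cases_i[OF i] that by auto
    show "elliptic_at A (quat_bundle Q k) (quat_op A Q k) i \<longleftrightarrow> i \<noteq> 1" if "k = 1"
      using cases_i[OF i] that by auto
    show "elliptic_at A (quat_bundle Q k) (quat_op A Q k) i" if "k = 0"
      using cases_i[OF i] that by auto
  qed
qed

end
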